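(* Assume the following. (i) $s_\star:\mathbb{R}\to\mathbb{R}$ is a (non-constant) periodic function with finite fundamental frequency $f_\star$ (so $1/f_\star$ is the smallest positive period of $s_\star$). (ii) $X_j=\sum_{k=1}^j V_k$, where $(V_k)_{k\ge1}$ is an i.i.d. sequence of non-negative random variables with finite mean, and, with $\Phi(t)=\mathbb{E}[\exp(\mathrm{i}tV_1)]$, one has $\sup_{|t|\ge\epsilon}|\Phi(t)|<1$ for all $\epsilon>0$. (iii) $(\varepsilon_j)_{j\ge 1}$ are i.i.d. zero-mean Gaussian random variables with variance $\sigma_\star^2>0$, independent of $(X_j)_{j\ge1}$. Let $Y_j=s_\star(X_j)+\varepsilon_j$, $j\geq 1$. Let $(K_n)$ be a sequence of positive integers tending to infinity such that, for some $\beta>0$, $$\lim_{n\to\infty}K_n\left\{R(n^\beta)+n^{-1/2+\beta}\right\}=0,\qquad\text{where } R(m)=\sum_{|k|>m}|c_k(s_\star)|,\ m\ge0.$$ Let $0<f_{\min}<f_{\max}$ be such that there is a unique number $f\in[f_{\min},f_{\max}]$ for which $s_\star$ is $1/f$-periodic, and denote this number by $f_0$. Let $\hat f_n\in[f_{\min},f_{\max}]$ be defined by $$\Lambda_n(\hat f_n)=\sup_{f\in[f_{\min},f_{\max}]}\Lambda_n(f),\qquad \Lambda_n(f)=\frac1{n^2}\sum_{k=1}^{K_n}\left|\sum_{j=1}^nY_j\,e^{-2\mathrm{i}k\pi fX_j}\right|^2 .$$ Then, for any $\alpha>0$, $$\hat f_n=f_0+o_p(n^{-1+\alpha})\quad\text{as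 } n\to\infty.$$ If in addition $\mathbb{E}(V_1^2)$ is finite, then $$n(\hat f_n-f_0)\to0\quad\text{almost surely}.$$
   Context: For a locally integrable $T$-periodic function $s$, its Fourier coefficients are $c_k(s)=\frac1T\int_0^Ts(t)e^{-2\mathrm{i}k\pi t/T}\,dt$, $k\in\mathbb{Z}$. Here $c_k(s_\star)$ is taken with $T=1/f_\star$. It is understood that $s_\star$ is locally integrable and equals its Fourier expansion $s_\star(t)=\sum_{p\in\mathbb{Z}}c_p(s_\star)e^{2\mathrm{i}\pi pt/T}$ for every $t$ (the condition on $(K_n)$ implies that this series converges absolutely). The notation $o_p(a_n)$ means a random quantity which, divided by $a_n$, tends to $0$ in probability. *)

theory Defs
  imports "HOL-Probability.Probability"
begin

definition has_period :: "(real \<Rightarrow> real) \<Rightarrow> real \<Rightarrow> bool" where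
  "has_period s T \<longleftrightarrow> (\<forall>t. s (t + T) = s t)"

definition fundamental_frequency :: "(real \<Rightarrow> real) \<Rightarrow> real \<Rightarrow> bool" where
  "fundamental_frequency s f \<longleftrightarrow>
     f > 0 \<and> has_period s (1 / f) \<and> (\<forall>T>0. has_period s T \<longrightarrow> 1 / f \<le> T)"

definition locally_integrable :: "(real \<Rightarrow> real) \<Rightarrow> bool" where
  "locally_integrable s \<longleftrightarrow> (\<forall>a b. set_integrable lebesgue {a..b} s)"

definition fourier_coeff :: "real \<Rightarrow> (real \<Rightarrow> real) \<Rightarrow> int \<Rightarrow> complex" where
  "fourier_coeff T s k =
     complex_of_real (1 / T) *
     (LINT t:{0..T}|lebesgue. complex_of_real (s t) * cis (- 2 * of_int k * pi * t / T))"

text \<open>The tail is valued in \<^typ>\<open>ennreal\<close>, so that a divergent series has the value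
  \<open>\<infinity>\<close> and not the default value \<open>0\<close> of real-valued infinite sums.\<close>

definition fourier_tail :: "real \<Rightarrow> (real \<Rightarrow> real) \<Rightarrow> real \<Rightarrow> ennreal" where
  "fourier_tail T s m =
     (\<Sum>\<^sub>\<infinity>k\<in>{k::int. \<bar>real_of_int k\<bar> > m}. ennreal (cmod (fourier_coeff T s k)))"

definition cumulated_periodogram ::
    "nat \<Rightarrow> nat \<Rightarrow> (nat \<Rightarrow> real) \<Rightarrow> (nat \<Rightarrow> real) \<Rightarrow> real \<Rightarrow> real" where
  "cumulated_periodogram K n x y f =
     1 / (real n)\<^sup>2 *
     (\<Sum>k=1..K. (cmod (\<Sum>j=1..n. complex_of_real (y j) * cis (- 2 * real k * pi * f * x j)))\<^sup>2)"

text \<open>\<open>Z n = o\<^sub>p(a n)\<close> under \<open>M\<close>. It is meaningful only for measurable \<open>Z n\<close>, since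
  \<^const>\<open>measure\<close> is \<open>0\<close> on sets that are not measurable.\<close>

definition small_o_p ::
    "'a measure \<Rightarrow> (nat \<Rightarrow> 'a \<Rightarrow> real) \<Rightarrow> (nat \<Rightarrow> real) \<Rightarrow> bool" where
  "small_o_p M Z a \<longleftrightarrow>
     (\<forall>\<delta>>0. (\<lambda>n. measure M {\<omega> \<in> space M. \<bar>Z n \<omega> / a n\<bar> > \<delta>}) \<longlonglongrightarrow> 0)"

end

theory Submission
  imports Defs "HOL-Real_Asymp.Real_Asymp"
begin

text \<open>Write \<open>S\<^sub>n(t)\<close> for the mean of \<open>cis (t X\<^sub>j)\<close> and \<open>N\<^sub>n(t)\<close> for the mean of \<open>\<epsilon>\<^sub>j cis (t X\<^sub>j)\<close> over
\<open>1 \<le> j \<le> n\<close>. Inserting the Fourier expansion of the signal, the cumulated periodogram at \<open>f\<close> is the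
sum over \<open>1 \<le> k \<le> K\<^sub>n\<close> of the squared moduli of

  \<open>\<Sum>\<^sub>p c\<^sub>p S\<^sub>n(2\<pi>(p f\<^sub>\<star> - k f)) + N\<^sub>n(- 2\<pi>k f)\<close>.

The sampling instants form a random walk, and \<open>S\<^sub>n\<close> behaves like the indicator of \<open>0\<close>. The proof
separates what happens on one trajectory of the walk from what almost every trajectory satisfies.

One trajectory. Suppose that \<open>S\<^sub>n(t)\<close> away from \<open>t = 0\<close> and \<open>N\<^sub>n\<close> are of order \<open>n\<^bsup>-1/4\<^esup>\<close>, uniformly for
\<open>t \<le> n\<close>. Then only resonant pairs \<open>(p, k)\<close>, those with \<open>p f\<^sub>\<star>\<close> close to \<open>k f\<close>, matter: the condition on
\<open>K\<^sub>n\<close> ensures that everything else has Euclidean norm \<open>o(1)\<close> as a vector indexed by \<open>k\<close>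
(\<open>perturbation_tendsto_0\<close>). Each \<open>k\<close> resonates with at most one \<open>p\<close> and conversely, so the resonant
energy never exceeds \<open>\<Sum>\<^bsub>p\<ge>1\<^esub> |c\<^sub>p|\<^sup>2\<close>, and \<open>f\<^sub>0 = f\<^sub>\<star>/l\<close> attains this bound in the limit. Since \<open>f\<^sub>\<star>\<close> is the
fundamental frequency, the indices of the nonzero harmonics have greatest common divisor 1, and
finitely many of them already satisfy a Bezout identity. A maximizer \<open>f\<close> cannot afford to lose any of
these finitely many harmonics, so \<open>|S\<^sub>n|\<close> is close to \<open>1\<close> at each of the corresponding points
\<open>2\<pi>(p f\<^sub>\<star> - k\<^sub>p f)\<close>; if \<open>|S\<^sub>n(t)| \<le> 1 - \<kappa>\<close> for \<open>t \<ge> r\<^sub>n\<close>, these points are smaller than \<open>r\<^sub>n\<close>. The Bezout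
combination turns this into \<open>f\<^sub>\<star> = m f + O(r\<^sub>n)\<close> with an integer \<open>m\<close>, and uniqueness of \<open>f\<^sub>0\<close> in the
window forces \<open>m = l\<close>, so \<open>f = f\<^sub>0 + O(r\<^sub>n)\<close>. This is \<open>maximizer_localized\<close>.

Almost every trajectory. It remains to find sequences \<open>r\<^sub>n\<close> for which \<open>|S\<^sub>n|\<close> is bounded away from 1 on
\<open>[r\<^sub>n, n]\<close>. With \<open>\<phi>\<close> the characteristic function of the steps, the sums of
\<open>cis (t X\<^bsub>j-1\<^esub>) (cis (t V\<^sub>j) - \<phi>(t))\<close> form a martingale whose increments have variance at most
\<open>2 |1 - \<phi>(t)|\<close> and which equals \<open>(1 - \<phi>(t)) n S\<^sub>n(t)\<close> up to a bounded term. A Bernstein argument gives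
\<open>P(|S\<^sub>n(t)| > y) \<le> 12 exp (- n |1 - \<phi>(t)| y\<^sup>2 / 32)\<close> (\<open>walk_trig_mean_tail\<close>). As steps have positive mean
and \<open>|\<phi>|\<close> stays away from 1 outside neighbourhoods of \<open>0\<close>, \<open>|1 - \<phi>(t)| \<ge> c min(t, 1)\<close>. It is the factor
\<open>|1 - \<phi>(t)|\<close>, linear in \<open>t\<close> for small \<open>t\<close>, that makes the bound effective down to \<open>t = n\<^bsup>-1+\<alpha>\<^esup>\<close>. A union bound over
a polynomial grid and the Borel-Cantelli lemma make it uniform in \<open>t\<close>
(\<open>trig_mean_uniformly_small\<close>); this yields the choice \<open>r\<^sub>n = n\<^bsup>-1+\<alpha>\<^esup>\<close> and the first assertion. If the
steps are square integrable, then \<open>X\<^sub>j = \<mu> j\<close> up to an error so small that for \<open>t \<le> n\<^bsup>-1+1/16\<^esup>\<close> the mean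
\<open>S\<^sub>n(t)\<close> is asymptotically the normalized Dirichlet kernel at \<open>\<mu> t\<close>, which is bounded away from 1 in
modulus as soon as \<open>n t\<close> is bounded away from \<open>0\<close>. So every \<open>r\<^sub>n = \<epsilon>/n\<close> is admissible (\<open>AE_S_contraction\<close>), which
is the second assertion.\<close>

section \<open>Exponential moments and tails\<close>

definition trig_mean :: "(nat \<Rightarrow> real) \<Rightarrow> (nat \<Rightarrow> real) \<Rightarrow> nat \<Rightarrow> real \<Rightarrow> complex" where
  "trig_mean b x n t = (\<Sum>j=1..n. of_real (b j) * cis (t * x j)) / of_nat n"

text \<open>Conditioning without conditional expectations: for independent variables, a bound on the integral
over one of them, with the other frozen, may be integrated. It is applied to a step of the walk given
the past, and to the noise given the walk.\<close>
lemma (in prob_space) indep_var_nn_integral_le: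
  assumes ind: "indep_var T B S A"
    and F [measurable]: "F \<in> borel_measurable (T \<Otimes>\<^sub>M S)"
    and G [measurable]: "G \<in> borel_measurable S"
    and le: "\<And>a. a \<in> space S \<Longrightarrow> (\<integral>\<^sup>+\<omega>. F (B \<omega>, a) \<partial>M) \<le> G a"
  shows "(\<integral>\<^sup>+\<omega>. F (B \<omega>, A \<omega>) \<partial>M) \<le> (\<integral>\<^sup>+\<omega>. G (A \<omega>) \<partial>M)"
proof -
  have A [measurable]: "random_variable S A" and B [measurable]: "random_variable T B"
    using ind by (blast dest: indep_var_rv1 indep_var_rv2)+
  interpret A: prob_space "distr M S A" by (rule prob_space_distr) fact
  interpret B: prob_space "distr M T B" by (rule prob_space_distr) fact
  interpret P: pair_sigma_finite "distr M T B" "distr M S A" ..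
  have "(\<integral>\<^sup>+\<omega>. F (B \<omega>, A \<omega>) \<partial>M) = (\<integral>\<^sup>+p. F p \<partial>distr M (T \<Otimes>\<^sub>M S) (\<lambda>\<omega>. (B \<omega>, A \<omega>)))"
    by (subst nn_integral_distr) auto
  also have "\<dots> = (\<integral>\<^sup>+p. F p \<partial>(distr M T B \<Otimes>\<^sub>M distr M S A))"
    using ind by (simp add: indep_var_distribution_eq)
  also have "\<dots> = (\<integral>\<^sup>+a. \<integral>\<^sup>+b. F (b, a) \<partial>distr M T B \<partial>distr M S A)"
    by (subst P.nn_integral_snd) auto
  also have "\<dots> \<le> (\<integral>\<^sup>+a. G a \<partial>distr M S A)"
  proof (rule nn_integral_mono)
    fix a assume "a \<in> space (distr M S A)"
    then have a [measurable]: "a \<in> space S" by simp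
    have "(\<integral>\<^sup>+b. F (b, a) \<partial>distr M T B) = (\<integral>\<^sup>+\<omega>. F (B \<omega>, a) \<partial>M)"
      by (subst nn_integral_distr) auto
    then show "(\<integral>\<^sup>+b. F (b, a) \<partial>distr M T B) \<le> G a" using le[OF a] by simp
  qed
  also have "\<dots> = (\<integral>\<^sup>+\<omega>. G (A \<omega>) \<partial>M)"
    by (subst nn_integral_distr) auto
  finally show ?thesis .
qed

text \<open>The inequality behind Bernstein's bound. For negative \<open>x\<close>, multiply by \<open>1 - x \<le> exp (- x)\<close>:
\<open>(1 + x + x\<^sup>2)(1 - x) = 1 - x\<^sup>3 \<ge> 1\<close>.\<close>
lemma exp_le_quadratic:
  fixes x :: real
  assumes "\<bar>x\<bar> \<le> 1"
  shows "exp x \<le> 1 + x + x\<^sup>2"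
proof (cases "x \<ge> 0")
  case True
  then show ?thesis using exp_bound assms by auto
next
  case False
  have "1 \<le> (1 + x + x\<^sup>2) * (1 - x)"
  proof -
    have "(1 + x + x\<^sup>2) * (1 - x) = 1 - x * x\<^sup>2" by (simp add: algebra_simps power2_eq_square)
    moreover have "x * x\<^sup>2 \<le> 0" using False by (simp add: mult_nonpos_nonneg)
    ultimately show ?thesis by simp
  qed
  also have "\<dots> \<le> (1 + x + x\<^sup>2) * exp (- x)"
  proof (rule mult_left_mono)
    show "1 - x \<le> exp (- x)" using exp_ge_add_one_self[of "-x"] by simp
    show "0 \<le> 1 + x + x\<^sup>2" using assms by (auto simp: abs_if split: if_splits)
  qed
  finally show ?thesis by (simp add: exp_minus field_simps)
qed

text \<open>Bernstein's estimate for one step. The exponent has mean zero and absolute value at most 1, and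
its second moment is at most \<open>l\<^sup>2 (1 - |\<phi>|\<^sup>2) \<le> 2 l\<^sup>2 |1 - \<phi>|\<close>. Keeping \<open>|1 - \<phi>|\<close> instead of a
constant is what later allows frequencies as low as \<open>n\<^bsup>-1+\<alpha>\<^esup>\<close>.\<close>
lemma (in prob_space) exp_moment_centred_phase:
  fixes V :: "'a \<Rightarrow> real" and z \<phi> :: complex
  assumes V [measurable]: "random_variable borel V"
    and \<phi>: "\<phi> = expectation (\<lambda>\<omega>. cis (t * V \<omega>))"
    and z: "cmod z = 1" and l: "0 \<le> l" "l \<le> 1/2"
  shows "(\<integral>\<^sup>+\<omega>. ennreal (exp (l * Re (z * (cis (t * V \<omega>) - \<phi>)))) \<partial>M)
           \<le> ennreal (exp (2 * l\<^sup>2 * cmod (1 - \<phi>)))"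
proof -
  have [measurable]: "(\<lambda>\<omega>. cis (t * V \<omega>)) \<in> borel_measurable M"
    by (simp add: cis_conv_exp)
  have intc [simp]: "integrable M (\<lambda>\<omega>. cis (t * V \<omega>))"
    by (rule integrable_const_bound[where B=1]) auto
  have \<phi>1: "cmod \<phi> \<le> 1"
  proof -
    have "cmod \<phi> \<le> expectation (\<lambda>\<omega>. cmod (cis (t * V \<omega>)))" unfolding \<phi> by (rule integral_norm_bound)
    then show ?thesis by (simp add: prob_space)
  qed
  define D where "D \<omega> = cis (t * V \<omega>) - \<phi>" for \<omega>
  have Dm [measurable]: "D \<in> borel_measurable M" unfolding D_def by measurable
  have D2: "cmod (D \<omega>) \<le> 2" for \<omega>
    unfolding D_def using norm_triangle_ineq4[of "cis (t * V \<omega>)" \<phi>] \<phi>1 by simp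
  define U where "U \<omega> = l * Re (z * D \<omega>)" for \<omega>
  have Um [measurable]: "U \<in> borel_measurable M" unfolding U_def by measurable
  have Ub: "\<bar>U \<omega>\<bar> \<le> l * cmod (D \<omega>)" for \<omega>
    unfolding U_def using abs_Re_le_cmod[of "z * D \<omega>"] z l by (simp add: abs_mult norm_mult mult_left_mono)
  have U1: "\<bar>U \<omega>\<bar> \<le> 1" for \<omega>
    using Ub[of \<omega>] mult_mono[OF l(2) D2[of \<omega>]] by simp
  have intU [simp]: "integrable M U"
    by (rule integrable_const_bound[where B=1]) (use U1 in auto)
  have U2: "(U \<omega>)\<^sup>2 \<le> 1" for \<omega> using U1[of \<omega>] by (simp add: abs_square_le_1)
  have intU2 [simp]: "integrable M (\<lambda>\<omega>. (U \<omega>)\<^sup>2)"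
    by (rule integrable_const_bound[where B=1]) (use U2 in auto)
  have ED: "expectation D = 0"
    unfolding D_def by (simp add: \<phi>[symmetric] prob_space)
  have intD [simp]: "integrable M D" unfolding D_def by simp
  have EU: "expectation U = 0"
  proof -
    have "expectation U = l * Re (expectation (\<lambda>\<omega>. z * D \<omega>))"
      unfolding U_def by (subst integral_Re[symmetric]) auto
    also have "\<dots> = 0" by (simp add: ED)
    finally show ?thesis .
  qed
  have D2e: "(cmod (D \<omega>))\<^sup>2 = 1 + (cmod \<phi>)\<^sup>2 - 2 * Re (cnj \<phi> * cis (t * V \<omega>))" for \<omega>
    unfolding D_def cmod_power2 using sin_cos_squared_add3[of "t * V \<omega>"]
    by (simp add: power2_eq_square algebra_simps)
  have EU2: "expectation (\<lambda>\<omega>. (U \<omega>)\<^sup>2) \<le> 2 * l\<^sup>2 * cmod (1 - \<phi>)"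
  proof -
    have "expectation (\<lambda>\<omega>. (U \<omega>)\<^sup>2) \<le> expectation (\<lambda>\<omega>. l\<^sup>2 * (1 + (cmod \<phi>)\<^sup>2 - 2 * Re (cnj \<phi> * cis (t * V \<omega>))))"
    proof (rule integral_mono)
      show "(U \<omega>)\<^sup>2 \<le> l\<^sup>2 * (1 + (cmod \<phi>)\<^sup>2 - 2 * Re (cnj \<phi> * cis (t * V \<omega>)))" for \<omega>
      proof -
        have "(U \<omega>)\<^sup>2 \<le> (l * cmod (D \<omega>))\<^sup>2" using Ub[of \<omega>] abs_le_square_iff l by fastforce
        then show ?thesis by (simp add: power_mult_distrib D2e)
      qed
      have "integrable M (\<lambda>\<omega>. Re (cnj \<phi> * cis (t * V \<omega>)))"
        by (intro integrable_Re) auto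
      then show "integrable M (\<lambda>\<omega>. l\<^sup>2 * (1 + (cmod \<phi>)\<^sup>2 - 2 * Re (cnj \<phi> * cis (t * V \<omega>))))"
        by (simp del: times_complex.simps)
    qed simp
    also have "\<dots> = l\<^sup>2 * (1 - (cmod \<phi>)\<^sup>2)"
    proof -
      define h where "h \<omega> = Re (cnj \<phi> * cis (t * V \<omega>))" for \<omega>
      have "expectation h = Re (expectation (\<lambda>\<omega>. cnj \<phi> * cis (t * V \<omega>)))"
        unfolding h_def by (subst integral_Re) auto
      also have "\<dots> = (cmod \<phi>)\<^sup>2" unfolding cmod_power2 by (simp add: \<phi> power2_eq_square)
      finally have "expectation h = (cmod \<phi>)\<^sup>2" .
      moreover have "integrable M h" unfolding h_def by (intro integrable_Re) auto
      ultimately show ?thesis unfolding h_def[symmetric] by (simp add: prob_space)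
    qed
    also have "\<dots> \<le> l\<^sup>2 * (2 * cmod (1 - \<phi>))"
    proof (rule mult_left_mono)
      have a: "1 - cmod \<phi> \<le> cmod (1 - \<phi>)" using norm_triangle_ineq2[of 1 \<phi>] by simp
      have "1 - (cmod \<phi>)\<^sup>2 = (1 - cmod \<phi>) * (1 + cmod \<phi>)" by (simp add: power2_eq_square algebra_simps)
      also have "\<dots> \<le> (1 - cmod \<phi>) * 2" using \<phi>1 by (intro mult_left_mono) auto
      finally show "1 - (cmod \<phi>)\<^sup>2 \<le> 2 * cmod (1 - \<phi>)" using a by simp
    qed simp
    finally show ?thesis by (simp add: mult_ac)
  qed
  have "(\<integral>\<^sup>+\<omega>. ennreal (exp (U \<omega>)) \<partial>M) \<le> (\<integral>\<^sup>+\<omega>. ennreal (1 + U \<omega> + (U \<omega>)\<^sup>2) \<partial>M)"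
    by (intro nn_integral_mono ennreal_leI exp_le_quadratic U1)
  also have "\<dots> = ennreal (expectation (\<lambda>\<omega>. 1 + U \<omega> + (U \<omega>)\<^sup>2))"
  proof (rule nn_integral_eq_integral)
    have "0 \<le> 1 + U \<omega> + (U \<omega>)\<^sup>2" for \<omega>
      using exp_le_quadratic[OF U1[of \<omega>]] exp_ge_zero[of "U \<omega>"] by linarith
    then show "AE \<omega> in M. 0 \<le> 1 + U \<omega> + (U \<omega>)\<^sup>2" by simp
  qed auto
  also have "expectation (\<lambda>\<omega>. 1 + U \<omega> + (U \<omega>)\<^sup>2) = 1 + expectation (\<lambda>\<omega>. (U \<omega>)\<^sup>2)"
    by (simp add: EU prob_space)
  also have "ennreal \<dots> \<le> ennreal (exp (2 * l\<^sup>2 * cmod (1 - \<phi>)))"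
    using EU2 exp_ge_add_one_self[of "2 * l\<^sup>2 * cmod (1 - \<phi>)"] by (intro ennreal_leI) linarith
  finally show ?thesis unfolding U_def D_def .
qed

text \<open>Reduces deviations of a complex variable to real exponential moments of four rotations of it.\<close>
lemma cmod_gt_imp_rotation:
  assumes "cmod z > 2 * r"
  shows "\<exists>u\<in>{1, -1, \<i>, -\<i>}. Re (u * z) \<ge> r"
proof (rule ccontr)
  assume "\<not> ?thesis"
  then have "Re z < r" "- Re z < r" "Im z < r" "- Im z < r" by (auto simp: not_le)
  then have "\<bar>Re z\<bar> + \<bar>Im z\<bar> < 2 * r" by linarith
  then show False using cmod_le[of z] assms by linarith
qed

lemma (in prob_space) complex_tail_from_exp_moment:
  fixes Z :: "'a \<Rightarrow> complex"
  assumes [measurable]: "random_variable borel Z" and l: "l > 0"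
    and mgf: "\<And>u. cmod u = 1 \<Longrightarrow> (\<integral>\<^sup>+\<omega>. ennreal (exp (l * Re (u * Z \<omega>))) \<partial>M) \<le> ennreal B"
  shows "prob {\<omega>\<in>space M. cmod (Z \<omega>) > 2 * r} \<le> 4 * (exp (- l * r) * B)"
proof -
  have B: "B \<ge> 0"
  proof (rule ccontr)
    assume "\<not> B \<ge> 0"
    then have "(\<integral>\<^sup>+\<omega>. ennreal (exp (l * Re (1 * Z \<omega>))) \<partial>M) = 0"
      using mgf[of 1] by (simp add: ennreal_neg)
    then have "AE \<omega> in M. ennreal (exp (l * Re (1 * Z \<omega>))) = 0"
      by (subst (asm) nn_integral_0_iff_AE) auto
    then show False by simp
  qed
  let ?E = "\<lambda>u. {\<omega>\<in>space M. Re (u * Z \<omega>) \<ge> r}"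
  have 1: "prob (?E u) \<le> exp (- l * r) * B" if u: "cmod u = 1" for u
  proof -
    have "ennreal (prob (?E u)) = emeasure M (?E u)" by (simp add: emeasure_eq_measure)
    also have "\<dots> \<le> ennreal (exp (- l * r)) * (\<integral>\<^sup>+\<omega>\<in>space M. ennreal (exp (l * Re (u * Z \<omega>))) \<partial>M)"
      using Chernoff_ineq_nn_integral_ge[OF l, of "space M" M "\<lambda>\<omega>. Re (u * Z \<omega>)" r] by simp
    also have "(\<integral>\<^sup>+\<omega>\<in>space M. ennreal (exp (l * Re (u * Z \<omega>))) \<partial>M) = (\<integral>\<^sup>+\<omega>. ennreal (exp (l * Re (u * Z \<omega>))) \<partial>M)"
      by (intro nn_integral_cong) auto
    also have "ennreal (exp (- l * r)) * \<dots> \<le> ennreal (exp (- l * r)) * ennreal B"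
      by (intro mult_left_mono mgf u) auto
    also have "\<dots> = ennreal (exp (- l * r) * B)" using B by (simp add: ennreal_mult)
    finally show ?thesis using B by (subst (asm) ennreal_le_iff) auto
  qed
  have "prob {\<omega>\<in>space M. cmod (Z \<omega>) > 2 * r} \<le> prob (\<Union>u\<in>{1, -1, \<i>, -\<i>}. ?E u)"
  proof (rule finite_measure_mono)
    show "{\<omega>\<in>space M. cmod (Z \<omega>) > 2 * r} \<subseteq> (\<Union>u\<in>{1, -1, \<i>, -\<i>}. ?E u)"
      using cmod_gt_imp_rotation by blast
    show "(\<Union>u\<in>{1, -1, \<i>, -\<i>}. ?E u) \<in> events" by (rule sets.finite_UN) auto
  qed
  also have "\<dots> \<le> (\<Sum>u\<in>{1, -1, \<i>, -\<i>}. prob (?E u))"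
    by (rule finite_measure_subadditive_finite) auto
  also have "\<dots> \<le> (\<Sum>u\<in>{1, -1, \<i>, -\<i>}. exp (- l * r) * B)"
  proof (rule sum_mono)
    fix u :: complex assume "u \<in> {1, -1, \<i>, -\<i>}"
    then have "cmod u = 1" by auto
    then show "prob (?E u) \<le> exp (- l * r) * B" by (rule 1)
  qed
  also have "\<dots> = real (card {1, -1, \<i>, -\<i>}) * (exp (- l * r) * B)" by simp
  also have "\<dots> \<le> 4 * (exp (- l * r) * B)"
    by (intro mult_right_mono) (use B card_insert_le_m1 in \<open>auto simp: card_insert_if\<close>)
  finally show ?thesis .
qed

definition walk :: "(nat \<Rightarrow> real) \<Rightarrow> nat \<Rightarrow> real" where
  "walk v j = (\<Sum>k=1..j. v k)"

text \<open>When the \<open>v j\<close> are independent with \<open>\<phi> = E cis (t v\<^sub>j)\<close>, each summand has mean zero given the previous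
\<open>v\<close>, so the partial sums form a martingale.\<close>
definition phase_martingale :: "complex \<Rightarrow> real \<Rightarrow> (nat \<Rightarrow> real) \<Rightarrow> nat \<Rightarrow> complex" where
  "phase_martingale \<phi> t v n = (\<Sum>j=1..n. cis (t * walk v (j - 1)) * (cis (t * v j) - \<phi>))"

lemma phase_martingale_Suc:
  "phase_martingale \<phi> t v (Suc n) = phase_martingale \<phi> t v n + cis (t * walk v n) * (cis (t * v (Suc n)) - \<phi>)"
  by (simp add: phase_martingale_def)

text \<open>Summation by parts: the martingale controls the exponential sum of the walk, up to a bounded
boundary term and the factor \<open>1 - \<phi>\<close>.\<close>
lemma phase_martingale_eq:
  "phase_martingale \<phi> t v n =
     (1 - \<phi>) * (\<Sum>j=1..n. cis (t * walk v j)) + \<phi> * (cis (t * walk v n) - 1)"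
proof (induction n)
  case 0
  then show ?case by (simp add: phase_martingale_def walk_def)
next
  case (Suc n)
  have "cis (t * walk v (Suc n)) = cis (t * walk v n) * cis (t * v (Suc n))"
    by (simp add: walk_def cis_mult distrib_left)
  then show ?case unfolding phase_martingale_Suc Suc by (simp add: algebra_simps)
qed

lemma borel_measurable_cis [measurable]:
  "f \<in> borel_measurable M \<Longrightarrow> (\<lambda>x. cis (f x)) \<in> borel_measurable M"
  unfolding cis_conv_exp by measurable

lemma measurable_walk [measurable (raw)]:
  "(\<And>k. k \<in> {1..j} \<Longrightarrow> (\<lambda>x. v x k) \<in> borel_measurable N) \<Longrightarrow> (\<lambda>x. walk (v x) j) \<in> borel_measurable N"
  unfolding walk_def by (rule borel_measurable_sum) auto

lemma measurable_phase_martingale [measurable (raw)]: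
  assumes [measurable]: "\<And>k. k \<in> {1..n} \<Longrightarrow> (\<lambda>x. v x k) \<in> borel_measurable N"
  shows "(\<lambda>x. phase_martingale \<phi> t (v x) n) \<in> borel_measurable N"
  unfolding phase_martingale_def
proof (rule borel_measurable_sum)
  fix j assume j: "j \<in> {1..n}"
  have [measurable]: "(\<lambda>x. walk (v x) (j - 1)) \<in> borel_measurable N" "(\<lambda>x. v x j) \<in> borel_measurable N"
    by (rule measurable_walk, rule assms, use j in auto)
  show "(\<lambda>x. cis (t * walk (v x) (j - 1)) * (cis (t * v x j) - \<phi>)) \<in> borel_measurable N"
    by measurable
qed

text \<open>Induction on \<open>n\<close>: the new increment is integrated first, with the earlier steps frozen.\<close>
lemma (in prob_space) phase_martingale_exp_moment:
  fixes V :: "nat \<Rightarrow> 'a \<Rightarrow> real"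
  assumes ind: "indep_vars (\<lambda>_. borel) V {1..}"
    and \<phi>: "\<And>k. k \<ge> 1 \<Longrightarrow> expectation (\<lambda>\<omega>. cis (t * V k \<omega>)) = \<phi>"
    and u: "cmod u = 1" and l: "0 \<le> l" "l \<le> 1/2"
  shows "(\<integral>\<^sup>+\<omega>. ennreal (exp (l * Re (u * phase_martingale \<phi> t (\<lambda>k. V k \<omega>) n))) \<partial>M)
           \<le> ennreal (exp (2 * l\<^sup>2 * cmod (1 - \<phi>) * n))"
proof (induction n)
  case 0
  then show ?case by (simp add: phase_martingale_def emeasure_space_1)
next
  case (Suc n)
  have Vm: "random_variable borel (V k)" if "k \<ge> 1" for k
    using ind that by (auto simp: indep_vars_def)
  let ?S = "PiM {1..n} (\<lambda>_. borel :: real measure)"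
  define A where "A = (\<lambda>\<omega>. restrict (\<lambda>i. V i \<omega>) {1..n})"
  let ?T = "PiM {Suc n} (\<lambda>_. borel :: real measure)"
  define B where "B = (\<lambda>\<omega>. restrict (\<lambda>i. V i \<omega>) {Suc n})"
  have iv: "indep_var ?T B ?S A"
    unfolding A_def B_def by (rule indep_var_restrict[OF ind]) auto
  let ?w = "2 * l\<^sup>2 * cmod (1 - \<phi>)"
  define F where "F = (\<lambda>(b, v). ennreal (exp (l * Re (u * phase_martingale \<phi> t v n))) *
      ennreal (exp (l * Re (u * cis (t * walk v n) * (cis (t * b (Suc n)) - \<phi>)))))"
  define G where "G = (\<lambda>v. ennreal (exp (l * Re (u * phase_martingale \<phi> t v n))) * ennreal (exp ?w))"
  have [measurable]: "(\<lambda>v. phase_martingale \<phi> t v n) \<in> borel_measurable ?S"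
    "(\<lambda>v. walk v n) \<in> borel_measurable ?S"
    by (auto intro!: measurable_phase_martingale measurable_walk)
  have [measurable]: "(\<lambda>b. b (Suc n)) \<in> borel_measurable ?T" by simp
  have Bn [simp]: "B \<omega> (Suc n) = V (Suc n) \<omega>" for \<omega> by (simp add: B_def)
  have Fm: "F \<in> borel_measurable (?T \<Otimes>\<^sub>M ?S)" unfolding F_def by measurable
  have Gm: "G \<in> borel_measurable ?S" unfolding G_def by measurable
  have pm: "phase_martingale \<phi> t (A \<omega>) n = phase_martingale \<phi> t (\<lambda>k. V k \<omega>) n" for \<omega>
    unfolding phase_martingale_def walk_def A_def
    by (intro sum.cong refl arg_cong2[where f="(*)"] arg_cong[where f=cis] arg_cong[where f="\<lambda>x. t * x"] arg_cong2[where f="(-)"]) auto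
  have wk: "walk (A \<omega>) n = walk (\<lambda>k. V k \<omega>) n" for \<omega>
    unfolding walk_def A_def by (intro sum.cong) auto
  have "(\<integral>\<^sup>+\<omega>. ennreal (exp (l * Re (u * phase_martingale \<phi> t (\<lambda>k. V k \<omega>) (Suc n)))) \<partial>M)
      = (\<integral>\<^sup>+\<omega>. F (B \<omega>, A \<omega>) \<partial>M)"
    unfolding F_def prod.case pm wk Bn phase_martingale_Suc
    by (intro nn_integral_cong) (simp add: ennreal_mult[symmetric] exp_add[symmetric] algebra_simps)
  also have "\<dots> \<le> (\<integral>\<^sup>+\<omega>. G (A \<omega>) \<partial>M)"
  proof (rule indep_var_nn_integral_le[OF iv Fm Gm])
    fix v
    have [measurable]: "random_variable borel (V (Suc n))" by (rule Vm) simp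
    have "(\<integral>\<^sup>+\<omega>. F (B \<omega>, v) \<partial>M) = ennreal (exp (l * Re (u * phase_martingale \<phi> t v n))) *
       (\<integral>\<^sup>+\<omega>. ennreal (exp (l * Re (u * cis (t * walk v n) * (cis (t * V (Suc n) \<omega>) - \<phi>)))) \<partial>M)"
      unfolding F_def prod.case Bn by (rule nn_integral_cmult) measurable
    also have "\<dots> \<le> G v" unfolding G_def
      by (intro mult_left_mono exp_moment_centred_phase) (use l in \<open>auto simp: \<phi> u norm_mult Vm\<close>)
    finally show "(\<integral>\<^sup>+\<omega>. F (B \<omega>, v) \<partial>M) \<le> G v" .
  qed
  also have "\<dots> = (\<integral>\<^sup>+\<omega>. ennreal (exp (l * Re (u * phase_martingale \<phi> t (\<lambda>k. V k \<omega>) n))) \<partial>M) * ennreal (exp ?w)"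
    unfolding G_def pm
  proof (rule nn_integral_multc)
    have [measurable]: "(\<lambda>\<omega>. phase_martingale \<phi> t (\<lambda>k. V k \<omega>) n) \<in> borel_measurable M"
      by (rule measurable_phase_martingale) (auto intro: Vm)
    show "(\<lambda>\<omega>. ennreal (exp (l * Re (u * phase_martingale \<phi> t (\<lambda>k. V k \<omega>) n)))) \<in> borel_measurable M"
      by measurable
  qed
  also have "\<dots> \<le> ennreal (exp (?w * n)) * ennreal (exp ?w)"
    by (rule mult_right_mono[OF Suc]) simp
  also have "\<dots> = ennreal (exp (?w * Suc n))"
    by (simp add: ennreal_mult[symmetric] exp_add[symmetric] algebra_simps)
  finally show ?case .
qed

text \<open>Chernoff's bound for the martingale at level \<open>n |1 - \<phi>| y - 2\<close>, where \<open>2\<close> absorbs the boundary term of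
\<open>phase_martingale_eq\<close>. The parameter \<open>l = y/8\<close> turns the exponent \<open>2 l\<^sup>2 n w - l n w y / 2\<close>, with
\<open>w = |1 - \<phi>|\<close>, into \<open>- n w y\<^sup>2 / 32\<close>; the boundary term costs the factor \<open>exp (y/8) < 3\<close>.\<close>
lemma (in prob_space) walk_trig_mean_tail:
  fixes V :: "nat \<Rightarrow> 'a \<Rightarrow> real"
  assumes ind: "indep_vars (\<lambda>_. borel) V {1..}"
    and \<phi>: "\<And>k. k \<ge> 1 \<Longrightarrow> expectation (\<lambda>\<omega>. cis (t * V k \<omega>)) = \<phi>"
    and y: "0 < y" "y \<le> 1"
  shows "prob {\<omega>\<in>space M. cmod (trig_mean (\<lambda>_. 1) (walk (\<lambda>k. V k \<omega>)) n t) > y}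
           \<le> 12 * exp (- (n * cmod (1 - \<phi>) * y\<^sup>2 / 32))"
proof -
  have Vm: "random_variable borel (V k)" if "k \<ge> 1" for k
    using ind that by (auto simp: indep_vars_def)
  have "cmod (expectation (\<lambda>\<omega>. cis (t * V 1 \<omega>))) \<le> expectation (\<lambda>\<omega>. cmod (cis (t * V 1 \<omega>)))"
    by (rule integral_norm_bound)
  then have \<phi>1: "cmod \<phi> \<le> 1" by (simp add: prob_space \<phi>)
  define w where "w = cmod (1 - \<phi>)"
  define Z where "Z \<omega> = phase_martingale \<phi> t (\<lambda>k. V k \<omega>) n" for \<omega>
  have Zm [measurable]: "Z \<in> borel_measurable M"
    unfolding Z_def by (rule measurable_phase_martingale) (auto intro: Vm)
  define r where "r = (w * n * y - 2) / 2"
  have "{\<omega>\<in>space M. cmod (trig_mean (\<lambda>_. 1) (walk (\<lambda>k. V k \<omega>)) n t) > y} \<subseteq> {\<omega>\<in>space M. cmod (Z \<omega>) > 2 * r}"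
  proof safe
    fix \<omega> assume gt: "y < cmod (trig_mean (\<lambda>_. 1) (walk (\<lambda>k. V k \<omega>)) n t)"
    let ?S = "\<Sum>j=1..n. cis (t * walk (\<lambda>k. V k \<omega>) j)"
    have n: "n > 0" using gt y by (cases n) (auto simp: trig_mean_def)
    have "y * n < cmod ?S" using gt n by (simp add: trig_mean_def norm_divide field_simps)
    then have less: "w * (y * n) \<le> w * cmod ?S" by (intro mult_left_mono) (auto simp: w_def)
    have "(1 - \<phi>) * ?S = Z \<omega> - \<phi> * (cis (t * walk (\<lambda>k. V k \<omega>) n) - 1)"
      unfolding Z_def phase_martingale_eq by simp
    then have "w * cmod ?S \<le> cmod (Z \<omega>) + cmod (\<phi> * (cis (t * walk (\<lambda>k. V k \<omega>) n) - 1))"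
      unfolding w_def norm_mult[symmetric] by (metis norm_triangle_ineq4)
    moreover have "cmod (\<phi> * (cis (t * walk (\<lambda>k. V k \<omega>) n) - 1)) \<le> 1 * 2"
      unfolding norm_mult using \<phi>1 norm_triangle_ineq4[of "cis (t * walk (\<lambda>k. V k \<omega>) n)" 1]
      by (intro mult_mono) auto
    ultimately have ge: "w * (y * n) - 2 \<le> cmod (Z \<omega>)" using less by linarith
    show "2 * r < cmod (Z \<omega>)"
    proof (cases "w = 0")
      case True
      then have "2 * r < 0" by (simp add: r_def)
      then show ?thesis using norm_ge_zero[of "Z \<omega>"] by linarith
    next
      case False
      then have "w * (y * n) < w * cmod ?S" using \<open>y * n < cmod ?S\<close> by (simp add: w_def)
      then show ?thesis
        using \<open>w * cmod ?S \<le> _\<close> \<open>cmod (\<phi> * _) \<le> 1 * 2\<close> by (simp add: r_def mult_ac)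
    qed
  qed
  then have "prob {\<omega>\<in>space M. cmod (trig_mean (\<lambda>_. 1) (walk (\<lambda>k. V k \<omega>)) n t) > y}
      \<le> prob {\<omega>\<in>space M. cmod (Z \<omega>) > 2 * r}"
    by (intro finite_measure_mono) auto
  also have "\<dots> \<le> 4 * (exp (- (y / 8) * r) * exp (2 * (y / 8)\<^sup>2 * w * n))"
    unfolding w_def
  proof (rule complex_tail_from_exp_moment)
    show "(\<integral>\<^sup>+\<omega>. ennreal (exp (y / 8 * Re (u * Z \<omega>))) \<partial>M) \<le> ennreal (exp (2 * (y / 8)\<^sup>2 * cmod (1 - \<phi>) * n))"
      if "cmod u = 1" for u
      unfolding Z_def by (rule phase_martingale_exp_moment[OF ind \<phi> that]) (use y in auto)
  qed (use y in auto)
  also have "\<dots> = 4 * exp (y / 8) * exp (- (n * w * y\<^sup>2 / 32))"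
    unfolding r_def by (simp add: exp_add[symmetric]) (simp add: field_simps power2_eq_square)
  also have "\<dots> \<le> 12 * exp (- (n * w * y\<^sup>2 / 32))"
  proof (rule mult_right_mono)
    have "exp (y / 8) \<le> exp 1" using y by simp
    then show "4 * exp (y / 8) \<le> 12" using exp_le by linarith
  qed simp
  finally show ?thesis by (simp add: w_def)
qed

text \<open>Completing the square shifts the density to one centred at \<open>a \<sigma>\<^sup>2\<close>.\<close>
lemma (in prob_space) normal_exp_moment:
  assumes D: "distributed M lborel e (normal_density 0 \<sigma>)" and s: "\<sigma> > 0"
  shows "(\<integral>\<^sup>+\<omega>. ennreal (exp (a * e \<omega>)) \<partial>M) = ennreal (exp (a\<^sup>2 * \<sigma>\<^sup>2 / 2))"
proof -
  have "(\<integral>\<^sup>+\<omega>. ennreal (exp (a * e \<omega>)) \<partial>M) = (\<integral>\<^sup>+x. ennreal (normal_density 0 \<sigma> x) * ennreal (exp (a * x)) \<partial>lborel)"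
    by (subst distributed_nn_integral[OF D]) auto
  also have "\<dots> = (\<integral>\<^sup>+x. ennreal (exp (a\<^sup>2 * \<sigma>\<^sup>2 / 2)) * ennreal (normal_density (a * \<sigma>\<^sup>2) \<sigma> x) \<partial>lborel)"
  proof (rule nn_integral_cong)
    fix x :: real
    have "- (x - 0)\<^sup>2 / (2 * \<sigma>\<^sup>2) + a * x = a\<^sup>2 * \<sigma>\<^sup>2 / 2 + - (x - a * \<sigma>\<^sup>2)\<^sup>2 / (2 * \<sigma>\<^sup>2)"
      using s by (simp add: field_simps power2_eq_square)
    then have "exp (- (x - 0)\<^sup>2 / (2 * \<sigma>\<^sup>2)) * exp (a * x) = exp (a\<^sup>2 * \<sigma>\<^sup>2 / 2) * exp (- (x - a * \<sigma>\<^sup>2)\<^sup>2 / (2 * \<sigma>\<^sup>2))"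
      by (metis exp_add)
    then have "normal_density 0 \<sigma> x * exp (a * x) = exp (a\<^sup>2 * \<sigma>\<^sup>2 / 2) * normal_density (a * \<sigma>\<^sup>2) \<sigma> x"
      unfolding normal_density_def by (simp add: field_simps)
    then show "ennreal (normal_density 0 \<sigma> x) * ennreal (exp (a * x)) = ennreal (exp (a\<^sup>2 * \<sigma>\<^sup>2 / 2)) * ennreal (normal_density (a * \<sigma>\<^sup>2) \<sigma> x)"
      by (simp add: ennreal_mult[symmetric])
  qed
  also have "\<dots> = ennreal (exp (a\<^sup>2 * \<sigma>\<^sup>2 / 2)) * (\<integral>\<^sup>+x. ennreal (normal_density (a * \<sigma>\<^sup>2) \<sigma> x) \<partial>lborel)"
    by (rule nn_integral_cmult) simp
  also have "(\<integral>\<^sup>+x. ennreal (normal_density (a * \<sigma>\<^sup>2) \<sigma> x) \<partial>lborel) = 1"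
    by (subst nn_integral_eq_integral) (use s in auto)
  finally show ?thesis by simp
qed

text \<open>Given the sampling instants, a rotated noise sum is a centred Gaussian variable whose variance is at
most \<open>n \<sigma>\<^sup>2\<close>, whatever the instants are, so Chernoff's bound with \<open>l = y / (2 \<sigma>\<^sup>2)\<close> holds
unconditionally.\<close>
lemma (in prob_space) noise_trig_mean_tail:
  fixes eps X :: "nat \<Rightarrow> 'a \<Rightarrow> real"
  assumes ind: "indep_vars (\<lambda>_. borel) eps {1..}" and s: "\<sigma> > 0"
    and normal: "\<And>j. j \<ge> 1 \<Longrightarrow> distributed M lborel (eps j) (normal_density 0 \<sigma>)"
    and indX: "indep_var (\<Pi>\<^sub>M j\<in>{1..}. borel) (\<lambda>\<omega>. \<lambda>j\<in>{1..}. eps j \<omega>)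
           (\<Pi>\<^sub>M j\<in>{1..}. borel) (\<lambda>\<omega>. \<lambda>j\<in>{1..}. X j \<omega>)"
    and y: "0 < y"
  shows "prob {\<omega>\<in>space M. cmod (trig_mean (\<lambda>j. eps j \<omega>) (\<lambda>j. X j \<omega>) n t) > y}
           \<le> 4 * exp (- (n * y\<^sup>2 / (8 * \<sigma>\<^sup>2)))"
proof (cases "n = 0")
  case True
  then show ?thesis using y prob_le_1 by (auto simp: trig_mean_def)
next
  case n: False
  let ?P = "\<Pi>\<^sub>M j\<in>{1::nat..}. borel :: real measure"
  have em: "random_variable borel (eps k)" if "k \<ge> 1" for k
    using ind that by (auto simp: indep_vars_def)
  have XP: "(\<lambda>\<omega>. \<lambda>j\<in>{1..}. X j \<omega>) \<in> measurable M ?P" using indX by (rule indep_var_rv2)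
  have Xm: "random_variable borel (X k)" if "k \<ge> 1" for k
    using measurable_compose[OF XP measurable_component_singleton[of k "{1..}" "\<lambda>_. borel"]] that by simp
  define Z where "Z \<omega> = (\<Sum>j=1..n. of_real (eps j \<omega>) * cis (t * X j \<omega>))" for \<omega>
  have Zm [measurable]: "random_variable borel Z"
    unfolding Z_def
  proof (rule borel_measurable_sum)
    fix j assume "j \<in> {1..n}"
    then have [measurable]: "random_variable borel (eps j)" "random_variable borel (X j)" using em Xm by auto
    show "(\<lambda>\<omega>. of_real (eps j \<omega>) * cis (t * X j \<omega>)) \<in> borel_measurable M" by measurable
  qed
  define l where "l = y / (2 * \<sigma>\<^sup>2)"
  have l: "l > 0" using y s by (simp add: l_def)
  have mgf: "(\<integral>\<^sup>+\<omega>. ennreal (exp (l * Re (u * Z \<omega>))) \<partial>M) \<le> ennreal (exp (n * (l\<^sup>2 * \<sigma>\<^sup>2 / 2)))"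
    if u: "cmod u = 1" for u
  proof -
    define a where "a x j = l * Re (u * cis (t * x j))" for x :: "nat \<Rightarrow> real" and j
    have a: "(a x j)\<^sup>2 \<le> l\<^sup>2" for x j
    proof -
      have "\<bar>a x j\<bar> \<le> l * 1" unfolding a_def abs_mult using l abs_Re_le_cmod[of "u * cis (t * x j)"] u
        by (intro mult_mono) (auto simp: norm_mult)
      then show ?thesis using l by (simp add: abs_le_square_iff[symmetric])
    qed
    define F where "F = (\<lambda>(e, x). \<Prod>j=1..n. ennreal (exp (a x j * e j)))"
    have "(\<integral>\<^sup>+\<omega>. ennreal (exp (l * Re (u * Z \<omega>))) \<partial>M) = (\<integral>\<^sup>+\<omega>. F (\<lambda>j\<in>{1..}. eps j \<omega>, \<lambda>j\<in>{1..}. X j \<omega>) \<partial>M)"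
    proof (rule nn_integral_cong)
      fix \<omega>
      have "l * Re (u * Z \<omega>) = (\<Sum>j=1..n. l * Re (u * cis (t * X j \<omega>)) * eps j \<omega>)"
        unfolding Z_def by (simp add: sum_distrib_left sum_subtractf[symmetric] algebra_simps)
      then have "ennreal (exp (l * Re (u * Z \<omega>))) = (\<Prod>j=1..n. ennreal (exp (l * Re (u * cis (t * X j \<omega>)) * eps j \<omega>)))"
        by (simp only: exp_sum[OF finite_atLeastAtMost]) (simp add: prod_ennreal)
      also have "\<dots> = F (\<lambda>j\<in>{1..}. eps j \<omega>, \<lambda>j\<in>{1..}. X j \<omega>)"
        unfolding F_def prod.case a_def by (intro prod.cong) auto
      finally show "ennreal (exp (l * Re (u * Z \<omega>))) = F (\<lambda>j\<in>{1..}. eps j \<omega>, \<lambda>j\<in>{1..}. X j \<omega>)" .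
    qed
    also have "\<dots> \<le> (\<integral>\<^sup>+\<omega>. (\<lambda>_. ennreal (exp (n * (l\<^sup>2 * \<sigma>\<^sup>2 / 2)))) (\<lambda>j\<in>{1..}. X j \<omega>) \<partial>M)"
    proof (rule indep_var_nn_integral_le[OF indX])
      show "F \<in> borel_measurable (?P \<Otimes>\<^sub>M ?P)"
        unfolding F_def case_prod_beta
      proof (rule borel_measurable_prod_ennreal)
        fix j assume "j \<in> {1..n}"
        then have [measurable]: "(\<lambda>f. f j) \<in> measurable ?P borel" by (intro measurable_component_singleton) auto
        show "(\<lambda>p. ennreal (exp (a (snd p) j * fst p j))) \<in> borel_measurable (?P \<Otimes>\<^sub>M ?P)"
          unfolding a_def by measurable
      qed
    next
      fix x assume "x \<in> space ?P"
      have "(\<integral>\<^sup>+\<omega>. F (\<lambda>j\<in>{1..}. eps j \<omega>, x) \<partial>M) = (\<integral>\<^sup>+\<omega>. (\<Prod>j=1..n. ennreal (exp (a x j * eps j \<omega>))) \<partial>M)"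
        unfolding F_def prod.case by (intro nn_integral_cong prod.cong) auto
      also have "\<dots> = (\<Prod>j=1..n. \<integral>\<^sup>+\<omega>. ennreal (exp (a x j * eps j \<omega>)) \<partial>M)"
      proof (rule indep_vars_nn_integral)
        have "indep_vars (\<lambda>_. borel) eps {1..n}" using ind by (rule indep_vars_subset) auto
        then show "indep_vars (\<lambda>_. borel) (\<lambda>j \<omega>. ennreal (exp (a x j * eps j \<omega>))) {1..n}"
          by (rule indep_vars_compose2) auto
      qed auto
      also have "\<dots> = (\<Prod>j=1..n. ennreal (exp ((a x j)\<^sup>2 * \<sigma>\<^sup>2 / 2)))"
        by (intro prod.cong refl normal_exp_moment normal s) auto
      also have "\<dots> = ennreal (\<Prod>j=1..n. exp ((a x j)\<^sup>2 * \<sigma>\<^sup>2 / 2))"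
        by (rule prod_ennreal) simp
      also have "\<dots> \<le> ennreal (\<Prod>j=1..n. exp (l\<^sup>2 * \<sigma>\<^sup>2 / 2))"
        by (intro ennreal_leI prod_mono) (auto intro!: divide_right_mono mult_right_mono a)
      also have "\<dots> = ennreal (exp (n * (l\<^sup>2 * \<sigma>\<^sup>2 / 2)))"
        by (simp add: exp_of_nat_mult[symmetric])
      finally show "(\<integral>\<^sup>+\<omega>. F (\<lambda>j\<in>{1..}. eps j \<omega>, x) \<partial>M) \<le> ennreal (exp (n * (l\<^sup>2 * \<sigma>\<^sup>2 / 2)))" .
    qed auto
    also have "\<dots> = ennreal (exp (n * (l\<^sup>2 * \<sigma>\<^sup>2 / 2)))" by (simp add: emeasure_space_1)
    finally show ?thesis .
  qed
  have "{\<omega>\<in>space M. cmod (trig_mean (\<lambda>j. eps j \<omega>) (\<lambda>j. X j \<omega>) n t) > y} = {\<omega>\<in>space M. cmod (Z \<omega>) > 2 * (n * y / 2)}"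
    using n by (auto simp: trig_mean_def Z_def norm_divide field_simps)
  then have "prob {\<omega>\<in>space M. cmod (trig_mean (\<lambda>j. eps j \<omega>) (\<lambda>j. X j \<omega>) n t) > y}
     \<le> 4 * (exp (- l * (n * y / 2)) * exp (n * (l\<^sup>2 * \<sigma>\<^sup>2 / 2)))"
    using complex_tail_from_exp_moment[OF Zm l mgf, of "n * y / 2"] by simp
  also have "exp (- l * (n * y / 2)) * exp (n * (l\<^sup>2 * \<sigma>\<^sup>2 / 2)) = exp (- (n * y\<^sup>2 / (8 * \<sigma>\<^sup>2)))"
    unfolding exp_add[symmetric] l_def using s by (simp add: field_simps power2_eq_square)
  finally show ?thesis by simp
qed

section \<open>Uniform bounds along almost every trajectory\<close>

lemma cmod_cis_diff_le: "cmod (cis a - cis b) \<le> \<bar>a - b\<bar>"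
proof -
  have "cis a - cis b = cis b * (exp (\<i> * of_real (a - b)) - 1)"
    unfolding cis_conv_exp[symmetric] by (simp add: algebra_simps cis_mult)
  then have "cmod (cis a - cis b) = 2 * \<bar>sin ((a - b) / 2)\<bar>"
    by (simp only: norm_mult dist_exp_i_1 norm_cis mult_1)
  also have "\<dots> \<le> \<bar>a - b\<bar>" using abs_sin_x_le_abs_x[of "(a - b) / 2"] by simp
  finally show ?thesis .
qed

lemma trig_mean_diff_le:
  "cmod (trig_mean b x n t - trig_mean b x n t') \<le> \<bar>t - t'\<bar> * (\<Sum>j=1..n. \<bar>b j * x j\<bar>) / n"
proof -
  have "cmod (trig_mean b x n t - trig_mean b x n t') = cmod (\<Sum>j=1..n. of_real (b j) * (cis (t * x j) - cis (t' * x j))) / n"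
    unfolding trig_mean_def by (simp add: diff_divide_distrib[symmetric] norm_divide sum_subtractf[symmetric] right_diff_distrib)
  also have "\<dots> \<le> (\<Sum>j=1..n. \<bar>t - t'\<bar> * \<bar>b j * x j\<bar>) / n"
  proof (intro divide_right_mono order_trans[OF norm_sum] sum_mono)
    fix j
    have "cmod (of_real (b j) * (cis (t * x j) - cis (t' * x j))) \<le> \<bar>b j\<bar> * \<bar>t * x j - t' * x j\<bar>"
      unfolding norm_mult using cmod_cis_diff_le by (intro mult_mono) auto
    also have "\<dots> = \<bar>t - t'\<bar> * \<bar>b j * x j\<bar>" by (simp add: abs_mult left_diff_distrib[symmetric])
    finally show "cmod (of_real (b j) * (cis (t * x j) - cis (t' * x j))) \<le> \<bar>t - t'\<bar> * \<bar>b j * x j\<bar>" .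
  qed simp
  finally show ?thesis by (simp add: sum_distrib_left)
qed

lemma trig_mean_measurable:
  assumes "\<And>j. j \<ge> 1 \<Longrightarrow> b j \<in> borel_measurable N" "\<And>j. j \<ge> 1 \<Longrightarrow> x j \<in> borel_measurable N"
  shows "(\<lambda>\<omega>. trig_mean (\<lambda>j. b j \<omega>) (\<lambda>j. x j \<omega>) n t) \<in> borel_measurable N"
proof -
  have "(\<lambda>\<omega>. \<Sum>j=1..n. of_real (b j \<omega>) * cis (t * x j \<omega>)) \<in> borel_measurable N"
  proof (rule borel_measurable_sum)
    fix j assume "j \<in> {1..n}"
    then have [measurable]: "b j \<in> borel_measurable N" "x j \<in> borel_measurable N" using assms by auto
    show "(\<lambda>\<omega>. of_real (b j \<omega>) * cis (t * x j \<omega>)) \<in> borel_measurable N" by measurable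
  qed
  then show ?thesis unfolding trig_mean_def by measurable
qed

text \<open>A stretched exponential tail beats any polynomial number of points: the points \<open>i / n\<^sup>9\<close> of \<open>[0, n]\<close>
number \<open>n\<^bsup>10\<^esup> + 1\<close>, and by Borel-Cantelli the bound eventually holds at all of them. Between grid
points the mean varies by at most \<open>1 / n\<close>, since its Lipschitz constant is at most \<open>n\<^sup>9 / n\<close>.\<close>
lemma (in prob_space) trig_mean_uniformly_small:
  fixes b x :: "nat \<Rightarrow> 'a \<Rightarrow> real" and a y :: "nat \<Rightarrow> real"
  assumes bm: "\<And>j. j \<ge> 1 \<Longrightarrow> random_variable borel (b j)"
    and xm: "\<And>j. j \<ge> 1 \<Longrightarrow> random_variable borel (x j)"
    and lip: "AE \<omega> in M. \<forall>\<^sub>F n in sequentially. (\<Sum>j=1..n. \<bar>b j \<omega> * x j \<omega>\<bar>) \<le> real n ^ 9"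
    and a: "\<And>n. a n \<ge> 0" and c: "c > 0" and \<alpha>: "\<alpha> > 0"
    and tail: "\<forall>\<^sub>F n in sequentially. \<forall>t::real. a n \<le> t \<and> t \<le> real n \<longrightarrow>
        prob {\<omega>\<in>space M. cmod (trig_mean (\<lambda>j. b j \<omega>) (\<lambda>j. x j \<omega>) n t) > y n} \<le> C * exp (- c * n powr \<alpha>)"
  shows "AE \<omega> in M. \<forall>\<^sub>F n in sequentially. \<forall>t::real. a n \<le> t \<and> t \<le> real n \<longrightarrow>
        cmod (trig_mean (\<lambda>j. b j \<omega>) (\<lambda>j. x j \<omega>) n t) \<le> y n + 1 / n"
proof -
  define Z where "Z n t \<omega> = trig_mean (\<lambda>j. b j \<omega>) (\<lambda>j. x j \<omega>) n t" for n t \<omega>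
  have Zm [measurable]: "random_variable borel (Z n t)" for n t
    unfolding Z_def by (rule trig_mean_measurable[OF bm xm])
  define I where "I n = {i \<in> {0..n^10}. a n \<le> real i / real n ^ 9 \<and> real i / real n ^ 9 \<le> n}" for n
  have fin: "finite (I n)" for n unfolding I_def by simp
  have cI: "card (I n) \<le> n^10 + 1" for n
  proof -
    have "card (I n) \<le> card {0..n^10}" by (rule card_mono) (auto simp: I_def)
    then show ?thesis by simp
  qed
  define E where "E n = (\<Union>i\<in>I n. {\<omega>\<in>space M. cmod (Z n (real i / real n ^ 9) \<omega>) > y n})" for n
  have Em: "E n \<in> events" for n unfolding E_def by (intro sets.finite_UN fin) measurable
  have "AE \<omega> in M. \<forall>\<^sub>F n in sequentially. \<omega> \<in> space M - E n"
  proof (rule borel_cantelli_AE1[OF Em])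
    show "summable (\<lambda>n. prob (E n))"
    proof (rule summable_comparison_test_ev)
      show "\<forall>\<^sub>F n in sequentially. norm (prob (E n)) \<le> (real n ^ 10 + 1) * (\<bar>C\<bar> * exp (- c * n powr \<alpha>))"
        using tail
      proof eventually_elim
        case (elim n)
        have "prob (E n) \<le> (\<Sum>i\<in>I n. prob {\<omega>\<in>space M. cmod (Z n (real i / real n ^ 9) \<omega>) > y n})"
          unfolding E_def by (intro finite_measure_subadditive_finite fin) auto
        also have "\<dots> \<le> (\<Sum>i\<in>I n. C * exp (- c * n powr \<alpha>))"
          unfolding Z_def using elim by (intro sum_mono) (auto simp: I_def)
        also have "\<dots> = card (I n) * (C * exp (- c * n powr \<alpha>))" by simp
        also have "\<dots> \<le> card (I n) * (\<bar>C\<bar> * exp (- c * n powr \<alpha>))"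
          by (intro mult_left_mono mult_right_mono) auto
        also have "\<dots> \<le> real (n ^ 10 + 1) * (\<bar>C\<bar> * exp (- c * n powr \<alpha>))"
          by (intro mult_right_mono of_nat_mono cI) auto
        finally show ?case by (simp add: measure_nonneg add.commute)
      qed
      show "summable (\<lambda>n. (real n ^ 10 + 1) * (\<bar>C\<bar> * exp (- c * n powr \<alpha>)))"
      proof (rule summable_comparison_test_ev)
        have "((\<lambda>n::nat. (real n ^ 10 + 1) * exp (- c * n powr \<alpha>) * real n powr 2) \<longlonglongrightarrow> 0)"
          using c \<alpha> by real_asymp
        then have "\<forall>\<^sub>F n::nat in sequentially. (real n ^ 10 + 1) * exp (- c * n powr \<alpha>) * real n powr 2 < 1"
          by (rule order_tendstoD) simp
        then show "\<forall>\<^sub>F n in sequentially. norm ((real n ^ 10 + 1) * (\<bar>C\<bar> * exp (- c * n powr \<alpha>))) \<le> \<bar>C\<bar> * (real n powr - 2)"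
          using eventually_gt_at_top[of 0]
        proof eventually_elim
          case (elim n)
          have "(real n ^ 10 + 1) * exp (- c * n powr \<alpha>) \<le> real n powr - 2"
            using elim by (simp add: powr_minus field_simps)
          then have "\<bar>C\<bar> * ((real n ^ 10 + 1) * exp (- c * n powr \<alpha>)) \<le> \<bar>C\<bar> * real n powr - 2"
            by (intro mult_left_mono) auto
          then show ?case by (simp add: mult_ac abs_mult)
        qed
        show "summable (\<lambda>n. \<bar>C\<bar> * (real n powr - 2))"
          by (intro summable_mult) (simp add: summable_real_powr_iff)
      qed
    qed
  qed (simp add: emeasure_eq_measure)
  with lip show ?thesis
  proof eventually_elim
    case (elim \<omega>)
    from elim(1) elim(2) eventually_gt_at_top[of 0]
    show ?case
    proof eventually_elim
      case (elim n)
      show ?case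
      proof (intro allI impI)
        fix t :: real assume t: "a n \<le> t \<and> t \<le> real n"
        then have t0: "t \<ge> 0" using a[of n] by linarith
        define i where "i = nat \<lceil>t * real n ^ 9\<rceil>"
        have n: "real n ^ 9 > 0" using elim by simp
        have i1: "t * real n ^ 9 \<le> real i" "real i \<le> t * real n ^ 9 + 1"
          unfolding i_def using t0 n by (auto simp: le_nat_iff)
        have "t * real n ^ 9 \<le> real n * real n ^ 9" using t n by (intro mult_right_mono) auto
        then have "\<lceil>t * real n ^ 9\<rceil> \<le> int (n ^ 10)" by (simp add: ceiling_le_iff power_Suc[symmetric])
        then have i2: "i \<le> n ^ 10" unfolding i_def by linarith
        have i3: "t \<le> real i / real n ^ 9" using i1 n by (simp add: field_simps)
        have "real i \<le> real n ^ 10" using i2 by (metis of_nat_le_iff of_nat_power)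
        then have i4: "real i / real n ^ 9 \<le> n" using n by (simp add: field_simps power_Suc[symmetric])
        have iI: "i \<in> I n" unfolding I_def using i2 i3 i4 t by auto
        have b1: "cmod (Z n (real i / real n ^ 9) \<omega>) \<le> y n"
          using elim iI unfolding E_def by auto
        have dt: "\<bar>t - real i / real n ^ 9\<bar> \<le> 1 / real n ^ 9"
        proof -
          have "t - real i / real n ^ 9 = (t * real n ^ 9 - real i) / real n ^ 9" using n by (simp add: diff_divide_distrib)
          then have "\<bar>t - real i / real n ^ 9\<bar> = \<bar>t * real n ^ 9 - real i\<bar> / real n ^ 9" using n by simp
          also have "\<dots> \<le> 1 / real n ^ 9" using i1 n by (intro divide_right_mono) auto
          finally show ?thesis .
        qed
        have "cmod (Z n t \<omega> - Z n (real i / real n ^ 9) \<omega>) \<le> \<bar>t - real i / real n ^ 9\<bar> * (\<Sum>j=1..n. \<bar>b j \<omega> * x j \<omega>\<bar>) / n"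
          unfolding Z_def by (rule trig_mean_diff_le)
        also have "\<dots> \<le> (1 / real n ^ 9) * real n ^ 9 / n"
          by (intro divide_right_mono mult_mono dt elim sum_nonneg) auto
        also have "\<dots> = 1 / n" using n by simp
        finally have "cmod (Z n t \<omega> - Z n (real i / real n ^ 9) \<omega>) \<le> 1 / n" .
        then have "cmod (Z n t \<omega>) \<le> y n + 1 / n"
          using b1 norm_triangle_sub[of "Z n t \<omega>" "Z n (real i / real n ^ 9) \<omega>"] by linarith
        then show "cmod (trig_mean (\<lambda>j. b j \<omega>) (\<lambda>j. x j \<omega>) n t) \<le> y n + 1 / n" by (simp add: Z_def)
      qed
    qed
  qed
qed

text \<open>A cheap strong law: \<open>\<Sum>\<^sub>j |Z\<^sub>j| j\<^bsup>-p\<^esup>\<close> has finite expectation, hence is almost surely finite, and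
\<open>\<Sum>\<^bsub>j\<le>n\<^esub> |Z\<^sub>j| \<le> n\<^sup>p \<Sum>\<^sub>j |Z\<^sub>j| j\<^bsup>-p\<^esup>\<close>. The \<open>Z\<^sub>j\<close> may be arbitrarily dependent, so it applies to the positions of a
walk and to their deviations from the mean drift.\<close>
lemma (in prob_space) AE_partial_sums_le_powr:
  fixes Z :: "nat \<Rightarrow> 'a \<Rightarrow> real"
  assumes int: "\<And>j. j \<ge> 1 \<Longrightarrow> integrable M (Z j)"
    and le: "\<And>j. j \<ge> 1 \<Longrightarrow> expectation (\<lambda>\<omega>. \<bar>Z j \<omega>\<bar>) \<le> C * real j powr q"
    and pq: "p > q + 1" "p \<ge> 0"
  shows "AE \<omega> in M. \<exists>W. \<forall>n. (\<Sum>j=1..n. \<bar>Z j \<omega>\<bar>) \<le> W * real n powr p"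
proof -
  define f where "f j \<omega> = ennreal (\<bar>Z (Suc j) \<omega>\<bar> * real (Suc j) powr - p)" for j \<omega>
  have [measurable]: "random_variable borel (Z (Suc j))" for j using int[of "Suc j"] by auto
  have fm [measurable]: "f j \<in> borel_measurable M" for j unfolding f_def by measurable
  have "C * real 1 powr q \<ge> 0"
    by (rule order_trans[OF _ le]) auto
  then have C: "C \<ge> 0" by simp
  have f: "(\<integral>\<^sup>+\<omega>. f j \<omega> \<partial>M) \<le> ennreal (C * real (Suc j) powr (q - p))" for j
  proof -
    have "(\<integral>\<^sup>+\<omega>. f j \<omega> \<partial>M) = ennreal (expectation (\<lambda>\<omega>. \<bar>Z (Suc j) \<omega>\<bar> * real (Suc j) powr - p))"
      unfolding f_def by (rule nn_integral_eq_integral) (use int[of "Suc j"] in auto)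
    also have "\<dots> \<le> ennreal (C * real (Suc j) powr q * real (Suc j) powr - p)"
      using le[of "Suc j"] by (intro ennreal_leI) (auto intro!: mult_right_mono)
    also have "C * real (Suc j) powr q * real (Suc j) powr - p = C * real (Suc j) powr (q - p)"
      by (simp add: powr_add[symmetric])
    finally show ?thesis .
  qed
  have "summable (\<lambda>j. real j powr (q - p))" using pq by (simp add: summable_real_powr_iff)
  then have "summable (\<lambda>j. real (Suc j) powr (q - p))" by (subst summable_Suc_iff)
  then have sm: "summable (\<lambda>j. C * real (Suc j) powr (q - p))" by (rule summable_mult)
  have "(\<integral>\<^sup>+\<omega>. (\<Sum>j. f j \<omega>) \<partial>M) = (\<Sum>j. \<integral>\<^sup>+\<omega>. f j \<omega> \<partial>M)"
    by (rule nn_integral_suminf) auto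
  also have "\<dots> \<le> (\<Sum>j. ennreal (C * real (Suc j) powr (q - p)))"
    by (intro suminf_le f) auto
  also have "\<dots> = ennreal (\<Sum>j. C * real (Suc j) powr (q - p))"
    using C sm by (intro suminf_ennreal2) auto
  also have "\<dots> < \<infinity>" by simp
  finally have "AE \<omega> in M. (\<Sum>j. f j \<omega>) \<noteq> \<infinity>"
    by (intro nn_integral_PInf_AE) auto
  then show ?thesis
  proof eventually_elim
    case (elim \<omega>)
    define W where "W = enn2real (\<Sum>j. f j \<omega>)"
    show ?case
    proof (intro exI[of _ W] allI)
      fix n
      have "ennreal (\<Sum>j<n. \<bar>Z (Suc j) \<omega>\<bar> * real (Suc j) powr - p) = (\<Sum>j<n. f j \<omega>)"
        unfolding f_def by (rule sum_ennreal[symmetric]) auto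
      also have "\<dots> \<le> (\<Sum>j. f j \<omega>)" by (intro sum_le_suminf) auto
      also have "\<dots> = ennreal W" unfolding W_def using elim by (simp add: less_top)
      finally have W: "(\<Sum>j<n. \<bar>Z (Suc j) \<omega>\<bar> * real (Suc j) powr - p) \<le> W"
        by (subst (asm) ennreal_le_iff) (auto simp: W_def)
      have "(\<Sum>j=1..n. \<bar>Z j \<omega>\<bar>) = (\<Sum>j<n. \<bar>Z (Suc j) \<omega>\<bar>)"
        using sum.atLeast1_atMost_eq[of "\<lambda>j. \<bar>Z j \<omega>\<bar>" n] by simp
      also have "\<dots> \<le> (\<Sum>j<n. real n powr p * (\<bar>Z (Suc j) \<omega>\<bar> * real (Suc j) powr - p))"
      proof (rule sum_mono)
        fix j assume j: "j \<in> {..<n}"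
        have "1 = real (Suc j) powr p * real (Suc j) powr - p" by (simp add: powr_add[symmetric])
        also have "\<dots> \<le> real n powr p * real (Suc j) powr - p"
          using j pq by (intro mult_right_mono powr_mono2) auto
        finally have "\<bar>Z (Suc j) \<omega>\<bar> * 1 \<le> \<bar>Z (Suc j) \<omega>\<bar> * (real n powr p * real (Suc j) powr - p)"
          by (intro mult_left_mono) auto
        then show "\<bar>Z (Suc j) \<omega>\<bar> \<le> real n powr p * (\<bar>Z (Suc j) \<omega>\<bar> * real (Suc j) powr - p)"
          by (simp add: mult_ac)
      qed
      also have "\<dots> = real n powr p * (\<Sum>j<n. \<bar>Z (Suc j) \<omega>\<bar> * real (Suc j) powr - p)"
        by (simp add: sum_distrib_left)
      also have "\<dots> \<le> real n powr p * W" by (intro mult_left_mono W) auto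
      finally show "(\<Sum>j=1..n. \<bar>Z j \<omega>\<bar>) \<le> W * real n powr p" by (simp add: mult.commute)
    qed
  qed
qed

text \<open>On \<open>[z\<^sub>0, 2]\<close> use \<open>|sin z| = 2 |sin (z/2) cos (z/2)| \<le> z cos (z\<^sub>0/2)\<close>, and beyond \<open>2\<close> the bound
\<open>1 \<le> z/2\<close>.\<close>
lemma abs_sin_le_contraction:
  fixes z0 :: real
  assumes "z0 > 0"
  shows "\<exists>\<kappa>>0. \<kappa> < 1 \<and> (\<forall>z\<ge>z0. \<bar>sin z\<bar> \<le> (1 - \<kappa>) * z)"
proof -
  define z1 where "z1 = min z0 2"
  have z1: "0 < z1" "z1 \<le> 2" using assms by (auto simp: z1_def)
  define m where "m = max (cos (z1 / 2)) (1 / 2)"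
  have "cos (z1 / 2) < cos 0" using z1 pi_gt3 by (intro cos_monotone_0_pi) auto
  then have m: "m < 1" "m > 0" by (auto simp: m_def)
  have "\<bar>sin z\<bar> \<le> m * z" if z: "z \<ge> z0" for z
  proof (cases "z \<le> 2")
    case True
    have z': "z1 \<le> z" "0 < z" using z assms by (auto simp: z1_def)
    have "\<bar>sin z\<bar> = 2 * \<bar>sin (z / 2)\<bar> * \<bar>cos (z / 2)\<bar>"
      using sin_double[of "z / 2"] by (simp add: abs_mult)
    also have "\<dots> \<le> z * \<bar>cos (z / 2)\<bar>"
      using abs_sin_x_le_abs_x[of "z / 2"] z' by (intro mult_right_mono) auto
    also have "\<bar>cos (z / 2)\<bar> = cos (z / 2)" using z' True pi_gt3 by (intro abs_of_nonneg cos_ge_zero) auto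
    also have "z * cos (z / 2) \<le> z * m"
    proof (rule mult_left_mono)
      have "cos (z / 2) \<le> cos (z1 / 2)" using z' z1 True pi_gt3 by (intro cos_monotone_0_pi_le) auto
      then show "cos (z / 2) \<le> m" by (simp add: m_def)
    qed (use z' in simp)
    finally show ?thesis by (simp add: mult.commute)
  next
    case False
    have "\<bar>sin z\<bar> \<le> 1" by (rule abs_sin_le_one)
    also have "1 \<le> (1 / 2) * z" using False by simp
    also have "\<dots> \<le> m * z" using False by (intro mult_right_mono) (auto simp: m_def)
    finally show ?thesis .
  qed
  then show ?thesis using m by (intro exI[of _ "1 - m"]) auto
qed

text \<open>For the arithmetic progression, the mean is the normalized Dirichlet kernel
\<open>|sin (n \<theta>/2)| / (n sin (\<theta>/2))\<close>. The numerator is a fixed fraction below \<open>n \<theta>/2\<close> because \<open>n \<theta> \<ge> d\<close>, and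
for small \<open>\<theta>\<close> the denominator loses only half of this fraction.\<close>
lemma arithmetic_trig_mean_contraction:
  assumes d: "d > 0"
  shows "\<exists>\<kappa>>0. \<exists>h>0. \<forall>n::nat. \<forall>\<theta>. 0 < n \<and> d / n \<le> \<theta> \<and> \<theta> \<le> h \<longrightarrow> cmod (trig_mean (\<lambda>_. 1) real n \<theta>) \<le> 1 - \<kappa>"
proof -
  from d have d2: "d / 2 > 0" by simp
  obtain k where k: "k > 0" "k < 1" "\<And>z. z \<ge> d / 2 \<Longrightarrow> \<bar>sin z\<bar> \<le> (1 - k) * z"
    using abs_sin_le_contraction[OF d2] by blast
  define \<kappa> where "\<kappa> = k / 2"
  have \<kappa>: "0 < \<kappa>" "\<kappa> < 1" using k by (auto simp: \<kappa>_def)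
  have "((\<lambda>x::real. sin x / x) \<longlongrightarrow> 1) (at_right 0)" by real_asymp
  then have "\<forall>\<^sub>F x::real in at_right 0. sin x / x > 1 - \<kappa>" by (rule order_tendstoD) (use \<kappa> in auto)
  then obtain h0 where h0: "h0 > 0" "\<And>x::real. 0 < x \<Longrightarrow> x < h0 \<Longrightarrow> sin x / x > 1 - \<kappa>"
    unfolding eventually_at_right_field by auto
  have "cmod (trig_mean (\<lambda>_. 1) real n \<theta>) \<le> 1 - \<kappa>" if H: "0 < n" "d / n \<le> \<theta>" "\<theta> \<le> h0" for n :: nat and \<theta> :: real
  proof -
    have \<theta>: "\<theta> > 0" using H d by (meson divide_pos_pos less_le_trans of_nat_0_less_iff)
    define x where "x = \<theta> / 2"
    have x: "0 < x" "x < h0" using \<theta> H h0 by (auto simp: x_def)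
    then have sx: "sin x > (1 - \<kappa>) * x" using h0(2)[of x] by (simp add: field_simps)
    have sx0: "sin x > 0" using sx \<kappa> x by (smt (verit) mult_nonneg_nonneg)
    let ?S = "\<Sum>j=1..n. cis (\<theta> * real j)"
    have tele: "?S * (cis \<theta> - 1) = cis \<theta> * (cis (\<theta> * n) - 1)"
      by (induction n) (simp_all add: algebra_simps cis_mult)
    have c1: "cmod (cis a - 1) = 2 * \<bar>sin (a / 2)\<bar>" for a using dist_exp_i_1[of a] by (simp add: cis_conv_exp)
    have "cmod ?S * cmod (cis \<theta> - 1) = cmod (cis \<theta> * (cis (\<theta> * n) - 1))"
      unfolding tele[symmetric] norm_mult ..
    then have "cmod ?S * (2 * \<bar>sin x\<bar>) = 2 * \<bar>sin (n * x)\<bar>"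
      unfolding norm_mult c1 by (simp add: x_def mult_ac)
    then have S: "cmod ?S * sin x = \<bar>sin (n * x)\<bar>" using sx0 by simp
    have nx: "n * x \<ge> d / 2" using H by (simp add: x_def field_simps)
    have "cmod ?S * ((1 - \<kappa>) * x) \<le> cmod ?S * sin x" using sx by (intro mult_left_mono) auto
    also have "\<dots> \<le> (1 - k) * (n * x)" using S k(3)[OF nx] by simp
    also have "\<dots> \<le> ((1 - \<kappa>) * (1 - \<kappa>)) * (n * x)"
      using x by (intro mult_right_mono) (auto simp: \<kappa>_def algebra_simps)
    finally have "cmod ?S * ((1 - \<kappa>) * x) \<le> ((1 - \<kappa>) * n) * ((1 - \<kappa>) * x)" by (simp add: mult_ac)
    moreover have "(1 - \<kappa>) * x > 0" using \<kappa> x by simp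
    ultimately have "cmod ?S \<le> (1 - \<kappa>) * n" by (rule mult_right_le_imp_le)
    then show ?thesis using H by (simp add: trig_mean_def norm_divide field_simps)
  qed
  then show ?thesis using \<kappa> h0 by blast
qed

text \<open>Near \<open>0\<close>, the imaginary part \<open>E sin (t V)\<close> is asymptotic to \<open>t E V\<close>, by dominated convergence
with majorant \<open>|V|\<close>; away from \<open>0\<close>, the hypothesis gives a constant gap.\<close>
lemma (in prob_space) characteristic_gap:
  fixes V :: "'a \<Rightarrow> real"
  assumes int: "integrable M V" and pos: "expectation V > 0"
    and gap: "\<And>\<epsilon>. \<epsilon> > 0 \<Longrightarrow> \<exists>\<rho><1. \<forall>t\<ge>\<epsilon>. cmod (expectation (\<lambda>\<omega>. cis (t * V \<omega>))) \<le> \<rho>"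
  shows "\<exists>c>0. \<forall>t\<ge>0. c * min t 1 \<le> cmod (1 - expectation (\<lambda>\<omega>. cis (t * V \<omega>)))"
proof -
  have Vm [measurable]: "random_variable borel V" using int by auto
  define \<mu> where "\<mu> = expectation V"
  have "((\<lambda>s. expectation (\<lambda>\<omega>. s * sin (V \<omega> / s))) \<longlongrightarrow> expectation V) at_top"
  proof (rule integral_dominated_convergence_at_top[where w="\<lambda>\<omega>. \<bar>V \<omega>\<bar>"])
    show "AE \<omega> in M. ((\<lambda>s. s * sin (V \<omega> / s)) \<longlongrightarrow> V \<omega>) at_top"
    proof (rule AE_I2)
      fix \<omega>
      have "((\<lambda>s. s * sin (v / s)) \<longlongrightarrow> v) at_top" for v :: real
        by (cases v "0::real" rule: linorder_cases) real_asymp+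
      then show "((\<lambda>s. s * sin (V \<omega> / s)) \<longlongrightarrow> V \<omega>) at_top" .
    qed
    show "\<forall>\<^sub>F s in at_top. AE \<omega> in M. norm (s * sin (V \<omega> / s)) \<le> \<bar>V \<omega>\<bar>"
      using eventually_gt_at_top[of "0::real"]
    proof eventually_elim
      case (elim s)
      show ?case
      proof (rule AE_I2)
        fix \<omega>
        have "s * \<bar>sin (V \<omega> / s)\<bar> \<le> s * \<bar>V \<omega> / s\<bar>" using elim by (intro mult_left_mono abs_sin_x_le_abs_x) auto
        then show "norm (s * sin (V \<omega> / s)) \<le> \<bar>V \<omega>\<bar>" using elim by (simp add: abs_mult)
      qed
    qed
  qed (use int in auto)
  then have "\<forall>\<^sub>F s in at_top. expectation (\<lambda>\<omega>. s * sin (V \<omega> / s)) > \<mu> / 2"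
    by (rule order_tendstoD) (use pos in \<open>auto simp: \<mu>_def\<close>)
  then obtain s0 where s0: "\<And>s. s \<ge> s0 \<Longrightarrow> expectation (\<lambda>\<omega>. s * sin (V \<omega> / s)) > \<mu> / 2"
    by (auto simp: eventually_at_top_linorder)
  define \<delta> where "\<delta> = 1 / max s0 1"
  have \<delta>: "0 < \<delta>" "\<delta> \<le> 1" by (auto simp: \<delta>_def)
  have small: "t * (\<mu> / 2) \<le> cmod (1 - expectation (\<lambda>\<omega>. cis (t * V \<omega>)))" if t: "0 < t" "t \<le> \<delta>" for t
  proof -
    have "1 / t \<ge> 1 / \<delta>" using t \<delta> by (intro divide_left_mono) auto
    then have "1 / t \<ge> max s0 1" by (simp add: \<delta>_def)
    then have "\<mu> / 2 < expectation (\<lambda>\<omega>. (1 / t) * sin (V \<omega> / (1 / t)))" by (intro s0) simp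
    then have "\<mu> / 2 < expectation (\<lambda>\<omega>. sin (t * V \<omega>)) / t" by (simp add: mult.commute)
    then have "t * (\<mu> / 2) \<le> expectation (\<lambda>\<omega>. sin (t * V \<omega>))" using t by (simp add: field_simps)
    also have "\<dots> = Im (expectation (\<lambda>\<omega>. cis (t * V \<omega>)))"
    proof -
      have "integrable M (\<lambda>\<omega>. cis (t * V \<omega>))" by (rule integrable_const_bound[where B=1]) auto
      from integral_Im[OF this] show ?thesis by simp
    qed
    also have "\<dots> \<le> cmod (1 - expectation (\<lambda>\<omega>. cis (t * V \<omega>)))"
      using abs_Im_le_cmod[of "1 - expectation (\<lambda>\<omega>. cis (t * V \<omega>))"] by simp
    finally show ?thesis .
  qed
  obtain \<rho> where \<rho>: "\<rho> < 1" "\<And>t. t \<ge> \<delta> \<Longrightarrow> cmod (expectation (\<lambda>\<omega>. cis (t * V \<omega>))) \<le> \<rho>"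
    using gap[OF \<delta>(1)] by blast
  define c where "c = min (\<mu> / 2) (1 - \<rho>)"
  have c: "c > 0" using pos \<rho> by (auto simp: c_def \<mu>_def)
  have "c * min t 1 \<le> cmod (1 - expectation (\<lambda>\<omega>. cis (t * V \<omega>)))" if t: "t \<ge> 0" for t
  proof (cases "t \<ge> \<delta>")
    case True
    have "c * min t 1 \<le> c * 1" using c by (intro mult_left_mono) auto
    also have "\<dots> \<le> 1 - \<rho>" by (simp add: c_def)
    also have "\<dots> \<le> 1 - cmod (expectation (\<lambda>\<omega>. cis (t * V \<omega>)))" using \<rho>(2)[OF True] by simp
    also have "\<dots> \<le> cmod (1 - expectation (\<lambda>\<omega>. cis (t * V \<omega>)))"
      using norm_triangle_ineq2[of 1 "expectation (\<lambda>\<omega>. cis (t * V \<omega>))"] by simp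
    finally show ?thesis .
  next
    case False
    show ?thesis
    proof (cases "t = 0")
      case False
      have "c \<le> \<mu> / 2" unfolding c_def by (rule min.cobounded1)
      then have "c * min t 1 \<le> (\<mu> / 2) * t" using t c by (intro mult_mono) auto
      also have "\<dots> \<le> cmod (1 - expectation (\<lambda>\<omega>. cis (t * V \<omega>)))"
        using small[of t] False t \<open>\<not> \<delta> \<le> t\<close> by (simp add: mult.commute)
      finally show ?thesis .
    qed auto
  qed
  then show ?thesis using c by blast
qed

section \<open>Exponential means of a walk with nonnegative steps\<close>

lemma mult_power2_powr_quarter:
  assumes "n > 0"
  shows "real n * (real n powr (-1/4))\<^sup>2 = real n powr (1/2)"
proof -
  have "(real n powr (-1/4))\<^sup>2 = real n powr (-1/2)"
    by (simp add: power2_eq_square powr_add[symmetric])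
  moreover have "real n powr 1 * real n powr (-1/2) = real n powr (1/2)"
    by (subst powr_add[symmetric]) simp
  ultimately show ?thesis using assms by simp
qed

locale nonneg_walk = prob_space M for M :: "'a measure" +
  fixes V :: "nat \<Rightarrow> 'a \<Rightarrow> real"
  assumes V_indep: "indep_vars (\<lambda>_. borel) V {1..}"
    and V_ident: "\<And>k. k \<ge> 1 \<Longrightarrow> distr M borel (V k) = distr M borel (V 1)"
    and V_nonneg: "\<And>k. k \<ge> 1 \<Longrightarrow> AE \<omega> in M. V k \<omega> \<ge> 0"
    and V_mean: "integrable M (V 1)"
    and V_char: "\<And>\<epsilon>. \<epsilon> > 0 \<Longrightarrow> (SUP t\<in>{t. \<bar>t\<bar> \<ge> \<epsilon>}. cmod (char (distr M borel (V 1)) t)) < 1"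
begin

abbreviation S :: "'a \<Rightarrow> nat \<Rightarrow> real \<Rightarrow> complex" where
  "S \<omega> \<equiv> trig_mean (\<lambda>_. 1) (walk (\<lambda>k. V k \<omega>))"

abbreviation \<mu> :: real where "\<mu> \<equiv> expectation (V 1)"

lemma V_measurable: "k \<ge> 1 \<Longrightarrow> random_variable borel (V k)"
  using V_indep by (auto simp: indep_vars_def)

lemma V1_measurable [measurable]: "random_variable borel (V 1)" "random_variable borel (V (Suc 0))"
  using V_measurable[of 1] by auto

lemma expectation_V:
  fixes g :: "real \<Rightarrow> 'b :: {banach, second_countable_topology}"
  assumes [measurable]: "g \<in> borel_measurable borel" and k: "k \<ge> 1"
  shows "expectation (\<lambda>\<omega>. g (V k \<omega>)) = expectation (\<lambda>\<omega>. g (V 1 \<omega>))"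
proof -
  note V_measurable[OF k, measurable]
  have "expectation (\<lambda>\<omega>. g (V k \<omega>)) = (\<integral>x. g x \<partial>distr M borel (V k))"
    by (subst integral_distr) auto
  also have "\<dots> = expectation (\<lambda>\<omega>. g (V 1 \<omega>))"
    unfolding V_ident[OF k] by (subst integral_distr) auto
  finally show ?thesis .
qed

lemma integrable_V:
  fixes g :: "real \<Rightarrow> 'b :: {banach, second_countable_topology}"
  assumes [measurable]: "g \<in> borel_measurable borel" and k: "k \<ge> 1"
    and int: "integrable M (\<lambda>\<omega>. g (V 1 \<omega>))"
  shows "integrable M (\<lambda>\<omega>. g (V k \<omega>))"
proof -
  note V_measurable[OF k, measurable]
  have "integrable (distr M borel (V 1)) g" by (subst integrable_distr_eq) (use int in auto)
  then have "integrable (distr M borel (V k)) g" unfolding V_ident[OF k] .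
  then show ?thesis by (subst (asm) integrable_distr_eq) auto
qed

lemma char_V1: "char (distr M borel (V 1)) t = expectation (\<lambda>\<omega>. cis (t * V 1 \<omega>))"
  unfolding char_def by (subst integral_distr) (auto simp: cis_conv_exp)

lemma V_char_le:
  assumes "\<epsilon> > 0"
  shows "\<exists>\<rho><1. \<forall>t\<ge>\<epsilon>. cmod (expectation (\<lambda>\<omega>. cis (t * V 1 \<omega>))) \<le> \<rho>"
proof (intro exI conjI allI impI)
  let ?r = "SUP t\<in>{t. \<bar>t\<bar> \<ge> \<epsilon>}. cmod (char (distr M borel (V 1)) t)"
  show "?r < 1" by (rule V_char) fact
  fix t assume t: "t \<ge> \<epsilon>"
  interpret D: real_distribution "distr M borel (V 1)"
    by (rule real_distribution_distr) measurable
  have "cmod (char (distr M borel (V 1)) t) \<le> ?r"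
    by (rule cSUP_upper) (use t assms D.cmod_char_le_1 in \<open>auto intro!: bdd_aboveI2[where M=1]\<close>)
  then show "cmod (expectation (\<lambda>\<omega>. cis (t * V 1 \<omega>))) \<le> ?r" unfolding char_V1 .
qed

text \<open>Steps of mean zero would vanish almost surely, and then \<open>\<phi> = 1\<close> everywhere.\<close>
lemma V_mean_pos: "\<mu> > 0"
proof (rule ccontr)
  assume "\<not> \<mu> > 0"
  moreover have "\<mu> \<ge> 0" using V_nonneg[of 1] by (intro integral_nonneg_AE) auto
  ultimately have "\<mu> = 0" by simp
  then have "AE \<omega> in M. V 1 \<omega> = 0"
    using integral_nonneg_eq_0_iff_AE[OF V_mean] V_nonneg[of 1] by simp
  then have "expectation (\<lambda>\<omega>. cis (1 * V 1 \<omega>)) = expectation (\<lambda>\<omega>. 1)"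
    by (intro integral_cong_AE) (auto elim!: eventually_mono)
  moreover obtain \<rho> where "\<rho> < 1" "\<forall>t\<ge>1. cmod (expectation (\<lambda>\<omega>. cis (t * V 1 \<omega>))) \<le> \<rho>"
    using V_char_le[of 1] by auto
  ultimately show False by (force simp: prob_space)
qed

lemma char_gap: "\<exists>c>0. \<forall>t\<ge>0. c * min t 1 \<le> cmod (1 - expectation (\<lambda>\<omega>. cis (t * V 1 \<omega>)))"
  by (rule characteristic_gap[OF V_mean V_mean_pos V_char_le])

lemma walk_measurable: "random_variable borel (\<lambda>\<omega>. walk (\<lambda>k. V k \<omega>) j)"
  by (rule measurable_walk) (auto intro: V_measurable)

lemma walk_integrable: "integrable M (\<lambda>\<omega>. walk (\<lambda>k. V k \<omega>) j)"
  unfolding walk_def by (rule Bochner_Integration.integrable_sum) (auto intro: integrable_V[of "\<lambda>x. x"] V_mean)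

lemma AE_sum_walk_le: "AE \<omega> in M. \<exists>W. \<forall>n. (\<Sum>j=1..n. \<bar>walk (\<lambda>k. V k \<omega>) j\<bar>) \<le> W * real n powr 3"
proof (rule AE_partial_sums_le_powr[where q=1])
  fix j :: nat assume "j \<ge> 1"
  have "expectation (\<lambda>\<omega>. \<bar>walk (\<lambda>k. V k \<omega>) j\<bar>) \<le> expectation (\<lambda>\<omega>. \<Sum>k=1..j. \<bar>V k \<omega>\<bar>)"
    by (rule integral_mono)
       (auto simp: walk_def intro!: sum_abs Bochner_Integration.integrable_sum integrable_abs integrable_V[of "\<lambda>x. x"] V_mean)
  also have "\<dots> = (\<Sum>k=1..j. expectation (\<lambda>\<omega>. \<bar>V k \<omega>\<bar>))"
    by (rule Bochner_Integration.integral_sum) (auto intro!: integrable_V[of "\<lambda>x. x"] V_mean)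
  also have "\<dots> = (\<Sum>k=1..j. expectation (\<lambda>\<omega>. \<bar>V 1 \<omega>\<bar>))"
    by (intro sum.cong refl expectation_V[of abs]) auto
  finally show "expectation (\<lambda>\<omega>. \<bar>walk (\<lambda>k. V k \<omega>) j\<bar>) \<le> expectation (\<lambda>\<omega>. \<bar>V 1 \<omega>\<bar>) * real j powr 1"
    by (simp add: mult.commute)
qed (auto simp: walk_integrable)

text \<open>With \<open>|1 - \<phi>(t)| \<ge> c min (t, 1)\<close>, the tail of \<open>S\<close> at \<open>t \<ge> a\<^sub>n\<close> and level \<open>y\<^sub>n\<close> is a stretched exponential
as soon as \<open>n min (a\<^sub>n, 1) y\<^sub>n\<^sup>2\<close> grows like a power of \<open>n\<close>. The two instances that follow trade the
range of \<open>t\<close> against the level.\<close>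
lemma AE_S_small:
  fixes a y :: "nat \<Rightarrow> real"
  assumes a: "\<And>n. a n \<ge> 0" and \<alpha>: "\<alpha> > 0"
    and y: "\<forall>\<^sub>F n in sequentially. 0 < y n \<and> y n \<le> 1"
    and rate: "\<forall>\<^sub>F n in sequentially. b * real n powr \<alpha> \<le> n * min (a n) 1 * (y n)\<^sup>2" and b: "b > 0"
  shows "AE \<omega> in M. \<forall>\<^sub>F n in sequentially. \<forall>t. a n \<le> t \<and> t \<le> real n \<longrightarrow> cmod (S \<omega> n t) \<le> y n + 1 / n"
proof -
  obtain c where c: "c > 0" "\<And>t. t \<ge> 0 \<Longrightarrow> c * min t 1 \<le> cmod (1 - expectation (\<lambda>\<omega>. cis (t * V 1 \<omega>)))"
    using char_gap by blast
  show ?thesis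
  \<comment> \<open>The sums of the positions are \<open>O(n\<^sup>3)\<close>, well below the Lipschitz bound \<open>n\<^sup>9\<close> that the grid tolerates.\<close>
  proof (rule trig_mean_uniformly_small[where c="c * b / 32" and C=12 and \<alpha>=\<alpha>])
    show "AE \<omega> in M. \<forall>\<^sub>F n in sequentially. (\<Sum>j=1..n. \<bar>1 * walk (\<lambda>k. V k \<omega>) j\<bar>) \<le> real n ^ 9"
      using AE_sum_walk_le
    proof eventually_elim
      case (elim \<omega>)
      then obtain W where W: "\<And>n. (\<Sum>j=1..n. \<bar>walk (\<lambda>k. V k \<omega>) j\<bar>) \<le> W * real n powr 3" by blast
      have "\<bar>W\<bar> + 1 > 0" by simp
      then have "\<forall>\<^sub>F n::nat in sequentially. (\<bar>W\<bar> + 1) * real n powr 3 \<le> real n ^ 9"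
        by real_asymp
      then show ?case using eventually_gt_at_top[of 0]
      proof eventually_elim
        case (elim n)
        have "(\<Sum>j=1..n. \<bar>1 * walk (\<lambda>k. V k \<omega>) j\<bar>) \<le> W * real n powr 3" using W[of n] by simp
        also have "\<dots> \<le> (\<bar>W\<bar> + 1) * real n powr 3" by (intro mult_right_mono) auto
        also have "\<dots> \<le> real n ^ 9" using elim by blast
        finally show ?case .
      qed
    qed
    show "\<forall>\<^sub>F n in sequentially. \<forall>t. a n \<le> t \<and> t \<le> real n \<longrightarrow>
        prob {\<omega>\<in>space M. cmod (S \<omega> n t) > y n} \<le> 12 * exp (- (c * b / 32) * n powr \<alpha>)"
      using y rate
    proof eventually_elim
      case (elim n)
      show ?case
      proof (intro allI impI)
        fix t assume t: "a n \<le> t \<and> t \<le> real n"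
        have "prob {\<omega>\<in>space M. cmod (S \<omega> n t) > y n}
          \<le> 12 * exp (- (n * cmod (1 - expectation (\<lambda>\<omega>. cis (t * V 1 \<omega>))) * (y n)\<^sup>2 / 32))"
        proof (rule walk_trig_mean_tail[OF V_indep])
          show "expectation (\<lambda>\<omega>. cis (t * V k \<omega>)) = expectation (\<lambda>\<omega>. cis (t * V 1 \<omega>))" if "k \<ge> 1" for k
            using that by (intro expectation_V[of "\<lambda>x. cis (t * x)"]) auto
        qed (use elim in auto)
        also have "\<dots> \<le> 12 * exp (- (c * b / 32) * n powr \<alpha>)"
        proof -
          have "c * (b * real n powr \<alpha>) \<le> c * (n * min (a n) 1 * (y n)\<^sup>2)"
            using elim c by (intro mult_left_mono) auto
          also have "\<dots> = n * (c * min (a n) 1) * (y n)\<^sup>2" by (simp add: mult_ac)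
          also have "\<dots> \<le> n * cmod (1 - expectation (\<lambda>\<omega>. cis (t * V 1 \<omega>))) * (y n)\<^sup>2"
          proof (intro mult_right_mono mult_left_mono)
            have "c * min (a n) 1 \<le> c * min t 1" using c t by (intro mult_left_mono) auto
            also have "\<dots> \<le> cmod (1 - expectation (\<lambda>\<omega>. cis (t * V 1 \<omega>)))" using a[of n] t by (intro c) linarith
            finally show "c * min (a n) 1 \<le> cmod (1 - expectation (\<lambda>\<omega>. cis (t * V 1 \<omega>)))" .
          qed auto
          finally show ?thesis by simp
        qed
        finally show "prob {\<omega>\<in>space M. cmod (S \<omega> n t) > y n} \<le> 12 * exp (- (c * b / 32) * n powr \<alpha>)" .
      qed
    qed
    show "c * b / 32 > 0" using c b by simp
  qed (simp | rule a \<alpha> walk_measurable)+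
qed

lemma AE_S_far:
  assumes "\<epsilon> > 0"
  shows "AE \<omega> in M. \<forall>\<^sub>F n in sequentially. \<forall>t. \<epsilon> \<le> t \<and> t \<le> real n \<longrightarrow> cmod (S \<omega> n t) \<le> n powr (-1/4) + 1 / n"
proof (rule AE_S_small[where \<alpha>="1/2" and b="min \<epsilon> 1"])
  have "\<forall>\<^sub>F n::nat in sequentially. 0 < real n powr (-1/4)" "\<forall>\<^sub>F n::nat in sequentially. real n powr (-1/4) \<le> 1"
    by real_asymp+
  then show "\<forall>\<^sub>F n in sequentially. 0 < real n powr (-1/4) \<and> real n powr (-1/4) \<le> 1"
    by (rule eventually_conj)
  show "\<forall>\<^sub>F n in sequentially. min \<epsilon> 1 * real n powr (1/2) \<le> n * min \<epsilon> 1 * (real n powr (-1/4))\<^sup>2"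
    using eventually_gt_at_top[of 0]
  proof eventually_elim
    case (elim n)
    then have "min \<epsilon> 1 * real n powr (1/2) = min \<epsilon> 1 * (n * (real n powr (-1/4))\<^sup>2)"
      by (simp only: mult_power2_powr_quarter)
    then show ?case by (simp only: mult_ac order_refl)
  qed
qed (use assms in auto)

lemma AE_S_half:
  assumes \<alpha>: "\<alpha> > 0"
  shows "AE \<omega> in M. \<forall>\<^sub>F n in sequentially. \<forall>t. n powr (-1 + \<alpha>) \<le> t \<and> t \<le> real n \<longrightarrow> cmod (S \<omega> n t) \<le> 1/2"
proof -
  have "AE \<omega> in M. \<forall>\<^sub>F n in sequentially. \<forall>t. n powr (-1 + \<alpha>) \<le> t \<and> t \<le> real n \<longrightarrow> cmod (S \<omega> n t) \<le> 1/4 + 1 / n"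
  proof (rule AE_S_small[where \<alpha>="min \<alpha> 1" and b="1/16" and y="\<lambda>_. 1/4"])
    show "\<forall>\<^sub>F n in sequentially. 1/16 * real n powr min \<alpha> 1 \<le> n * min (real n powr (-1 + \<alpha>)) 1 * (1/4)\<^sup>2"
      using eventually_ge_at_top[of 1]
    proof eventually_elim
      case (elim n)
      have "real n powr min \<alpha> 1 \<le> n * min (real n powr (-1 + \<alpha>)) 1"
      proof (cases "\<alpha> \<le> 1")
        case True
        then have "real n powr (-1 + \<alpha>) \<le> 1" using elim powr_mono[of "-1 + \<alpha>" 0 n] by simp
        moreover have "real n powr \<alpha> = real n * real n powr (-1 + \<alpha>)"
          using elim powr_add[of "real n" 1 "-1 + \<alpha>"] by simp
        ultimately show ?thesis using True by (simp add: min_def)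
      next
        case False
        then have "real n powr (-1 + \<alpha>) \<ge> 1" using elim by (intro ge_one_powr_ge_zero) auto
        then show ?thesis using False elim by (simp add: min_def)
      qed
      then show ?case by (simp add: power2_eq_square)
    qed
  qed (use \<alpha> in auto)
  then show ?thesis
  proof eventually_elim
    case (elim \<omega>)
    then show ?case using eventually_ge_at_top[of 4]
    proof eventually_elim
      case (elim n)
      have "1 / real n \<le> 1 / 4" using elim by (intro divide_left_mono) auto
      then have "1 / 4 + 1 / real n \<le> 1 / 2" by simp
      then show ?case using elim(1) by (meson order_trans)
    qed
  qed
qed

lemma walk_variance:
  assumes sq: "integrable M (\<lambda>\<omega>. (V 1 \<omega>)\<^sup>2)"
  shows "integrable M (\<lambda>\<omega>. (walk (\<lambda>k. V k \<omega>) j - j * \<mu>)\<^sup>2) \<and>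
    expectation (\<lambda>\<omega>. (walk (\<lambda>k. V k \<omega>) j - j * \<mu>)\<^sup>2) = j * expectation (\<lambda>\<omega>. (V 1 \<omega> - \<mu>)\<^sup>2)"
proof (induction j)
  case 0
  then show ?case by (simp add: walk_def)
next
  case (Suc j)
  define A where "A \<omega> = walk (\<lambda>k. V k \<omega>) j - j * \<mu>" for \<omega>
  define B where "B \<omega> = V (Suc j) \<omega> - \<mu>" for \<omega>
  have intB2: "integrable M (\<lambda>\<omega>. (V 1 \<omega> - \<mu>)\<^sup>2)"
    using sq V_mean by (simp add: power2_diff)
  have B2: "integrable M (\<lambda>\<omega>. (B \<omega>)\<^sup>2)" unfolding B_def
    by (rule integrable_V[of "\<lambda>x. (x - \<mu>)\<^sup>2", OF _ _ intB2]) auto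
  have B: "integrable M B" unfolding B_def
    by (rule integrable_V[of "\<lambda>x. x - \<mu>"]) (use V_mean in auto)
  have EB: "expectation B = 0" unfolding B_def
    using expectation_V[of "\<lambda>x. x - \<mu>" "Suc j"] V_mean by (simp add: prob_space)
  have EB2: "expectation (\<lambda>\<omega>. (B \<omega>)\<^sup>2) = expectation (\<lambda>\<omega>. (V 1 \<omega> - \<mu>)\<^sup>2)" unfolding B_def
    by (rule expectation_V[of "\<lambda>x. (x - \<mu>)\<^sup>2"]) auto
  have A: "integrable M A" unfolding A_def using walk_integrable by auto
  have "indep_var borel (V (Suc j)) borel (\<lambda>\<omega>. \<Sum>i\<in>{1..j}. V i \<omega>)"
    by (rule indep_vars_sum) (auto intro: indep_vars_subset[OF V_indep])
  then have "indep_var borel ((\<lambda>x. x - \<mu>) \<circ> V (Suc j)) borel ((\<lambda>x. x - j * \<mu>) \<circ> (\<lambda>\<omega>. \<Sum>i\<in>{1..j}. V i \<omega>))"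
    by (rule indep_var_compose) auto
  moreover have "(\<lambda>x. x - \<mu>) \<circ> V (Suc j) = B" "(\<lambda>x. x - j * \<mu>) \<circ> (\<lambda>\<omega>. \<Sum>i\<in>{1..j}. V i \<omega>) = A"
    by (auto simp: fun_eq_iff A_def B_def walk_def)
  ultimately have ind: "indep_var borel B borel A" by simp
  have AB: "integrable M (\<lambda>\<omega>. B \<omega> * A \<omega>)" by (rule indep_var_integrable[OF ind B A])
  have EAB: "expectation (\<lambda>\<omega>. B \<omega> * A \<omega>) = 0"
    using indep_var_lebesgue_integral[OF ind B A] EB by simp
  have eq: "(walk (\<lambda>k. V k \<omega>) (Suc j) - Suc j * \<mu>)\<^sup>2 = (A \<omega>)\<^sup>2 + 2 * (B \<omega> * A \<omega>) + (B \<omega>)\<^sup>2" for \<omega>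
    by (simp add: A_def B_def walk_def power2_eq_square algebra_simps)
  have A2: "integrable M (\<lambda>\<omega>. (A \<omega>)\<^sup>2)" "expectation (\<lambda>\<omega>. (A \<omega>)\<^sup>2) = j * expectation (\<lambda>\<omega>. (V 1 \<omega> - \<mu>)\<^sup>2)"
    using Suc by (auto simp: A_def)
  show ?case unfolding eq using A2 AB B2 EAB EB2 by (simp add: distrib_right)
qed

text \<open>The standard deviation of \<open>X\<^sub>j\<close> is of order \<open>j\<^bsup>1/2\<^esup>\<close>, so every exponent above \<open>3/2\<close> is available. The value
\<open>15/8 = 2 - 1/8\<close> leaves, after multiplication by \<open>t/n \<le> n\<^bsup>-2+1/16\<^esup>\<close>, a negative power of \<open>n\<close>.\<close>
lemma AE_sum_walk_deviation_le:
  assumes sq: "integrable M (\<lambda>\<omega>. (V 1 \<omega>)\<^sup>2)"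
  shows "AE \<omega> in M. \<exists>W. \<forall>n. (\<Sum>j=1..n. \<bar>walk (\<lambda>k. V k \<omega>) j - j * \<mu>\<bar>) \<le> W * real n powr (15/8)"
proof (rule AE_partial_sums_le_powr[where q="1/2"])
  fix j :: nat assume j: "j \<ge> 1"
  define D where "D \<omega> = walk (\<lambda>k. V k \<omega>) j - j * \<mu>" for \<omega>
  define v where "v = expectation (\<lambda>\<omega>. (V 1 \<omega> - \<mu>)\<^sup>2)"
  have D2: "integrable M (\<lambda>\<omega>. (D \<omega>)\<^sup>2)" "expectation (\<lambda>\<omega>. (D \<omega>)\<^sup>2) = j * v"
    using walk_variance[OF sq, of j] by (auto simp: D_def v_def)
  have D: "integrable M D" unfolding D_def using walk_integrable by auto
  have "expectation (\<lambda>\<omega>. \<bar>D \<omega>\<bar>) \<le> expectation (\<lambda>\<omega>. ((D \<omega>)\<^sup>2 / sqrt j + sqrt j) / 2)"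
  proof (rule integral_mono)
    fix \<omega>
    have "0 \<le> (\<bar>D \<omega>\<bar> - sqrt j)\<^sup>2" by simp
    then have "2 * (\<bar>D \<omega>\<bar> * sqrt j) \<le> (D \<omega>)\<^sup>2 + j" by (simp add: power2_diff)
    then have "2 * (\<bar>D \<omega>\<bar> * sqrt j) \<le> (D \<omega>)\<^sup>2 + sqrt j * sqrt j" by simp
    then show "\<bar>D \<omega>\<bar> \<le> ((D \<omega>)\<^sup>2 / sqrt j + sqrt j) / 2" using j by (simp add: field_simps del: real_sqrt_mult_self)
  qed (use D D2 in auto)
  also have "\<dots> = (j * v / sqrt j + sqrt j) / 2" using D2 by (simp add: prob_space)
  also have "j * v / sqrt j = sqrt j * v" using j by (simp add: field_simps)
  also have "(sqrt j * v + sqrt j) / 2 = (v + 1) / 2 * real j powr (1/2)"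
    by (simp add: powr_half_sqrt algebra_simps)
  finally show "expectation (\<lambda>\<omega>. \<bar>D \<omega>\<bar>) \<le> (v + 1) / 2 * real j powr (1/2)" .
qed (use walk_integrable in auto)

text \<open>Two ranges overlap: from \<open>n\<^bsup>-1+1/16\<^esup>\<close> on, concentration bounds \<open>S\<close> by \<open>1/2\<close>; below, the law of large numbers
replaces the walk by its drift \<open>\<mu> j\<close>, and the Dirichlet kernel takes over.\<close>
lemma AE_S_contraction:
  assumes sq: "integrable M (\<lambda>\<omega>. (V 1 \<omega>)\<^sup>2)" and \<epsilon>: "\<epsilon> > 0"
  shows "\<exists>\<kappa>>0. AE \<omega> in M. \<forall>\<^sub>F n in sequentially. \<forall>t. \<epsilon> / n \<le> t \<and> t \<le> real n \<longrightarrow> cmod (S \<omega> n t) \<le> 1 - \<kappa>"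
proof -
  have "\<epsilon> * \<mu> > 0" using \<epsilon> V_mean_pos by simp
  from arithmetic_trig_mean_contraction[OF this]
  obtain k h where k: "k > 0" and h: "h > 0"
    and K: "\<And>n \<theta>. 0 < n \<Longrightarrow> \<epsilon> * \<mu> / real n \<le> \<theta> \<Longrightarrow> \<theta> \<le> h \<Longrightarrow> cmod (trig_mean (\<lambda>_. 1) real n \<theta>) \<le> 1 - k"
    by blast
  define \<kappa> where "\<kappa> = min (k / 2) (1 / 2)"
  have sixteenth: "(1 / 16 :: real) > 0" by simp
  have "AE \<omega> in M. \<forall>\<^sub>F n in sequentially. \<forall>t. \<epsilon> / n \<le> t \<and> t \<le> real n \<longrightarrow> cmod (S \<omega> n t) \<le> 1 - \<kappa>"
    using AE_S_half[of "1/16", OF sixteenth] AE_sum_walk_deviation_le[OF sq]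
  proof eventually_elim
    case (elim \<omega>)
    then obtain W where W: "\<And>n. (\<Sum>j=1..n. \<bar>walk (\<lambda>k. V k \<omega>) j - j * \<mu>\<bar>) \<le> W * real n powr (15/8)" by blast
    have half: "\<forall>\<^sub>F n in sequentially. \<forall>t. real n powr (-1 + 1/16) \<le> t \<and> t \<le> real n \<longrightarrow> cmod (S \<omega> n t) \<le> 1/2"
      using elim by simp
    have "(\<lambda>n::nat. (\<bar>W\<bar> + 1) * real n powr (-1/16)) \<longlonglongrightarrow> 0" by real_asymp
    then have ev1: "\<forall>\<^sub>F n::nat in sequentially. (\<bar>W\<bar> + 1) * real n powr (-1/16) < k / 2"
      by (rule order_tendstoD) (use k in simp)
    have "(\<lambda>n::nat. real n powr (-1 + 1/16)) \<longlonglongrightarrow> 0" by real_asymp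
    then have "(\<lambda>n::nat. \<mu> * real n powr (-1 + 1/16)) \<longlonglongrightarrow> 0" by (rule tendsto_mult_right_zero)
    then have ev2: "\<forall>\<^sub>F n::nat in sequentially. \<mu> * real n powr (-1 + 1/16) < h"
      by (rule order_tendstoD) (use h in simp)
    from half ev1 ev2 eventually_gt_at_top[of 0] show ?case
    proof eventually_elim
      case (elim n)
      show ?case
      proof (intro allI impI)
        fix t assume t: "\<epsilon> / n \<le> t \<and> t \<le> real n"
        show "cmod (S \<omega> n t) \<le> 1 - \<kappa>"
        proof (cases "real n powr (-1 + 1/16) \<le> t")
          case True
          then have "cmod (S \<omega> n t) \<le> 1/2" using elim t by blast
          then show ?thesis by (simp add: \<kappa>_def min_def)
        next
          case False
          have n: "n > 0" using elim by simp
          have t0: "t > 0" using t \<epsilon> n by (meson divide_pos_pos less_le_trans of_nat_0_less_iff)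
          have "\<mu> * t \<le> \<mu> * real n powr (-1 + 1/16)" using False V_mean_pos by (intro mult_left_mono) auto
          then have \<theta>h: "t * \<mu> \<le> h" using elim by (simp add: mult.commute)
          have "\<epsilon> / n * \<mu> \<le> t * \<mu>" using t V_mean_pos by (intro mult_right_mono) auto
          then have D: "cmod (trig_mean (\<lambda>_. 1) real n (t * \<mu>)) \<le> 1 - k" by (intro K n \<theta>h) simp
          have "cmod (S \<omega> n t - trig_mean (\<lambda>_. 1) real n (t * \<mu>)) = cmod (\<Sum>j=1..n. cis (t * walk (\<lambda>k. V k \<omega>) j) - cis (t * \<mu> * j)) / n"
            unfolding trig_mean_def by (simp add: diff_divide_distrib[symmetric] norm_divide sum_subtractf[symmetric])
          also have "\<dots> \<le> (\<Sum>j=1..n. t * \<bar>walk (\<lambda>k. V k \<omega>) j - j * \<mu>\<bar>) / n"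
          proof (intro divide_right_mono order_trans[OF norm_sum] sum_mono)
            fix j
            have "cmod (cis (t * walk (\<lambda>k. V k \<omega>) j) - cis (t * \<mu> * j)) \<le> \<bar>t * walk (\<lambda>k. V k \<omega>) j - t * \<mu> * j\<bar>"
              by (rule cmod_cis_diff_le)
            also have "t * walk (\<lambda>k. V k \<omega>) j - t * \<mu> * j = t * (walk (\<lambda>k. V k \<omega>) j - j * \<mu>)" by (simp add: algebra_simps)
            finally show "cmod (cis (t * walk (\<lambda>k. V k \<omega>) j) - cis (t * \<mu> * j)) \<le> t * \<bar>walk (\<lambda>k. V k \<omega>) j - j * \<mu>\<bar>"
              using t0 by (simp add: abs_mult)
          qed simp
          also have "\<dots> = t * (\<Sum>j=1..n. \<bar>walk (\<lambda>k. V k \<omega>) j - j * \<mu>\<bar>) / n" by (simp add: sum_distrib_left)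
          also have "\<dots> \<le> real n powr (-1 + 1/16) * ((\<bar>W\<bar> + 1) * real n powr (15/8)) / n"
          proof (intro divide_right_mono mult_mono)
            show "(\<Sum>j=1..n. \<bar>walk (\<lambda>k. V k \<omega>) j - j * \<mu>\<bar>) \<le> (\<bar>W\<bar> + 1) * real n powr (15/8)"
              by (rule order_trans[OF W]) (auto intro!: mult_right_mono)
          qed (use False in \<open>auto intro!: sum_nonneg\<close>)
          also have "\<dots> = (\<bar>W\<bar> + 1) * (real n powr (-1 + 1/16) * (real n powr (15/8) * real n powr -1))"
            using n by (simp add: powr_minus_divide)
          also have "real n powr (-1 + 1/16) * (real n powr (15/8) * real n powr -1) = real n powr (-1/16)"
            unfolding powr_add[symmetric] by simp
          also have "(\<bar>W\<bar> + 1) * real n powr (-1/16) < k / 2" using elim by blast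
          finally have "cmod (S \<omega> n t) \<le> 1 - k / 2"
            using D norm_triangle_sub[of "S \<omega> n t" "trig_mean (\<lambda>_. 1) real n (t * \<mu>)"] by linarith
          then show ?thesis by (simp add: \<kappa>_def min_def)
        qed
      qed
    qed
  qed
  moreover have "\<kappa> > 0" using k by (simp add: \<kappa>_def)
  ultimately show ?thesis by blast
qed

end

locale noisy_walk = nonneg_walk M V for M :: "'a measure" and V +
  fixes eps :: "nat \<Rightarrow> 'a \<Rightarrow> real" and \<sigma> :: real
  assumes sigma_pos: "\<sigma> > 0"
    and eps_indep: "indep_vars (\<lambda>_. borel) eps {1..}"
    and eps_normal: "\<And>j. j \<ge> 1 \<Longrightarrow> distributed M lborel (eps j) (normal_density 0 \<sigma>)"
    and eps_walk_indep: "indep_var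
           (\<Pi>\<^sub>M j\<in>{1..}. borel) (\<lambda>\<omega>. \<lambda>j\<in>{1..}. eps j \<omega>)
           (\<Pi>\<^sub>M j\<in>{1..}. borel) (\<lambda>\<omega>. \<lambda>j\<in>{1..}. walk (\<lambda>k. V k \<omega>) j)"
begin

abbreviation N :: "'a \<Rightarrow> nat \<Rightarrow> real \<Rightarrow> complex" where
  "N \<omega> \<equiv> trig_mean (\<lambda>j. eps j \<omega>) (walk (\<lambda>k. V k \<omega>))"

lemma AE_sum_eps_le: "AE \<omega> in M. \<exists>W. \<forall>n. (\<Sum>j=1..n. \<bar>eps j \<omega>\<bar>) \<le> W * real n powr 2"
proof (rule AE_partial_sums_le_powr[where q=0])
  fix j :: nat assume j: "j \<ge> 1"
  show "integrable M (eps j)"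
    by (subst distributed_integrable[OF eps_normal[OF j], where g="\<lambda>x. x", symmetric])
       (auto intro: integrable_normal_moment_nz_1 sigma_pos)
  have "expectation (\<lambda>\<omega>. \<bar>eps j \<omega>\<bar>) = (\<integral>x. normal_density 0 \<sigma> x * \<bar>x\<bar> \<partial>lborel)"
    by (subst distributed_integral[OF eps_normal[OF j]]) auto
  then show "expectation (\<lambda>\<omega>. \<bar>eps j \<omega>\<bar>) \<le> (\<integral>x. normal_density 0 \<sigma> x * \<bar>x\<bar> \<partial>lborel) * real j powr 0"
    using j by simp
qed auto

text \<open>The tail bound for the noise does not degenerate as \<open>t\<close> approaches \<open>0\<close>, so the grid may start there.\<close>
lemma AE_N_small:
  "AE \<omega> in M. \<forall>\<^sub>F n in sequentially. \<forall>t. 0 \<le> t \<and> t \<le> real n \<longrightarrow> cmod (N \<omega> n t) \<le> n powr (-1/4) + 1 / n"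
proof (rule trig_mean_uniformly_small[where a="\<lambda>_. 0" and c="1 / (8 * \<sigma>\<^sup>2)" and C=4 and \<alpha>="1/2"])
  show "AE \<omega> in M. \<forall>\<^sub>F n in sequentially. (\<Sum>j=1..n. \<bar>eps j \<omega> * walk (\<lambda>k. V k \<omega>) j\<bar>) \<le> real n ^ 9"
    using AE_sum_walk_le AE_sum_eps_le
  proof eventually_elim
    case (elim \<omega>)
    then obtain W W' where W: "\<And>n. (\<Sum>j=1..n. \<bar>walk (\<lambda>k. V k \<omega>) j\<bar>) \<le> W * real n powr 3"
      and W': "\<And>n. (\<Sum>j=1..n. \<bar>eps j \<omega>\<bar>) \<le> W' * real n powr 2" by blast
    have "\<bar>W\<bar> + 1 > 0" "\<bar>W'\<bar> + 1 > 0" by simp_all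
    then have "\<forall>\<^sub>F n::nat in sequentially. ((\<bar>W'\<bar> + 1) * real n powr 2) * ((\<bar>W\<bar> + 1) * real n powr 3) \<le> real n ^ 9"
      by real_asymp
    then show ?case using eventually_gt_at_top[of 0]
    proof eventually_elim
      case (elim n)
      have "(\<Sum>j=1..n. \<bar>eps j \<omega> * walk (\<lambda>k. V k \<omega>) j\<bar>) \<le> (\<Sum>j=1..n. \<bar>eps j \<omega>\<bar> * (\<Sum>j=1..n. \<bar>walk (\<lambda>k. V k \<omega>) j\<bar>))"
        unfolding abs_mult by (intro sum_mono mult_left_mono member_le_sum) auto
      also have "\<dots> = (\<Sum>j=1..n. \<bar>eps j \<omega>\<bar>) * (\<Sum>j=1..n. \<bar>walk (\<lambda>k. V k \<omega>) j\<bar>)" by (simp add: sum_distrib_right)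
      also have "\<dots> \<le> ((\<bar>W'\<bar> + 1) * real n powr 2) * ((\<bar>W\<bar> + 1) * real n powr 3)"
        by (intro mult_mono order_trans[OF W] order_trans[OF W'] mult_right_mono) (auto intro!: sum_nonneg)
      also have "\<dots> \<le> real n ^ 9" using elim by blast
      finally show ?case .
    qed
  qed
  show "\<forall>\<^sub>F n in sequentially. \<forall>t. 0 \<le> t \<and> t \<le> real n \<longrightarrow>
      prob {\<omega>\<in>space M. cmod (N \<omega> n t) > real n powr (-1/4)} \<le> 4 * exp (- (1 / (8 * \<sigma>\<^sup>2)) * n powr (1/2))"
    using eventually_gt_at_top[of 0]
  proof eventually_elim
    case (elim n)
    have e: "n * (real n powr (-1/4))\<^sup>2 = real n powr (1/2)" using elim by (rule mult_power2_powr_quarter)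
    show ?case
    proof (intro allI impI)
      fix t
      have "prob {\<omega>\<in>space M. cmod (N \<omega> n t) > real n powr (-1/4)} \<le> 4 * exp (- (n * (real n powr (-1/4))\<^sup>2 / (8 * \<sigma>\<^sup>2)))"
        by (rule noise_trig_mean_tail[OF eps_indep sigma_pos eps_normal eps_walk_indep]) (use elim in auto)
      then show "prob {\<omega>\<in>space M. cmod (N \<omega> n t) > real n powr (-1/4)} \<le> 4 * exp (- (1 / (8 * \<sigma>\<^sup>2)) * n powr (1/2))"
        unfolding e by simp
    qed
  qed
  show "random_variable borel (eps j)" if "j \<ge> 1" for j using eps_indep that by (auto simp: indep_vars_def)
  show "1 / (8 * \<sigma>\<^sup>2) > 0" using sigma_pos by simp
qed (simp | rule walk_measurable)+

end

section \<open>Periods and harmonics\<close>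

lemma has_period_add: "has_period s a \<Longrightarrow> has_period s b \<Longrightarrow> has_period s (a + b)"
  unfolding has_period_def by (metis add.assoc)

lemma has_period_uminus: "has_period s a \<Longrightarrow> has_period s (- a)"
  unfolding has_period_def by (metis add.commute uminus_add_conv_diff add_diff_cancel_left' diff_add_cancel)

lemma has_period_of_nat_mult: "has_period s a \<Longrightarrow> has_period s (of_nat m * a)"
proof (induction m)
  case 0
  then show ?case by (simp add: has_period_def)
next
  case (Suc m)
  then show ?case using has_period_add[of s a "of_nat m * a"] by (simp add: algebra_simps)
qed

lemma subharmonic_has_period:
  assumes "fundamental_frequency s fs"
  shows "has_period s (1 / (fs / of_nat m))"
  using has_period_of_nat_mult[of s "1 / fs" m] assms by (simp add: fundamental_frequency_def)

text \<open>The remainder of \<open>1/f\<close> modulo the smallest period is again a period, hence zero.\<close>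
lemma frequency_is_subharmonic:
  assumes fs: "fundamental_frequency s fs" and f: "f > 0" "has_period s (1 / f)"
  shows "\<exists>m::nat. m \<ge> 1 \<and> f = fs / m"
proof -
  have fs0: "fs > 0" and P: "has_period s (1 / fs)" and min: "\<And>T. T > 0 \<Longrightarrow> has_period s T \<Longrightarrow> 1 / fs \<le> T"
    using fs by (auto simp: fundamental_frequency_def)
  define m where "m = nat \<lfloor>fs / f\<rfloor>"
  have m: "real m \<le> fs / f" "fs / f < real m + 1"
    using f fs0 unfolding m_def by (auto simp: of_nat_nat)
  define T where "T = 1 / f - real m * (1 / fs)"
  have "has_period s T"
    unfolding T_def diff_conv_add_uminus by (intro has_period_add has_period_uminus has_period_of_nat_mult P f)
  moreover have "T = (fs / f - m) / fs" using fs0 by (simp add: T_def diff_divide_distrib)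
  then have "T \<ge> 0" "T < 1 / fs" using m fs0 by (auto intro!: divide_nonneg_pos divide_strict_right_mono)
  ultimately have "T = 0" using min[of T] by linarith
  then have eq: "fs = real m * f" using f fs0 by (simp add: T_def field_simps)
  then have "m \<ge> 1" using fs0 by (cases m) auto
  then show ?thesis using eq by (intro exI[of _ m]) simp
qed

text \<open>The integer combinations of elements of \<open>B\<close> are closed under remainders, so the least positive one
divides all of \<open>B\<close>. The point is that finitely many elements suffice.\<close>
lemma bezout_nat_set:
  fixes B :: "nat set"
  assumes "Gcd B = 1"
  shows "\<exists>A (a :: nat \<Rightarrow> int). finite A \<and> A \<subseteq> B \<and> (\<Sum>p\<in>A. a p * int p) = 1"
proof -
  define H where "H = {h. \<exists>A (a :: nat \<Rightarrow> int). finite A \<and> A \<subseteq> B \<and> h = (\<Sum>p\<in>A. a p * int p)}"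
  have comb: "u - q * v \<in> H" if "u \<in> H" "v \<in> H" for u v q
  proof -
    from that(1) have "\<exists>A (a :: nat \<Rightarrow> int). finite A \<and> A \<subseteq> B \<and> u = (\<Sum>p\<in>A. a p * int p)"
      unfolding H_def by (rule CollectD)
    then obtain A a where A: "finite A" "A \<subseteq> B" "u = (\<Sum>p\<in>A. a p * int p)"
      by (elim exE conjE)
    from that(2) have "\<exists>C (c :: nat \<Rightarrow> int). finite C \<and> C \<subseteq> B \<and> v = (\<Sum>p\<in>C. c p * int p)"
      unfolding H_def by (rule CollectD)
    then obtain C c where C: "finite C" "C \<subseteq> B" "v = (\<Sum>p\<in>C. c p * int p)"
      by (elim exE conjE)
    let ?a = "\<lambda>p. (if p \<in> A then a p else 0) - q * (if p \<in> C then c p else 0)"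
    have "u = (\<Sum>p\<in>A \<union> C. (if p \<in> A then a p else 0) * int p)"
      unfolding A(3) using A C by (intro sum.mono_neutral_cong_left) auto
    moreover have "v = (\<Sum>p\<in>A \<union> C. (if p \<in> C then c p else 0) * int p)"
      unfolding C(3) using A C by (intro sum.mono_neutral_cong_left) auto
    ultimately have "u - q * v = (\<Sum>p\<in>A \<union> C. ?a p * int p)"
      by (simp add: sum_distrib_left sum_subtractf[symmetric] algebra_simps)
    then have "finite (A \<union> C) \<and> A \<union> C \<subseteq> B \<and> u - q * v = (\<Sum>p\<in>A \<union> C. ?a p * int p)"
      using A(1,2) C(1,2) by simp
    then show ?thesis unfolding H_def by (intro CollectI exI)
  qed
  have gen: "int p \<in> H" if "p \<in> B" for p
  proof -
    have "finite {p} \<and> {p} \<subseteq> B \<and> int p = (\<Sum>q\<in>{p}. 1 * int q)" using that by simp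
    then show ?thesis unfolding H_def by (intro CollectI exI)
  qed
  have "\<not> B \<subseteq> {0}" using assms by (metis Gcd_0_iff zero_neq_one)
  then obtain p0 where p0: "p0 \<in> B" "p0 \<noteq> 0" by blast
  \<comment> \<open>The generator of the ideal \<open>H\<close>.\<close>
  define h where "h = (LEAST h::nat. h > 0 \<and> int h \<in> H)"
  have "\<exists>h::nat. h > 0 \<and> int h \<in> H" using p0 gen by blast
  then have "h > 0 \<and> int h \<in> H" unfolding h_def by (rule LeastI_ex)
  then have h: "h > 0" "int h \<in> H" by auto
  have "h dvd p" if p: "p \<in> B" for p
  proof (rule ccontr)
    assume "\<not> h dvd p"
    then have "p mod h > 0" by (simp add: mod_greater_zero_iff_not_dvd)
    moreover have "int (p mod h) = int p - int (p div h) * int h"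
      by (simp add: of_nat_mod minus_div_mult_eq_mod of_nat_div)
    then have "int (p mod h) \<in> H" using comb[OF gen[OF p] h(2)] by simp
    ultimately have "h \<le> p mod h" unfolding h_def by (intro Least_le) auto
    then show False using mod_less_divisor[OF h(1), of p] by linarith
  qed
  then have "h dvd Gcd B" by (rule Gcd_greatest)
  then have "h = 1" using assms by simp
  then have "(1::int) \<in> H" using h(2) by simp
  then have "\<exists>A (a :: nat \<Rightarrow> int). finite A \<and> A \<subseteq> B \<and> 1 = (\<Sum>p\<in>A. a p * int p)"
    unfolding H_def by (rule CollectD)
  then show ?thesis by (elim exE conjE) (intro exI conjI, auto)
qed

locale fourier_signal =
  fixes s :: "real \<Rightarrow> real" and fs :: real
  assumes nonconst: "\<not> s constant_on UNIV"
    and freq: "fundamental_frequency s fs"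
    and fourier: "\<And>t. ((\<lambda>p::int. fourier_coeff (1 / fs) s p * cis (2 * pi * of_int p * t / (1 / fs)))
                        has_sum complex_of_real (s t)) UNIV"
begin

abbreviation c :: "int \<Rightarrow> complex" where "c \<equiv> fourier_coeff (1 / fs) s"

lemma fs_pos: "fs > 0" using freq by (simp add: fundamental_frequency_def)

lemma s_expansion: "((\<lambda>p::int. c p * cis (2 * pi * of_int p * fs * t)) has_sum complex_of_real (s t)) UNIV"
  using fourier[of t] by (simp add: mult_ac)

lemma c_summable: "(\<lambda>p. cmod (c p)) summable_on UNIV"
proof -
  have "c summable_on UNIV" using s_expansion[of 0] by (auto simp: summable_on_def)
  then show ?thesis by (subst (asm) summable_on_iff_abs_summable_on_complex)
qed

lemma c_uminus: "c (- p) = cnj (c p)"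
proof -
  have "cnj (LINT t:{0..1 / fs}|lebesgue. complex_of_real (s t) * cis (- 2 * of_int p * pi * t / (1 / fs)))
      = (LINT t:{0..1 / fs}|lebesgue. complex_of_real (s t) * cis (- 2 * of_int (- p) * pi * t / (1 / fs)))"
    unfolding set_lebesgue_integral_def
    by (subst Bochner_Integration.integral_cnj[symmetric]) (simp add: cis_cnj scaleR_conv_of_real)
  then show ?thesis by (simp add: fourier_coeff_def)
qed

text \<open>A common divisor \<open>g\<close> of the harmonics makes \<open>1/(g f\<^sub>\<star>)\<close> a period, so \<open>g = 1\<close> by minimality of
\<open>1/f\<^sub>\<star>\<close>. There are harmonics at all because the signal is not constant; negative indices are covered by
\<open>c\<^bsub>-p\<^esub> = cnj c\<^sub>p\<close>, as the signal is real.\<close>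
lemma Gcd_harmonics: "Gcd {p::nat. p \<ge> 1 \<and> c (int p) \<noteq> 0} = 1"
proof -
  let ?B = "{p::nat. p \<ge> 1 \<and> c (int p) \<noteq> 0}"
  have neg: "c (int p) = 0 \<Longrightarrow> c (- int p) = 0" for p by (simp add: c_uminus)
  have "?B \<noteq> {}"
  proof
    assume E: "?B = {}"
    have z: "c p = 0" if "p \<noteq> 0" for p
    proof (cases "p > 0")
      case True
      then have "nat p \<ge> 1" by simp
      then have "c (int (nat p)) = 0" using E by blast
      then show ?thesis using True by simp
    next
      case False
      then have "nat (- p) \<ge> 1" using that by simp
      then have "c (int (nat (- p))) = 0" using E by blast
      then show ?thesis using neg[of "nat (- p)"] False by simp
    qed
    have "complex_of_real (s t) = c 0" for t
    proof -
      have "((\<lambda>p::int. c p * cis (2 * pi * of_int p * fs * t)) has_sum c 0) UNIV"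
        by (rule has_sum_finite_neutralI[of "{0}"]) (auto simp: z)
      then show ?thesis using s_expansion[of t] has_sum_unique by blast
    qed
    then have "s t = s 0" for t by (metis of_real_eq_iff)
    then show False using nonconst unfolding constant_on_def by blast
  qed
  define g where "g = Gcd ?B"
  have "g \<noteq> 0" using \<open>?B \<noteq> {}\<close> by (auto simp: g_def Gcd_0_iff)
  have dvd: "int g dvd p" if "c p \<noteq> 0" for p
  proof (cases "p = 0")
    case False
    then have "c (int (nat \<bar>p\<bar>)) \<noteq> 0" using that neg[of "nat (- p)"] by (cases "p > 0") auto
    then have "nat \<bar>p\<bar> \<in> ?B" using False by auto
    then have "g dvd nat \<bar>p\<bar>" unfolding g_def by (rule Gcd_dvd)
    then show ?thesis by (simp add: nat_abs_dvd_iff dvd_nat_abs_iff)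
  qed auto
  have "has_period s (1 / (g * fs))"
    unfolding has_period_def
  proof
    fix t
    have "(\<lambda>p::int. c p * cis (2 * pi * of_int p * fs * (t + 1 / (g * fs)))) = (\<lambda>p::int. c p * cis (2 * pi * of_int p * fs * t))"
    proof
      fix p
      show "c p * cis (2 * pi * of_int p * fs * (t + 1 / (g * fs))) = c p * cis (2 * pi * of_int p * fs * t)"
      proof (cases "c p = 0")
        case False
        then obtain m where m: "p = int g * m" using dvd by blast
        have "2 * pi * of_int p * fs * (t + 1 / (g * fs)) = 2 * pi * of_int p * fs * t + 2 * pi * of_int m"
          using \<open>g \<noteq> 0\<close> fs_pos by (simp add: m field_simps)
        then show ?thesis by (simp add: cis_mult[symmetric] cis_multiple_2pi)
      qed auto
    qed
    then have "complex_of_real (s (t + 1 / (g * fs))) = complex_of_real (s t)"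
      using has_sum_unique[OF s_expansion[of "t + 1 / (g * fs)"]] s_expansion[of t] by (simp only:)
    then show "s (t + 1 / (g * fs)) = s t" by (simp only: of_real_eq_iff)
  qed
  then have "1 / fs \<le> 1 / (g * fs)"
    using freq \<open>g \<noteq> 0\<close> fs_pos by (simp add: fundamental_frequency_def)
  then have "real g \<le> 1" using \<open>g \<noteq> 0\<close> fs_pos by (simp add: field_simps)
  then have "g = 1" using \<open>g \<noteq> 0\<close> by linarith
  then show ?thesis unfolding g_def .
qed

end

section \<open>Resonances of the periodogram\<close>

lemma cmod_trig_mean_le_1: "cmod (trig_mean (\<lambda>_. 1) x n t) \<le> 1"
proof (cases "n = 0")
  case False
  have "cmod (\<Sum>j=1..n. of_real 1 * cis (t * x j)) \<le> (\<Sum>j=1..n. cmod (of_real 1 * cis (t * x j)))"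
    by (rule norm_sum)
  also have "\<dots> = n" by simp
  finally show ?thesis using False by (simp add: trig_mean_def norm_divide)
qed (simp add: trig_mean_def)

lemma trig_mean_uminus: "trig_mean b x n (- t) = cnj (trig_mean b x n t)"
  by (simp add: trig_mean_def cis_cnj)

lemma cmod_trig_mean_abs: "cmod (trig_mean b x n \<bar>t\<bar>) = cmod (trig_mean b x n t)"
  by (cases "t \<ge> 0") (use trig_mean_uminus[of b x n t] in auto)

lemma trig_mean_0: "n > 0 \<Longrightarrow> trig_mean (\<lambda>_. 1) x n 0 = 1"
  by (simp add: trig_mean_def)

lemma trig_mean_add: "trig_mean (\<lambda>j. a j + b j) x n t = trig_mean a x n t + trig_mean b x n t"
  by (simp add: trig_mean_def sum.distrib distrib_right add_divide_distrib)

text \<open>The square root of the periodogram is a Euclidean norm, so that perturbations of the summands are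
controlled by the triangle inequality.\<close>
lemma cumulated_periodogram_eq_L2_set:
  "sqrt (cumulated_periodogram K n x y f) = L2_set (\<lambda>k. cmod (trig_mean y x n (- 2 * real k * pi * f))) {1..K}"
proof -
  have "(cmod (trig_mean y x n (- 2 * real k * pi * f)))\<^sup>2 =
      1 / (real n)\<^sup>2 * (cmod (\<Sum>j=1..n. complex_of_real (y j) * cis (- 2 * real k * pi * f * x j)))\<^sup>2" for k
    by (simp add: trig_mean_def norm_divide power_divide)
  then show ?thesis unfolding L2_set_def cumulated_periodogram_def by (simp add: sum_distrib_left)
qed

lemma bdd_above_cumulated_periodogram: "bdd_above (cumulated_periodogram K n x y ` F)"
proof (rule bdd_aboveI2)
  fix f
  show "cumulated_periodogram K n x y f \<le> 1 / (real n)\<^sup>2 * (\<Sum>k=1..K. (\<Sum>j=1..n. \<bar>y j\<bar>)\<^sup>2)"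
    unfolding cumulated_periodogram_def
  proof (intro mult_left_mono sum_mono power_mono)
    fix k
    have "cmod (\<Sum>j=1..n. complex_of_real (y j) * cis (- 2 * real k * pi * f * x j))
      \<le> (\<Sum>j=1..n. cmod (complex_of_real (y j) * cis (- 2 * real k * pi * f * x j)))" by (rule norm_sum)
    then show "cmod (\<Sum>j=1..n. complex_of_real (y j) * cis (- 2 * real k * pi * f * x j)) \<le> (\<Sum>j=1..n. \<bar>y j\<bar>)"
      by (simp add: norm_mult)
  qed auto
qed

lemma L2_set_norm_triangle:
  fixes f g :: "'i \<Rightarrow> 'b :: real_normed_vector"
  assumes d: "\<And>k. k \<in> A \<Longrightarrow> norm (f k - g k) \<le> d" and "finite A"
  shows "L2_set (\<lambda>k. norm (f k)) A \<le> L2_set (\<lambda>k. norm (g k)) A + sqrt (card A) * d"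
proof (cases "A = {}")
  case False
  then obtain k where "k \<in> A" by blast
  then have d0: "d \<ge> 0" using d[of k] norm_ge_zero order_trans by blast
  have "L2_set (\<lambda>k. norm (f k)) A \<le> L2_set (\<lambda>k. norm (g k) + d) A"
  proof (rule L2_set_mono)
    fix k assume "k \<in> A"
    then show "norm (f k) \<le> norm (g k) + d" using d[of k] norm_triangle_sub[of "f k" "g k"] by linarith
  qed simp
  also have "\<dots> \<le> L2_set (\<lambda>k. norm (g k)) A + L2_set (\<lambda>k. d) A" by (rule L2_set_triangle_ineq)
  also have "L2_set (\<lambda>k. d) A = sqrt (card A) * d" using d0 by (simp add: L2_set_constant)
  finally show ?thesis .
qed simp

lemma has_sum_finite_sum:
  fixes f :: "'p \<Rightarrow> 'j \<Rightarrow> 'b :: topological_comm_monoid_add"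
  assumes "finite J" "\<And>j. j \<in> J \<Longrightarrow> ((\<lambda>p. f p j) has_sum a j) A"
  shows "((\<lambda>p. \<Sum>j\<in>J. f p j) has_sum (\<Sum>j\<in>J. a j)) A"
  using assms
proof (induction J rule: finite_induct)
  case (insert x F)
  have "((\<lambda>p. f p x + (\<Sum>j\<in>F. f p j)) has_sum a x + (\<Sum>j\<in>F. a j)) A"
    by (intro has_sum_add insert.IH insert.prems) auto
  then show ?case using insert.hyps by simp
qed simp

locale frequency_window = fourier_signal s fs for s :: "real \<Rightarrow> real" and fs :: real +
  fixes fmin fmax f0 :: real
  assumes fmin_pos: "0 < fmin"
    and f0_unique: "\<exists>!f. f \<in> {fmin..fmax} \<and> has_period s (1 / f)"
    and f0: "f0 \<in> {fmin..fmax} \<and> has_period s (1 / f0)"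
begin

text \<open>Half the smaller of the two spacings: intervals of radius \<open>\<tau>\<close> around the multiples of \<open>f\<^sub>\<star>\<close> are disjoint,
and so are those around the multiples of any \<open>f \<ge> fmin\<close>. Hence resonance is a partial matching.\<close>
definition \<tau> :: real where "\<tau> = min fs fmin / 2"

lemma \<tau>_pos: "\<tau> > 0" using fs_pos fmin_pos by (simp add: \<tau>_def)

definition coeff_norm :: real where "coeff_norm = infsum (\<lambda>p. cmod (c p)) UNIV"

definition coeff_tail :: "real \<Rightarrow> real" where "coeff_tail m = infsum (\<lambda>p. cmod (c p)) {p. \<bar>real_of_int p\<bar> > m}"

definition resonant :: "real \<Rightarrow> real \<Rightarrow> nat \<Rightarrow> nat set" where
  "resonant m f k = {p. p \<ge> 1 \<and> real p \<le> m \<and> \<bar>p * fs - k * f\<bar> < \<tau>}"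

definition resonant_part :: "(nat \<Rightarrow> real) \<Rightarrow> nat \<Rightarrow> real \<Rightarrow> real \<Rightarrow> nat \<Rightarrow> complex" where
  "resonant_part x n m f k = (\<Sum>p\<in>resonant m f k. c (int p) * trig_mean (\<lambda>_. 1) x n (2 * pi * (p * fs - k * f)))"

lemma resonant_unique:
  assumes "p \<in> resonant m f k" "q \<in> resonant m f k"
  shows "p = q"
proof (rule ccontr)
  assume "p \<noteq> q"
  then have "\<bar>real p - real q\<bar> \<ge> 1" by linarith
  then have "1 * fs \<le> \<bar>real p - real q\<bar> * fs" using fs_pos by (intro mult_right_mono) auto
  also have "\<dots> = \<bar>(p * fs - k * f) - (q * fs - k * f)\<bar>" using fs_pos by (simp add: abs_mult left_diff_distrib[symmetric])
  also have "\<dots> < \<tau> + \<tau>" using assms unfolding resonant_def mem_Collect_eq by linarith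
  also have "\<dots> \<le> fs" by (simp add: \<tau>_def)
  finally show False by simp
qed

lemma resonant_unique_index:
  assumes "p \<in> resonant m f k" "p \<in> resonant m f l" and f: "f \<ge> fmin"
  shows "k = l"
proof (rule ccontr)
  assume "k \<noteq> l"
  then have "\<bar>real k - real l\<bar> \<ge> 1" by linarith
  then have "1 * fmin \<le> \<bar>real k - real l\<bar> * f" using f fmin_pos by (intro mult_mono) auto
  also have "\<dots> = \<bar>(p * fs - l * f) - (p * fs - k * f)\<bar>" using f fmin_pos by (simp add: abs_mult left_diff_distrib[symmetric])
  also have "\<dots> < \<tau> + \<tau>" using assms unfolding resonant_def mem_Collect_eq by linarith
  also have "\<dots> \<le> fmin" by (simp add: \<tau>_def)
  finally show False by simp
qed

lemma resonant_empty_or_singleton: "resonant m f k = {} \<or> (\<exists>p. resonant m f k = {p})"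
  using resonant_unique by blast

lemma finite_resonant [simp]: "finite (resonant m f k)"
  using resonant_empty_or_singleton[of m f k] by auto

lemma sampled_signal_expansion:
  "((\<lambda>p::int. c p * trig_mean (\<lambda>_. 1) x n (2 * pi * (of_int p * fs) - t)) has_sum trig_mean (\<lambda>j. s (x j)) x n (- t)) UNIV"
proof -
  have "((\<lambda>p::int. \<Sum>j=1..n. c p * cis (2 * pi * of_int p * fs * x j) * cis (- t * x j)) has_sum
      (\<Sum>j=1..n. complex_of_real (s (x j)) * cis (- t * x j))) UNIV"
    by (intro has_sum_finite_sum has_sum_cmult_left s_expansion) simp
  then have "((\<lambda>p::int. (1 / of_nat n) * (\<Sum>j=1..n. c p * cis (2 * pi * of_int p * fs * x j) * cis (- t * x j))) has_sum
      (1 / of_nat n) * (\<Sum>j=1..n. complex_of_real (s (x j)) * cis (- t * x j))) UNIV"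
    by (rule has_sum_cmult_right)
  moreover have "(1 / of_nat n) * (\<Sum>j=1..n. c p * cis (2 * pi * of_int p * fs * x j) * cis (- t * x j)) =
      c p * trig_mean (\<lambda>_. 1) x n (2 * pi * (of_int p * fs) - t)" for p :: int
  proof -
    have "cis (2 * pi * of_int p * fs * x j) * cis (- t * x j) = cis ((2 * pi * (of_int p * fs) - t) * x j)" for j
      unfolding cis_mult by (rule arg_cong[where f=cis]) (simp add: left_diff_distrib)
    then have "(\<Sum>j=1..n. c p * cis (2 * pi * of_int p * fs * x j) * cis (- t * x j)) =
        c p * (\<Sum>j=1..n. cis ((2 * pi * (of_int p * fs) - t) * x j))"
      by (simp only: mult.assoc sum_distrib_left)
    then show ?thesis by (simp add: trig_mean_def)
  qed
  moreover have "(1 / of_nat n) * (\<Sum>j=1..n. complex_of_real (s (x j)) * cis (- t * x j)) = trig_mean (\<lambda>j. s (x j)) x n (- t)"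
    by (simp add: trig_mean_def)
  ultimately show ?thesis by (simp only:)
qed

text \<open>In a pair that is not resonant, \<open>S\<close> is evaluated at distance at least \<open>2\<pi>\<tau>\<close> from \<open>0\<close>; this includes all
\<open>p \<le> 0\<close>, because then \<open>k f - p f\<^sub>\<star> \<ge> fmin\<close>. These terms contribute at most \<open>q \<Sum> |c\<^sub>p|\<close>, the noise at
most \<open>q\<close>. Harmonics beyond \<open>m\<close> are only bounded by \<open>|S| \<le> 1\<close>, since their frequencies may leave the range
\<open>[0, n]\<close> on which \<open>S\<close> is controlled.\<close>
lemma resonant_part_approximates:
  fixes k K n :: nat
  assumes f: "fmin \<le> f" "f \<le> fmax" and k: "1 \<le> k" "k \<le> K"
    and n: "2 * pi * (m * fs + K * fmax) \<le> n" and m: "m \<ge> 0" and q: "q \<ge> 0"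
    and S: "\<And>t::real. 2 * pi * \<tau> \<le> t \<Longrightarrow> t \<le> n \<Longrightarrow> cmod (trig_mean (\<lambda>_. 1) x n t) \<le> q"
    and N: "\<And>t::real. 0 \<le> t \<Longrightarrow> t \<le> n \<Longrightarrow> cmod (trig_mean e x n t) \<le> q"
  shows "cmod (trig_mean (\<lambda>j. s (x j) + e j) x n (- 2 * real k * pi * f) - resonant_part x n m f k) \<le> (coeff_norm + 1) * q + coeff_tail m"
proof -
  define t where "t = 2 * real k * pi * f"
  define S where "S = (\<lambda>u. trig_mean (\<lambda>_. 1) x n u)"
  have fmax0: "0 < f" "0 < fmax" using f fmin_pos by auto
  have kf: "real k * f \<le> K * fmax" using f k fmax0 by (intro mult_mono) auto
  have kf1: "1 * fmin \<le> real k * f" using f k fmin_pos by (intro mult_mono) auto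
  have tn: "0 \<le> t" "t \<le> n"
  proof -
    show "0 \<le> t" using fmax0 by (simp add: t_def)
    have "t = 2 * pi * (real k * f)" by (simp add: t_def)
    also have "\<dots> \<le> 2 * pi * (m * fs + K * fmax)"
    proof (rule mult_left_mono)
      have "m * fs \<ge> 0" using m fs_pos by simp
      then show "real k * f \<le> m * fs + K * fmax" using kf by linarith
    qed simp
    finally show "t \<le> n" using n by simp
  qed
  have noise: "cmod (trig_mean e x n (- t)) \<le> q" using N[OF tn] by (simp add: trig_mean_uminus)
  let ?g = "\<lambda>p::int. c p * S (2 * pi * (of_int p * fs) - t)"
  let ?h = "\<lambda>p::int. if p \<in> int ` resonant m f k then ?g p else 0"
  have expansion: "(?g has_sum trig_mean (\<lambda>j. s (x j)) x n (- t)) UNIV"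
    unfolding S_def by (rule sampled_signal_expansion)
  have h: "(?h has_sum resonant_part x n m f k) UNIV"
  proof (rule has_sum_finite_neutralI[of "int ` resonant m f k"])
    have "(\<Sum>p\<in>int ` resonant m f k. ?h p) = (\<Sum>p\<in>int ` resonant m f k. ?g p)"
      by (intro sum.cong) auto
    also have "\<dots> = (\<Sum>p\<in>resonant m f k. ?g (int p))"
      by (subst sum.reindex) (simp_all add: comp_def)
    also have "\<dots> = resonant_part x n m f k"
      unfolding resonant_part_def S_def t_def by (intro sum.cong refl) (simp add: algebra_simps)
    finally show "resonant_part x n m f k = (\<Sum>p\<in>int ` resonant m f k. ?h p)" by simp
  qed auto
  have d: "((\<lambda>p. ?g p + - ?h p) has_sum (trig_mean (\<lambda>j. s (x j)) x n (- t) + - resonant_part x n m f k)) UNIV"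
    by (intro has_sum_add expansion has_sum_uminusI h)
  have b: "((\<lambda>p::int. q * cmod (c p) + (if \<bar>real_of_int p\<bar> > m then cmod (c p) else 0)) has_sum (q * coeff_norm + coeff_tail m)) UNIV"
  proof (intro has_sum_add has_sum_cmult_right)
    show "((\<lambda>p. cmod (c p)) has_sum coeff_norm) UNIV" unfolding coeff_norm_def by (rule has_sum_infsum[OF c_summable])
    have "((\<lambda>p. cmod (c p)) has_sum coeff_tail m) {p. \<bar>real_of_int p\<bar> > m}"
      unfolding coeff_tail_def by (rule has_sum_infsum) (rule summable_on_subset_banach[OF c_summable], simp)
    then show "((\<lambda>p::int. if \<bar>real_of_int p\<bar> > m then cmod (c p) else 0) has_sum coeff_tail m) UNIV"
      using has_sum_cong_neutral[of UNIV "{p. \<bar>real_of_int p\<bar> > m}" "\<lambda>p. if \<bar>real_of_int p\<bar> > m then cmod (c p) else 0" "\<lambda>p. cmod (c p)" "coeff_tail m"]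
      by simp
  qed
  have "cmod (trig_mean (\<lambda>j. s (x j)) x n (- t) + - resonant_part x n m f k) \<le> q * coeff_norm + coeff_tail m"
  proof (rule norm_infsum_le[OF d b])
    fix p :: int
    show "cmod (?g p + - ?h p) \<le> q * cmod (c p) + (if \<bar>real_of_int p\<bar> > m then cmod (c p) else 0)"
    proof (cases "p \<in> int ` resonant m f k")
      case True
      then show ?thesis using q by simp
    next
      case far: False
      show ?thesis
      proof (cases "\<bar>real_of_int p\<bar> > m")
        case True
        have "cmod (?g p) \<le> cmod (c p) * 1" unfolding norm_mult S_def
          by (intro mult_left_mono cmod_trig_mean_le_1) auto
        moreover have "q * cmod (c p) \<ge> 0" using q by simp
        ultimately show ?thesis using far True by simp
      next
        case False
        define u where "u = 2 * pi * (of_int p * fs) - t"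
        have u: "u = 2 * pi * (of_int p * fs - k * f)" by (simp add: u_def t_def algebra_simps)
        have "\<tau> \<le> \<bar>of_int p * fs - k * f\<bar>"
        proof (cases "p \<ge> 1")
          case True
          then have "p = int (nat p)" "nat p \<ge> 1" by auto
          moreover have "nat p \<notin> resonant m f k" using far True by (metis calculation(1) image_eqI)
          moreover have "real (nat p) \<le> m" using False True by simp
          ultimately show ?thesis using True unfolding resonant_def by auto
        next
          case False
          then have "real_of_int p * fs \<le> 0" using fs_pos by (simp add: mult_le_0_iff)
          then have "fmin \<le> \<bar>of_int p * fs - k * f\<bar>" using kf1 by linarith
          moreover have "\<tau> \<le> fmin" using fmin_pos by (simp add: \<tau>_def min_def)
          ultimately show ?thesis by linarith
        qed
        then have "2 * pi * \<tau> \<le> 2 * pi * \<bar>of_int p * fs - k * f\<bar>" by (intro mult_left_mono) auto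
        then have u1: "2 * pi * \<tau> \<le> \<bar>u\<bar>" by (simp add: u abs_mult)
        have "\<bar>of_int p * fs\<bar> \<le> m * fs" unfolding abs_mult using False fs_pos by (intro mult_mono) auto
        moreover have "\<bar>real k * f\<bar> \<le> K * fmax" using kf fmax0 by simp
        ultimately have "\<bar>of_int p * fs - k * f\<bar> \<le> m * fs + K * fmax" by linarith
        then have "2 * pi * \<bar>of_int p * fs - k * f\<bar> \<le> 2 * pi * (m * fs + K * fmax)" by (intro mult_left_mono) auto
        then have "2 * pi * \<bar>of_int p * fs - k * f\<bar> \<le> n" using n by (rule order_trans)
        then have u2: "\<bar>u\<bar> \<le> n" unfolding u abs_mult by simp
        have "cmod (S u) \<le> q" using assms(8)[OF u1 u2] unfolding S_def cmod_trig_mean_abs .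
        then have "cmod (?g p) \<le> cmod (c p) * q" unfolding norm_mult u_def by (intro mult_left_mono) auto
        then show ?thesis using far False by (simp add: mult.commute)
      qed
    qed
  qed
  moreover have "trig_mean (\<lambda>j. s (x j) + e j) x n (- t) - resonant_part x n m f k
      = (trig_mean (\<lambda>j. s (x j)) x n (- t) + - resonant_part x n m f k) + trig_mean e x n (- t)"
    unfolding trig_mean_add by simp
  then have "cmod (trig_mean (\<lambda>j. s (x j) + e j) x n (- t) - resonant_part x n m f k)
      \<le> cmod (trig_mean (\<lambda>j. s (x j)) x n (- t) + - resonant_part x n m f k) + cmod (trig_mean e x n (- t))"
    by (simp only: norm_triangle_ineq)
  ultimately have "cmod (trig_mean (\<lambda>j. s (x j) + e j) x n (- t) - resonant_part x n m f k) \<le> q * coeff_norm + coeff_tail m + q"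
    using noise by linarith
  also have "q * coeff_norm + coeff_tail m + q = (coeff_norm + 1) * q + coeff_tail m" by (simp add: algebra_simps)
  also have "- t = - 2 * real k * pi * f" by (simp add: t_def)
  finally show ?thesis .
qed

definition harmonic_energy :: "nat \<Rightarrow> real" where "harmonic_energy p = (cmod (c (int p)))\<^sup>2"

definition signal_energy :: real where "signal_energy = infsum harmonic_energy {1..}"

lemma harmonic_energy_summable: "harmonic_energy summable_on {1..}"
proof (rule summable_on_comparison_test)
  have "(\<lambda>p. cmod (c p)) summable_on (int ` {1..})" by (rule summable_on_subset_banach[OF c_summable]) simp
  then have "((\<lambda>p. cmod (c p)) \<circ> int) summable_on {1..}" by (subst (asm) summable_on_reindex) (auto simp: inj_on_def)
  then show "(\<lambda>p. coeff_norm * cmod (c (int p))) summable_on {1..}" by (intro summable_on_cmult_right) (simp add: comp_def)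
  fix p
  have "(\<Sum>q\<in>{int p}. cmod (c q)) \<le> coeff_norm" unfolding coeff_norm_def by (rule finite_sum_le_infsum[OF c_summable]) auto
  then show "harmonic_energy p \<le> coeff_norm * cmod (c (int p))" unfolding harmonic_energy_def power2_eq_square by (intro mult_right_mono) auto
qed (simp add: harmonic_energy_def)

lemma harmonic_energy_nonneg: "harmonic_energy p \<ge> 0" by (simp add: harmonic_energy_def)

lemma sum_harmonic_energy_le: "finite F \<Longrightarrow> F \<subseteq> {1..} \<Longrightarrow> sum harmonic_energy F \<le> signal_energy"
  unfolding signal_energy_def by (rule finite_sum_le_infsum[OF harmonic_energy_summable]) (auto simp: harmonic_energy_def)

lemma sum_harmonic_energy_approx:
  assumes "\<eta> > 0"
  shows "\<exists>F. finite F \<and> F \<subseteq> {1..} \<and> signal_energy - \<eta> \<le> sum harmonic_energy F"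
proof -
  have "(harmonic_energy has_sum signal_energy) {1..}" unfolding signal_energy_def by (rule has_sum_infsum[OF harmonic_energy_summable])
  from has_sum_finite_approximation[OF this assms] show ?thesis
    by (auto simp: dist_real_def)
qed

lemma cmod_resonant_part_squared:
  "(cmod (resonant_part x n m f k))\<^sup>2 = (\<Sum>p\<in>resonant m f k. harmonic_energy p * (cmod (trig_mean (\<lambda>_. 1) x n (2 * pi * (p * fs - k * f))))\<^sup>2)"
  using resonant_empty_or_singleton[of m f k]
  by (auto simp: resonant_part_def harmonic_energy_def norm_mult power_mult_distrib)

text \<open>By the matching, the energy is \<open>\<Sum>\<^sub>p |c\<^sub>p|\<^sup>2 W\<^sub>p\<close>, where the weight \<open>W\<^sub>p\<close> is the value of \<open>|S|\<^sup>2\<close> at the only \<open>k\<close>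
that resonates with \<open>p\<close>, or \<open>0\<close> if there is none. All weights are at most 1, and the harmonic \<open>p\<^sub>0\<close> loses at
least the fraction \<open>1 - \<rho>\<close> of its energy.\<close>
lemma resonant_part_energy_le:
  assumes f: "fmin \<le> f" and A: "p0 \<ge> 1" and \<rho>: "0 \<le> \<rho>"
    and bad: "\<And>k::nat. k \<ge> 1 \<Longrightarrow> k \<le> K \<Longrightarrow> \<bar>real p0 * fs - real k * f\<bar> < \<tau> \<Longrightarrow>
      (cmod (trig_mean (\<lambda>_. 1) x n (2 * pi * (real p0 * fs - real k * f))))\<^sup>2 \<le> \<rho>"
  shows "(\<Sum>k=1..K. (cmod (resonant_part x n m f k))\<^sup>2) \<le> signal_energy - (1 - \<rho>) * harmonic_energy p0"
proof -
  define P where "P = {p::nat. p \<ge> 1 \<and> real p \<le> m}"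
  have finP: "finite P" by (rule finite_subset[of _ "{..nat \<lfloor>m\<rfloor>}"]) (auto simp: P_def le_nat_floor)
  define Z where "Z p k = (cmod (trig_mean (\<lambda>_. 1) x n (2 * pi * (real p * fs - real k * f))))\<^sup>2" for p k
  define W where "W p = (\<Sum>k=1..K. if p \<in> resonant m f k then Z p k else 0)" for p
  have Z1: "Z p k \<le> 1" for p k
    unfolding Z_def using cmod_trig_mean_le_1 by (simp add: power_le_one)
  have W_le: "W p \<le> b" if b: "b \<ge> 0" "\<And>k. k \<in> {1..K} \<Longrightarrow> p \<in> resonant m f k \<Longrightarrow> Z p k \<le> b" for p b
  proof (cases "\<exists>k\<in>{1..K}. p \<in> resonant m f k")
    case True
    then obtain k where k: "k \<in> {1..K}" "p \<in> resonant m f k" by blast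
    have "(if p \<in> resonant m f l then Z p l else 0) = (if l = k then Z p k else 0)" for l
    proof (cases "l = k")
      case False
      then have "p \<notin> resonant m f l" using resonant_unique_index[OF k(2), of l] f by blast
      then show ?thesis using False by simp
    qed (use k in simp)
    then have "W p = (\<Sum>l=1..K. if l = k then Z p k else 0)" by (simp add: W_def)
    also have "\<dots> = Z p k" using k by simp
    finally show ?thesis using b k by simp
  next
    case False
    then have "W p = 0" unfolding W_def by (intro sum.neutral) auto
    then show ?thesis using b by simp
  qed
  have "(\<Sum>k=1..K. (cmod (resonant_part x n m f k))\<^sup>2) = (\<Sum>k=1..K. \<Sum>p\<in>P. if p \<in> resonant m f k then harmonic_energy p * Z p k else 0)"
  proof (rule sum.cong[OF refl])
    fix k
    have "resonant m f k \<subseteq> P" by (auto simp: resonant_def P_def)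
    then have "(\<Sum>p\<in>resonant m f k. harmonic_energy p * Z p k) = (\<Sum>p\<in>P. if p \<in> resonant m f k then harmonic_energy p * Z p k else 0)"
      using finP by (intro sum.mono_neutral_cong_left) auto
    then show "(cmod (resonant_part x n m f k))\<^sup>2 = (\<Sum>p\<in>P. if p \<in> resonant m f k then harmonic_energy p * Z p k else 0)"
      unfolding cmod_resonant_part_squared Z_def .
  qed
  also have "\<dots> = (\<Sum>p\<in>P. \<Sum>k=1..K. if p \<in> resonant m f k then harmonic_energy p * Z p k else 0)" by (rule sum.swap)
  also have "\<dots> = (\<Sum>p\<in>P. harmonic_energy p * W p)"
    unfolding W_def sum_distrib_left by (intro sum.cong refl) simp
  also have "\<dots> \<le> (\<Sum>p\<in>P. harmonic_energy p - (if p = p0 then (1 - \<rho>) * harmonic_energy p0 else 0))"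
  proof (rule sum_mono)
    fix p
    show "harmonic_energy p * W p \<le> harmonic_energy p - (if p = p0 then (1 - \<rho>) * harmonic_energy p0 else 0)"
    proof (cases "p = p0")
      case True
      have "W p0 \<le> \<rho>" by (rule W_le[OF \<rho>]) (use bad in \<open>auto simp: resonant_def Z_def\<close>)
      then have "harmonic_energy p0 * W p0 \<le> harmonic_energy p0 * \<rho>" by (intro mult_left_mono harmonic_energy_nonneg)
      then show ?thesis using True by (simp add: algebra_simps)
    next
      case False
      have "W p \<le> 1" by (rule W_le) (auto simp: Z1)
      then have "harmonic_energy p * W p \<le> harmonic_energy p * 1" by (intro mult_left_mono harmonic_energy_nonneg)
      then show ?thesis using False by simp
    qed
  qed
  also have "\<dots> = sum harmonic_energy P - (if p0 \<in> P then (1 - \<rho>) * harmonic_energy p0 else 0)"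
    using finP by (simp add: sum_subtractf)
  also have "\<dots> \<le> signal_energy - (1 - \<rho>) * harmonic_energy p0"
  proof (cases "p0 \<in> P")
    case True
    then show ?thesis using sum_harmonic_energy_le[OF finP] by (auto simp: P_def)
  next
    case False
    then have "sum harmonic_energy P + harmonic_energy p0 = sum harmonic_energy (insert p0 P)" using finP by simp
    also have "\<dots> \<le> signal_energy" by (rule sum_harmonic_energy_le) (use finP A in \<open>auto simp: P_def\<close>)
    finally have "sum harmonic_energy P + harmonic_energy p0 \<le> signal_energy" .
    moreover have "\<rho> * harmonic_energy p0 \<ge> 0" using \<rho> harmonic_energy_nonneg[of p0] by simp
    ultimately show ?thesis using False by (simp add: algebra_simps)
  qed
  finally show ?thesis .
qed

text \<open>At a frequency \<open>f\<^sub>\<star>/l\<close>, the harmonic \<open>p\<close> is in exact resonance with \<open>k = l p\<close>, where \<open>S = 1\<close>.\<close>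
lemma resonant_part_energy_ge:
  assumes l: "l \<ge> 1" "f = fs / real l" and F: "finite F" "F \<subseteq> {1..}"
    and m: "\<And>p. p \<in> F \<Longrightarrow> real p \<le> m" and K: "\<And>p. p \<in> F \<Longrightarrow> l * p \<le> K" and n: "n > 0"
  shows "sum harmonic_energy F \<le> (\<Sum>k=1..K. (cmod (resonant_part x n m f k))\<^sup>2)"
proof -
  have eq: "real p * fs - real (l * p) * f = 0" for p using l by simp
  have "harmonic_energy p = (cmod (resonant_part x n m f (l * p)))\<^sup>2" if p: "p \<in> F" for p
  proof -
    have "p \<in> resonant m f (l * p)" using p F m[OF p] eq[of p] \<tau>_pos by (auto simp: resonant_def)
    then have "resonant m f (l * p) = {p}" using resonant_unique by blast
    moreover have "trig_mean (\<lambda>_. 1) x n (2 * pi * (real p * fs - real (l * p) * f)) = 1"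
      unfolding eq by (simp add: trig_mean_0 n)
    ultimately show ?thesis unfolding cmod_resonant_part_squared by simp
  qed
  then have "sum harmonic_energy F = (\<Sum>p\<in>F. (cmod (resonant_part x n m f (l * p)))\<^sup>2)" by simp
  also have "\<dots> = (\<Sum>k\<in>(*) l ` F. (cmod (resonant_part x n m f k))\<^sup>2)"
    using l by (subst sum.reindex) (auto simp: inj_on_def)
  also have "\<dots> \<le> (\<Sum>k=1..K. (cmod (resonant_part x n m f k))\<^sup>2)"
  proof (rule sum_mono2)
    show "(*) l ` F \<subseteq> {1..K}"
    proof (rule image_subsetI)
      fix p assume p: "p \<in> F"
      then have "p \<ge> 1" using F by auto
      then have "l * p \<ge> 1" using l by simp
      then show "l * p \<in> {1..K}" using K[OF p] by simp
    qed
  qed auto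
  finally show ?thesis .
qed

text \<open>Combining the near-equalities \<open>p f\<^sub>\<star> \<approx> k\<^sub>p f\<close> with the Bezout coefficients gives \<open>f\<^sub>\<star> \<approx> m f\<close> with the integer
\<open>m = \<Sum> a\<^sub>p k\<^sub>p\<close>. As \<open>f \<ge> fmin\<close>, only finitely many \<open>m\<close> are possible, and all but \<open>l\<close> place \<open>f\<^sub>\<star>/m\<close> at a
positive distance from the window, since every \<open>f\<^sub>\<star>/m\<close> is a frequency of the signal. The constants do not
depend on \<open>r\<close>.\<close>
lemma resonance_forces_frequency:
  assumes A: "finite A" "A \<noteq> {}" and a: "(\<Sum>p\<in>A. a p * int p) = 1"
  shows "\<exists>C>0. \<exists>r0>0. \<forall>f r :: real. f \<in> {fmin..fmax} \<and> 0 < r \<and> r \<le> r0 \<longrightarrow>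
     (\<forall>p\<in>A. \<exists>k::nat. 2 * pi * \<bar>real p * fs - real k * f\<bar> < r) \<longrightarrow> \<bar>f - f0\<bar> \<le> C * r"
proof -
  define C where "C = (\<Sum>p\<in>A. \<bar>real_of_int (a p)\<bar>)"
  have "\<exists>p\<in>A. a p \<noteq> 0"
  proof (rule ccontr)
    assume "\<not> ?thesis"
    then have "(\<Sum>p\<in>A. a p * int p) = 0" by (intro sum.neutral) simp
    then show False using a by simp
  qed
  then obtain p1 where p1: "p1 \<in> A" "a p1 \<noteq> 0" by blast
  have C: "C > 0" unfolding C_def by (rule sum_pos2[OF A(1) p1(1)]) (use p1 in auto)
  obtain l :: nat where l: "l \<ge> 1" "f0 = fs / l"
    using frequency_is_subharmonic[OF freq, of f0] f0 fmin_pos by auto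
  define B where "B = {j::nat. 1 \<le> j \<and> real j \<le> 2 * fs / fmin \<and> j \<noteq> l}"
  have finB: "finite B" by (rule finite_subset[of _ "{..nat \<lfloor>2 * fs / fmin\<rfloor>}"]) (auto simp: B_def le_nat_floor)
  define d where "d j = max (fmin - fs / real j) (fs / real j - fmax)" for j
  have d: "d j > 0" if j: "j \<in> B" for j
  proof (rule ccontr)
    assume "\<not> d j > 0"
    then have "fs / j \<in> {fmin..fmax}" by (auto simp: d_def)
    moreover have "has_period s (1 / (fs / j))" by (rule subharmonic_has_period[OF freq])
    ultimately have "fs / j = f0" using f0_unique f0 by blast
    then have "j = l" using l fs_pos j by (auto simp: B_def field_simps)
    then show False using j by (simp add: B_def)
  qed
  define \<delta> where "\<delta> = Min (insert 1 (d ` B))"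
  have \<delta>: "\<delta> > 0" "\<And>j. j \<in> B \<Longrightarrow> \<delta> \<le> d j"
    unfolding \<delta>_def using finB d by auto
  define r0 where "r0 = min (fs / (2 * C)) (\<delta> / (2 * C))"
  have r0: "r0 > 0" using fs_pos C \<delta> by (simp add: r0_def)
  have *: "\<bar>f - f0\<bar> \<le> C * r"
    if f: "f \<in> {fmin..fmax}" and r: "0 < r" "r \<le> r0" and k: "\<And>p. p \<in> A \<Longrightarrow> \<exists>k::nat. 2 * pi * \<bar>real p * fs - real k * f\<bar> < r" for f r :: real
  proof -
    have f_pos: "f > 0" using f fmin_pos by simp
    obtain k :: "nat \<Rightarrow> nat" where k: "\<And>p. p \<in> A \<Longrightarrow> 2 * pi * \<bar>p * fs - k p * f\<bar> < r"
      using k by metis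
    define m where "m = (\<Sum>p\<in>A. a p * int (k p))"
    have "(\<Sum>p\<in>A. real_of_int (a p) * (p * fs - k p * f)) = real_of_int (\<Sum>p\<in>A. a p * int p) * fs - m * f"
    proof -
      have "(\<Sum>p\<in>A. real_of_int (a p) * (p * fs - k p * f)) = (\<Sum>p\<in>A. real_of_int (a p * int p) * fs - real_of_int (a p * int (k p)) * f)"
        by (intro sum.cong refl) (simp add: algebra_simps)
      also have "\<dots> = (\<Sum>p\<in>A. real_of_int (a p * int p)) * fs - (\<Sum>p\<in>A. real_of_int (a p * int (k p))) * f"
        by (simp only: sum_subtractf sum_distrib_right)
      finally show ?thesis unfolding m_def of_int_sum .
    qed
    then have "\<bar>fs - m * f\<bar> = \<bar>\<Sum>p\<in>A. real_of_int (a p) * (p * fs - k p * f)\<bar>" using a by simp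
    also have "\<dots> \<le> (\<Sum>p\<in>A. \<bar>real_of_int (a p)\<bar> * r)"
    proof (intro order_trans[OF sum_abs] sum_mono)
      fix p assume "p \<in> A"
      have "1 * \<bar>p * fs - k p * f\<bar> \<le> 2 * pi * \<bar>p * fs - k p * f\<bar>" using pi_gt3 by (intro mult_right_mono) auto
      then have "\<bar>p * fs - k p * f\<bar> \<le> 2 * pi * \<bar>p * fs - k p * f\<bar>" by (simp only: mult_1)
      then have "\<bar>p * fs - k p * f\<bar> \<le> r" using k[OF \<open>p \<in> A\<close>] by (rule order_trans[OF _ less_imp_le])
      then show "\<bar>real_of_int (a p) * (p * fs - k p * f)\<bar> \<le> \<bar>real_of_int (a p)\<bar> * r"
        unfolding abs_mult by (intro mult_left_mono) auto
    qed
    also have "\<dots> = C * r" by (simp add: C_def sum_distrib_right)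
    finally have close: "\<bar>fs - m * f\<bar> \<le> C * r" .
    have Cr: "C * r \<le> C * r0" using r C by (intro mult_left_mono) auto
    have Cr1: "C * r \<le> fs / 2" and Cr2: "C * r \<le> \<delta> / 2"
      using Cr C by (auto simp: r0_def min_def field_simps split: if_splits)
    have mf: "m * f > 0" "m * f \<le> 2 * fs" using close Cr1 fs_pos by (simp_all add: abs_le_iff)
    then have m1: "m \<ge> 1" using f_pos by (simp add: zero_less_mult_iff)
    define j where "j = nat m"
    have j: "real_of_int m = real j" "j \<ge> 1" using m1 by (auto simp: j_def)
    have "real j * fmin \<le> real j * f" using f by (intro mult_left_mono) auto
    then have jB: "real j \<le> 2 * fs / fmin" using mf fmin_pos by (simp add: j field_simps)
    have "fs / j - f = (fs - m * f) / j" using j(2) unfolding j(1) by (simp add: diff_divide_distrib)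
    then have "\<bar>fs / j - f\<bar> = \<bar>fs - m * f\<bar> / j" by (simp add: abs_divide)
    also have "\<dots> \<le> C * r / 1" using close j C r by (intro frac_le) auto
    finally have fj: "\<bar>fs / j - f\<bar> \<le> C * r" by simp
    have "j = l"
    proof (rule ccontr)
      assume "j \<noteq> l"
      then have "j \<in> B" using j jB by (auto simp: B_def)
      then have "\<delta> \<le> d j" by (rule \<delta>)
      also have "\<dots> \<le> \<bar>fs / j - f\<bar>" unfolding d_def using f by auto
      finally show False using fj Cr2 \<delta>(1) by linarith
    qed
    then show ?thesis using fj l by (simp add: abs_minus_commute)
  qed
  show ?thesis
    by (intro exI[of _ C] conjI C exI[of _ r0] r0 allI impI *) auto
qed

end

section \<open>Localization of the maximizers\<close>

locale periodogram_regime = frequency_window s fs fmin fmax f0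
  for s :: "real \<Rightarrow> real" and fs fmin fmax f0 :: real +
  fixes K :: "nat \<Rightarrow> nat" and \<beta> :: real
  assumes K_pos: "\<And>n. n \<ge> 1 \<Longrightarrow> K n > 0"
    and K_top: "filterlim K at_top sequentially"
    and beta_pos: "\<beta> > 0"
    and K_lim: "(\<lambda>n. of_nat (K n) * (fourier_tail (1 / fs) s (real n powr \<beta>)
                        + ennreal (real n powr (- 1 / 2 + \<beta>)))) \<longlonglongrightarrow> 0"
begin

lemma coeff_tail_nonneg: "coeff_tail m \<ge> 0"
  unfolding coeff_tail_def by (rule infsum_nonneg) simp

lemma fourier_tail_eq_coeff_tail: "fourier_tail (1 / fs) s m = ennreal (coeff_tail m)"
proof -
  let ?A = "{k::int. \<bar>real_of_int k\<bar> > m}"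
  have sm: "(\<lambda>p. cmod (c p)) summable_on ?A" by (rule summable_on_subset_banach[OF c_summable]) simp
  have "fourier_tail (1 / fs) s m = (SUP F\<in>{F. finite F \<and> F \<subseteq> ?A}. \<Sum>k\<in>F. ennreal (cmod (c k)))"
    unfolding fourier_tail_def by (rule nonneg_infsum_complete) simp
  also have "\<dots> = (SUP F\<in>{F. finite F \<and> F \<subseteq> ?A}. ennreal (\<Sum>k\<in>F. cmod (c k)))"
    by (intro SUP_cong refl) (simp add: sum_ennreal)
  also have "\<dots> = ennreal (coeff_tail m)"
    unfolding coeff_tail_def by (rule infsum_nonneg_is_SUPREMUM_ennreal[symmetric]) (use sm in auto)
  finally show ?thesis .
qed

lemma K_times_tail: "(\<lambda>n. K n * coeff_tail (real n powr \<beta>)) \<longlonglongrightarrow> 0"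
  and K_times_rate: "(\<lambda>n. K n * real n powr (- 1 / 2 + \<beta>)) \<longlonglongrightarrow> 0"
proof -
  have "of_nat (K n) * (fourier_tail (1 / fs) s (real n powr \<beta>) + ennreal (real n powr (- 1 / 2 + \<beta>)))
     = ennreal (K n * (coeff_tail (real n powr \<beta>) + real n powr (- 1 / 2 + \<beta>)))" for n
    by (simp add: fourier_tail_eq_coeff_tail coeff_tail_nonneg ennreal_mult ennreal_of_nat_eq_real_of_nat)
  then have "(\<lambda>n. ennreal (K n * (coeff_tail (real n powr \<beta>) + real n powr (- 1 / 2 + \<beta>)))) \<longlonglongrightarrow> ennreal 0"
    using K_lim by simp
  then have lim: "(\<lambda>n. K n * (coeff_tail (real n powr \<beta>) + real n powr (- 1 / 2 + \<beta>))) \<longlonglongrightarrow> 0"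
    by (rule tendsto_ennrealD) (auto simp: coeff_tail_nonneg)
  show "(\<lambda>n. K n * coeff_tail (real n powr \<beta>)) \<longlonglongrightarrow> 0"
    by (rule tendsto_sandwich[OF _ _ tendsto_const lim]) (auto simp: coeff_tail_nonneg distrib_left)
  show "(\<lambda>n. K n * real n powr (- 1 / 2 + \<beta>)) \<longlonglongrightarrow> 0"
    by (rule tendsto_sandwich[OF _ _ tendsto_const lim]) (auto simp: coeff_tail_nonneg distrib_left)
qed

text \<open>Bounds the Euclidean distance between the vectors, indexed by \<open>k \<le> K\<^sub>n\<close>, of all the summands of
the periodogram and of their resonant parts: every entry is bounded by \<open>resonant_part_approximates\<close>.\<close>
definition perturbation :: "nat \<Rightarrow> real" where
  "perturbation n = sqrt (K n) * ((coeff_norm + 1) * (real n powr (-1/4) + 1 / n) + coeff_tail (real n powr \<beta>))"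

lemma coeff_norm_nonneg: "coeff_norm \<ge> 0"
  unfolding coeff_norm_def by (rule infsum_nonneg) simp

lemma perturbation_tendsto_0: "perturbation \<longlonglongrightarrow> 0"
proof (rule tendsto_sandwich[OF _ _ tendsto_const])
  let ?b = "\<lambda>n. (coeff_norm + 1) * (2 * sqrt (K n * real n powr (- 1 / 2 + \<beta>))) + K n * coeff_tail (real n powr \<beta>)"
  have "?b \<longlonglongrightarrow> (coeff_norm + 1) * (2 * sqrt 0) + 0"
    by (intro tendsto_intros K_times_rate K_times_tail)
  then show "?b \<longlonglongrightarrow> 0" by simp
  show "\<forall>\<^sub>F n in sequentially. 0 \<le> perturbation n"
    using coeff_norm_nonneg coeff_tail_nonneg unfolding perturbation_def by (intro always_eventually allI mult_nonneg_nonneg add_nonneg_nonneg) auto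
  show "\<forall>\<^sub>F n in sequentially. perturbation n \<le> ?b n"
    using eventually_ge_at_top[of 1]
  proof eventually_elim
    case (elim n)
    have n: "n \<ge> 1" using elim by simp
    have K1: "real (K n) \<ge> 1" using K_pos[OF n] by linarith
    have "1 / real n = real n powr -1" using n by (simp add: powr_minus_divide)
    also have "\<dots> \<le> real n powr (-1/4)" using n by (intro powr_mono) auto
    finally have "real n powr (-1/4) + 1 / n \<le> 2 * real n powr (-1/4)" by simp
    moreover have "sqrt (K n) * real n powr (-1/4) \<le> sqrt (K n * real n powr (- 1 / 2 + \<beta>))"
    proof -
      have "(real n powr (-1/4))\<^sup>2 = real n powr (-1/2)" by (simp add: power2_eq_square powr_add[symmetric])
      then have "real n powr (-1/4) = sqrt (real n powr (-1/2))" by (metis powr_ge_zero real_sqrt_unique)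
      also have "sqrt (K n) * \<dots> = sqrt (K n * real n powr (-1/2))" by (simp add: real_sqrt_mult)
      also have "\<dots> \<le> sqrt (K n * real n powr (- 1 / 2 + \<beta>))"
        using n beta_pos by (intro real_sqrt_le_mono mult_left_mono powr_mono) auto
      finally show ?thesis .
    qed
    ultimately have "sqrt (K n) * (real n powr (-1/4) + 1 / n) \<le> 2 * sqrt (K n * real n powr (- 1 / 2 + \<beta>))"
      using mult_left_mono[of "real n powr (-1/4) + 1 / n" "2 * real n powr (-1/4)" "sqrt (K n)"] by simp
    then have 1: "(coeff_norm + 1) * (sqrt (K n) * (real n powr (-1/4) + 1 / n)) \<le> (coeff_norm + 1) * (2 * sqrt (K n * real n powr (- 1 / 2 + \<beta>)))"
      using coeff_norm_nonneg by (intro mult_left_mono) auto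
    have "sqrt (K n) * 1 \<le> sqrt (K n) * sqrt (K n)" using K1 by (intro mult_left_mono) auto
    then have "sqrt (K n) \<le> K n" by simp
    then have 2: "sqrt (K n) * coeff_tail (real n powr \<beta>) \<le> K n * coeff_tail (real n powr \<beta>)"
      using coeff_tail_nonneg by (intro mult_right_mono) auto
    have "perturbation n = (coeff_norm + 1) * (sqrt (K n) * (real n powr (-1/4) + 1 / n)) + sqrt (K n) * coeff_tail (real n powr \<beta>)"
      unfolding perturbation_def by (simp only: distrib_left mult.left_commute)
    then show ?case using 1 2 by linarith
  qed
qed

text \<open>Because \<open>K\<^sub>n \<ge> 1\<close>, the rate condition forces \<open>\<beta> \<le> 1/2\<close>, and it also gives \<open>K\<^sub>n = O(n\<^bsup>1/2\<^esup>)\<close>. So all the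
frequencies at which \<open>S\<close> and \<open>N\<close> are evaluated are of order \<open>n\<^bsup>1/2\<^esup>\<close>.\<close>
lemma sampled_range: "\<forall>\<^sub>F n in sequentially. 2 * pi * (real n powr \<beta> * fs + K n * fmax) \<le> n"
proof -
  have fmax: "fmax > 0" using f0 fmin_pos by auto
  have "\<forall>\<^sub>F n in sequentially. K n * real n powr (- 1 / 2 + \<beta>) < 1"
    by (rule order_tendstoD(2)[OF K_times_rate]) simp
  moreover have "2 * pi * (fs + fmax) > 0" using fs_pos fmax by (intro mult_pos_pos) auto
  then have "\<forall>\<^sub>F n in sequentially. 2 * pi * (fs + fmax) * real n powr (1/2) \<le> n"
    by real_asymp
  ultimately show ?thesis using eventually_ge_at_top[of 2]
  proof eventually_elim
    case (elim n)
    have n: "real n > 1" using elim by simp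
    have K1: "real (K n) \<ge> 1" using K_pos[of n] elim by linarith
    have "1 * real n powr (- 1 / 2 + \<beta>) \<le> K n * real n powr (- 1 / 2 + \<beta>)" using K1 by (intro mult_right_mono) auto
    then have "real n powr (- 1 / 2 + \<beta>) < 1" using elim by linarith
    then have "real n powr (- 1 / 2 + \<beta>) < real n powr 0" using n by simp
    then have "- 1 / 2 + \<beta> < 0" by (simp only: powr_less_cancel_iff[OF n])
    then have b: "\<beta> \<le> 1 / 2" by linarith
    have "K n * real n powr (-1/2) \<le> K n * real n powr (- 1 / 2 + \<beta>)"
      using n beta_pos by (intro mult_left_mono powr_mono) auto
    then have "K n * real n powr (-1/2) \<le> 1" using elim by linarith
    then have "(K n * real n powr (-1/2)) * real n powr (1/2) \<le> 1 * real n powr (1/2)" by (intro mult_right_mono) auto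
    then have "real (K n) \<le> real n powr (1/2)" using n by (simp add: mult.assoc powr_add[symmetric])
    moreover have "real n powr \<beta> \<le> real n powr (1/2)" using n b by (intro powr_mono) auto
    ultimately have "real n powr \<beta> * fs + K n * fmax \<le> real n powr (1/2) * fs + real n powr (1/2) * fmax"
      using fs_pos fmax by (intro add_mono mult_right_mono) auto
    then have "2 * pi * (real n powr \<beta> * fs + K n * fmax) \<le> 2 * pi * (real n powr (1/2) * fs + real n powr (1/2) * fmax)"
      by (intro mult_left_mono) auto
    also have "\<dots> = 2 * pi * (fs + fmax) * real n powr (1/2)" by (simp only: distrib_left distrib_right mult_ac)
    finally show ?case using elim by linarith
  qed
qed

text \<open>If \<open>f\<close> were further than \<open>C r\<^sub>n\<close> from \<open>f\<^sub>0\<close>, some harmonic \<open>p\<^sub>0\<close> of the finite Bezout set would be out of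
resonance at scale \<open>r\<^sub>n\<close> and cost at least \<open>\<delta>\<close> in energy, while \<open>f\<^sub>0\<close> collects all but \<open>\<delta>/2\<close>; the
perturbation is too small to compensate. The constant \<open>C\<close> is chosen before the trajectory and before
\<open>r\<close>: this makes it possible to let \<open>r\<^sub>n = \<epsilon>/n\<close> with \<open>\<epsilon> \<rightarrow> 0\<close> at the end.\<close>
lemma maximizer_localized:
  "\<exists>C>0. \<forall>(x :: nat \<Rightarrow> real) (e :: nat \<Rightarrow> real) (r :: nat \<Rightarrow> real).
     (\<forall>\<^sub>F n in sequentially. \<forall>t. 2 * pi * \<tau> \<le> t \<and> t \<le> real n \<longrightarrow> cmod (trig_mean (\<lambda>_. 1) x n t) \<le> n powr (-1/4) + 1 / n) \<longrightarrow>
     (\<forall>\<^sub>F n in sequentially. \<forall>t. 0 \<le> t \<and> t \<le> real n \<longrightarrow> cmod (trig_mean e x n t) \<le> n powr (-1/4) + 1 / n) \<longrightarrow>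
     (\<exists>\<kappa>>0. \<forall>\<^sub>F n in sequentially. \<forall>t. r n \<le> t \<and> t \<le> real n \<longrightarrow> cmod (trig_mean (\<lambda>_. 1) x n t) \<le> 1 - \<kappa>) \<longrightarrow>
     (\<forall>\<^sub>F n in sequentially. r n > 0) \<longrightarrow> r \<longlonglongrightarrow> 0 \<longrightarrow>
     (\<forall>\<^sub>F n in sequentially. \<forall>f\<in>{fmin..fmax}.
        cumulated_periodogram (K n) n x (\<lambda>j. s (x j) + e j) f0 \<le> cumulated_periodogram (K n) n x (\<lambda>j. s (x j) + e j) f \<longrightarrow>
        \<bar>f - f0\<bar> \<le> C * r n)"
proof -
  obtain A a where A: "finite A" "A \<subseteq> {p::nat. p \<ge> 1 \<and> c (int p) \<noteq> 0}" and a: "(\<Sum>p\<in>A. a p * int p) = 1"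
    using bezout_nat_set[OF Gcd_harmonics] by blast
  have Ane: "A \<noteq> {}" using a by auto
  obtain C r0 where C: "C > 0" and r0: "r0 > 0"
    and res: "\<And>f r :: real. f \<in> {fmin..fmax} \<Longrightarrow> 0 < r \<Longrightarrow> r \<le> r0 \<Longrightarrow>
       (\<forall>p\<in>A. \<exists>k::nat. 2 * pi * \<bar>real p * fs - real k * f\<bar> < r) \<Longrightarrow> \<bar>f - f0\<bar> \<le> C * r"
    using resonance_forces_frequency[OF A(1) Ane a] by blast
  obtain l :: nat where l: "l \<ge> 1" "f0 = fs / l"
    using frequency_is_subharmonic[OF freq, of f0] f0 fmin_pos by auto
  show ?thesis
  proof (intro exI[of _ C] conjI C allI impI)
    fix x e r :: "nat \<Rightarrow> real"
    assume far: "\<forall>\<^sub>F n in sequentially. \<forall>t. 2 * pi * \<tau> \<le> t \<and> t \<le> real n \<longrightarrow> cmod (trig_mean (\<lambda>_. 1) x n t) \<le> n powr (-1/4) + 1 / n"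
      and noise: "\<forall>\<^sub>F n in sequentially. \<forall>t. 0 \<le> t \<and> t \<le> real n \<longrightarrow> cmod (trig_mean e x n t) \<le> n powr (-1/4) + 1 / n"
      and contr: "\<exists>\<kappa>>0. \<forall>\<^sub>F n in sequentially. \<forall>t. r n \<le> t \<and> t \<le> real n \<longrightarrow> cmod (trig_mean (\<lambda>_. 1) x n t) \<le> 1 - \<kappa>"
      and rpos: "\<forall>\<^sub>F n in sequentially. r n > 0" and rlim: "r \<longlonglongrightarrow> 0"
    obtain k0 where k0: "k0 > 0" and contr0: "\<forall>\<^sub>F n in sequentially. \<forall>t. r n \<le> t \<and> t \<le> real n \<longrightarrow> cmod (trig_mean (\<lambda>_. 1) x n t) \<le> 1 - k0"
      using contr by blast
    define \<kappa> where "\<kappa> = min k0 1"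
    have \<kappa>: "0 < \<kappa>" "\<kappa> \<le> 1" using k0 by (auto simp: \<kappa>_def)
    define \<rho> where "\<rho> = (1 - \<kappa>)\<^sup>2"
    have "(1 - \<kappa>)\<^sup>2 < 1\<^sup>2" using \<kappa> by (intro power_strict_mono) auto
    then have \<rho>: "0 \<le> \<rho>" "\<rho> < 1" by (auto simp: \<rho>_def)
    \<comment> \<open>The least energy that is lost when one of the harmonics in \<open>A\<close> is attenuated to the fraction \<open>\<rho>\<close>.\<close>
  define gm where "gm = Min (harmonic_energy ` A)"
    have "gm \<in> harmonic_energy ` A" unfolding gm_def using A Ane by (intro Min_in) auto
    then have gm_pos: "gm > 0" using A by (auto simp: harmonic_energy_def)
    have gm_le: "gm \<le> harmonic_energy p" if "p \<in> A" for p unfolding gm_def using A that by (intro Min_le) auto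
    define \<delta> where "\<delta> = (1 - \<rho>) * gm"
    have \<delta>: "\<delta> > 0" using \<rho> gm_pos by (simp add: \<delta>_def)
    then have "\<delta> / 2 > 0" by simp
    from sum_harmonic_energy_approx[OF this] obtain F where F: "finite F" "F \<subseteq> {1..}" "signal_energy - \<delta> / 2 \<le> sum harmonic_energy F" by blast
    define d where "d = sqrt (signal_energy - \<delta> / 2) - sqrt (signal_energy - \<delta>)"
    have d: "d > 0" using \<delta> by (simp add: d_def)
    have ev_pert: "\<forall>\<^sub>F n in sequentially. perturbation n < d / 2"
      by (rule order_tendstoD(2)[OF perturbation_tendsto_0]) (use d in simp)
    have ev_r: "\<forall>\<^sub>F n in sequentially. r n < r0"
      by (rule order_tendstoD(2)[OF rlim]) (use r0 in simp)
    have ev_tau: "\<forall>\<^sub>F n in sequentially. 2 * pi * \<tau> \<le> real n" by real_asymp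
    have ev_F1: "\<forall>\<^sub>F n in sequentially. \<forall>p\<in>F. real p \<le> real n powr \<beta>"
    proof (rule eventually_ball_finite[OF F(1)], rule ballI)
      fix p
      show "\<forall>\<^sub>F n in sequentially. real p \<le> real n powr \<beta>" using beta_pos by real_asymp
    qed
    have ev_F2: "\<forall>\<^sub>F n in sequentially. \<forall>p\<in>F. l * p \<le> K n"
      by (rule eventually_ball_finite[OF F(1)]) (use K_top in \<open>auto simp: filterlim_at_top\<close>)
    from far noise contr0 rpos ev_pert ev_r ev_tau ev_F1 ev_F2 sampled_range eventually_gt_at_top[of 0]
    show "\<forall>\<^sub>F n in sequentially. \<forall>f\<in>{fmin..fmax}.
        cumulated_periodogram (K n) n x (\<lambda>j. s (x j) + e j) f0 \<le> cumulated_periodogram (K n) n x (\<lambda>j. s (x j) + e j) f \<longrightarrow>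
        \<bar>f - f0\<bar> \<le> C * r n"
    proof eventually_elim
      case (elim n)
      let ?y = "\<lambda>j. s (x j) + e j"
      let ?m = "real n powr \<beta>"
      let ?q = "real n powr (-1/4) + 1 / n"
      let ?L = "\<lambda>f. L2_set (\<lambda>k. cmod (trig_mean ?y x n (- 2 * real k * pi * f))) {1..K n}"
      let ?E = "\<lambda>f. L2_set (\<lambda>k. cmod (resonant_part x n ?m f k)) {1..K n}"
      have app: "cmod (trig_mean ?y x n (- 2 * real k * pi * f) - resonant_part x n ?m f k) \<le> (coeff_norm + 1) * ?q + coeff_tail ?m"
        if "f \<in> {fmin..fmax}" "k \<in> {1..K n}" for f k
        by (rule resonant_part_approximates[where K="K n"]) (use that elim in auto)
      have up: "?L f \<le> ?E f + perturbation n" if "f \<in> {fmin..fmax}" for f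
        using L2_set_norm_triangle[OF app[OF that], of "{1..K n}"] by (simp add: perturbation_def)
      have lo: "?E f \<le> ?L f + perturbation n" if "f \<in> {fmin..fmax}" for f
        using L2_set_norm_triangle[of "{1..K n}" "\<lambda>k. resonant_part x n ?m f k" "\<lambda>k. trig_mean ?y x n (- 2 * real k * pi * f)" "(coeff_norm + 1) * ?q + coeff_tail ?m"]
          app[OF that] by (simp add: perturbation_def norm_minus_commute)
      show ?case
      proof (intro ballI impI, rule ccontr)
        fix f assume f: "f \<in> {fmin..fmax}"
          and ge: "cumulated_periodogram (K n) n x ?y f0 \<le> cumulated_periodogram (K n) n x ?y f"
          and not: "\<not> \<bar>f - f0\<bar> \<le> C * r n"
        obtain p0 where p0: "p0 \<in> A" "\<And>k::nat. r n \<le> 2 * pi * \<bar>real p0 * fs - real k * f\<bar>"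
          using res[OF f, of "r n"] not elim by (meson less_imp_le not_le)
        have "?E f \<le> sqrt (signal_energy - \<delta>)"
        proof -
          have "(\<Sum>k=1..K n. (cmod (resonant_part x n ?m f k))\<^sup>2) \<le> signal_energy - (1 - \<rho>) * harmonic_energy p0"
          proof (rule resonant_part_energy_le)
            fix k :: nat assume "\<bar>real p0 * fs - real k * f\<bar> < \<tau>"
            define t where "t = 2 * pi * (real p0 * fs - real k * f)"
            have t: "\<bar>t\<bar> = 2 * pi * \<bar>real p0 * fs - real k * f\<bar>" by (simp add: t_def abs_mult)
            have "\<bar>t\<bar> \<le> 2 * pi * \<tau>" unfolding t using \<open>_ < \<tau>\<close> by (intro mult_left_mono) auto
            then have "\<bar>t\<bar> \<le> n" using elim by linarith
            moreover have "r n \<le> \<bar>t\<bar>" using p0(2)[of k] by (simp only: t)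
            ultimately have "cmod (trig_mean (\<lambda>_. 1) x n \<bar>t\<bar>) \<le> 1 - k0" using elim by blast
            then have "cmod (trig_mean (\<lambda>_. 1) x n t) \<le> 1 - \<kappa>" by (simp add: cmod_trig_mean_abs \<kappa>_def)
            then show "(cmod (trig_mean (\<lambda>_. 1) x n (2 * pi * (real p0 * fs - real k * f))))\<^sup>2 \<le> \<rho>"
              unfolding \<rho>_def t_def by (intro power_mono) auto
          qed (use f A p0 \<rho> in auto)
          also have "\<dots> \<le> signal_energy - \<delta>" using gm_le[OF p0(1)] \<rho> by (simp add: \<delta>_def mult_left_mono)
          finally show ?thesis unfolding L2_set_def by (rule real_sqrt_le_mono)
        qed
        moreover have "sqrt (signal_energy - \<delta> / 2) \<le> ?E f0"
        proof -
          have "sum harmonic_energy F \<le> (\<Sum>k=1..K n. (cmod (resonant_part x n ?m f0 k))\<^sup>2)"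
            by (rule resonant_part_energy_ge[OF l F(1,2)]) (use elim in auto)
          then show ?thesis unfolding L2_set_def using F(3) by (intro real_sqrt_le_mono) linarith
        qed
        moreover have "?L f0 \<le> ?L f"
          using ge unfolding cumulated_periodogram_eq_L2_set[symmetric] by (rule real_sqrt_le_mono)
        moreover have "?E f0 \<le> ?L f0 + perturbation n" using f0 by (intro lo) auto
        moreover have "?L f \<le> ?E f + perturbation n" using f by (rule up)
        ultimately have "sqrt (signal_energy - \<delta> / 2) \<le> (sqrt (signal_energy - \<delta>) + perturbation n) + perturbation n"
          by (meson add_mono order_trans order_refl)
        then have "d / 2 \<le> perturbation n" unfolding d_def by simp
        then show False using elim(5) by linarith
      qed
    qed
  qed
qed

end

section \<open>Rates of convergence\<close>

text \<open>Almost sure convergence implies convergence in probability. The events are taken from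
index 1 on, where they are measurable.\<close>
lemma (in prob_space) AE_tendsto_0_imp_small_o_p:
  assumes m: "\<And>n. n \<ge> 1 \<Longrightarrow> random_variable borel (Z n)"
    and lim: "AE \<omega> in M. (\<lambda>n. Z n \<omega> / a n) \<longlonglongrightarrow> 0"
  shows "small_o_p M Z a"
  unfolding small_o_p_def
proof (intro allI impI)
  fix \<delta> :: real assume \<delta>: "\<delta> > 0"
  define E where "E n = {\<omega> \<in> space M. \<bar>Z n \<omega> / a n\<bar> > \<delta>}" for n
  have E [measurable]: "E (Suc n) \<in> events" for n
  proof -
    note m[of "Suc n", simplified, measurable]
    show ?thesis unfolding E_def by measurable
  qed
  have "(\<lambda>n. expectation (\<lambda>\<omega>. indicator (E (Suc n)) \<omega> :: real)) \<longlonglongrightarrow> expectation (\<lambda>\<omega>. 0 :: real)"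
  proof (rule integral_dominated_convergence[where w="\<lambda>_. 1"])
    show "AE \<omega> in M. (\<lambda>n. indicator (E (Suc n)) \<omega> :: real) \<longlonglongrightarrow> 0"
      using lim
    proof eventually_elim
      case (elim \<omega>)
      have "(\<lambda>n. \<bar>Z (Suc n) \<omega> / a (Suc n)\<bar>) \<longlonglongrightarrow> 0"
        using LIMSEQ_Suc[OF elim] by (rule tendsto_rabs_zero)
      then have "\<forall>\<^sub>F n in sequentially. \<bar>Z (Suc n) \<omega> / a (Suc n)\<bar> < \<delta>" by (rule order_tendstoD(2)) (rule \<delta>)
      then have "\<forall>\<^sub>F n in sequentially. indicator (E (Suc n)) \<omega> = (0 :: real)"
        by eventually_elim (simp add: E_def indicator_def)
      then show ?case by (rule tendsto_eventually)
    qed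
  qed auto
  then have "(\<lambda>n. prob (E (Suc n))) \<longlonglongrightarrow> 0" by simp
  then show "(\<lambda>n. prob {\<omega> \<in> space M. \<bar>Z n \<omega> / a n\<bar> > \<delta>}) \<longlonglongrightarrow> 0"
    unfolding E_def by (rule LIMSEQ_imp_Suc)
qed

theorem theorem1:
  fixes M :: "'a measure"
    and s :: "real \<Rightarrow> real"
    and V X eps Y fhat :: "nat \<Rightarrow> 'a \<Rightarrow> real"
    and K :: "nat \<Rightarrow> nat"
    and fstar sigma \<beta> fmin fmax f0 :: real
  assumes prob: "prob_space M"
    and s_nonconst: "\<not> s constant_on UNIV"
    and s_freq: "fundamental_frequency s fstar"
    and s_loc_int: "locally_integrable s"
    and s_fourier: "\<And>t. ((\<lambda>p::int. fourier_coeff (1 / fstar) s p * cis (2 * pi * of_int p * t / (1 / fstar)))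
                        has_sum complex_of_real (s t)) UNIV"
    and V_indep: "prob_space.indep_vars M (\<lambda>_. borel) V {1..}"
    and V_ident: "\<And>k. k \<ge> 1 \<Longrightarrow> distr M borel (V k) = distr M borel (V 1)"
    and V_nonneg: "\<And>k. k \<ge> 1 \<Longrightarrow> AE \<omega> in M. V k \<omega> \<ge> 0"
    and V_mean: "integrable M (V 1)"
    and V_char: "\<And>\<epsilon>. \<epsilon> > 0 \<Longrightarrow> (SUP t\<in>{t. \<bar>t\<bar> \<ge> \<epsilon>}. cmod (char (distr M borel (V 1)) t)) < 1"
    and X_def: "\<And>j \<omega>. X j \<omega> = (\<Sum>k=1..j. V k \<omega>)"
    and sigma_pos: "sigma > 0"
    and eps_indep: "prob_space.indep_vars M (\<lambda>_. borel) eps {1..}"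
    and eps_normal: "\<And>j. j \<ge> 1 \<Longrightarrow> distributed M lborel (eps j) (normal_density 0 sigma)"
    and eps_X_indep: "prob_space.indep_var M
           (\<Pi>\<^sub>M j\<in>{1..}. borel) (\<lambda>\<omega>. \<lambda>j\<in>{1..}. eps j \<omega>)
           (\<Pi>\<^sub>M j\<in>{1..}. borel) (\<lambda>\<omega>. \<lambda>j\<in>{1..}. X j \<omega>)"
    and Y_def: "\<And>j \<omega>. Y j \<omega> = s (X j \<omega>) + eps j \<omega>"
    and K_pos: "\<And>n. n \<ge> 1 \<Longrightarrow> K n > 0"
    and K_top: "filterlim K at_top sequentially"
    and beta_pos: "\<beta> > 0"
    and K_lim: "(\<lambda>n. of_nat (K n) * (fourier_tail (1 / fstar) s (real n powr \<beta>)
                        + ennreal (real n powr (- 1 / 2 + \<beta>)))) \<longlonglongrightarrow> 0"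
    and fmin_pos: "0 < fmin"
    and fmin_fmax: "fmin < fmax"
    and f0_unique: "\<exists>!f. f \<in> {fmin..fmax} \<and> has_period s (1 / f)"
    and f0: "f0 \<in> {fmin..fmax} \<and> has_period s (1 / f0)"
    and fhat_measurable: "\<And>n. n \<ge> 1 \<Longrightarrow> fhat n \<in> borel_measurable M"
    and fhat_range: "\<And>n \<omega>. n \<ge> 1 \<Longrightarrow> \<omega> \<in> space M \<Longrightarrow> fhat n \<omega> \<in> {fmin..fmax}"
    and fhat_max: "\<And>n \<omega>. n \<ge> 1 \<Longrightarrow> \<omega> \<in> space M \<Longrightarrow>
           cumulated_periodogram (K n) n (\<lambda>j. X j \<omega>) (\<lambda>j. Y j \<omega>) (fhat n \<omega>) =
           (SUP f\<in>{fmin..fmax}. cumulated_periodogram (K n) n (\<lambda>j. X j \<omega>) (\<lambda>j. Y j \<omega>) f)"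
  shows "(\<forall>\<alpha>>0. small_o_p M (\<lambda>n \<omega>. fhat n \<omega> - f0) (\<lambda>n. real n powr (- 1 + \<alpha>))) \<and>
         (integrable M (\<lambda>\<omega>. (V 1 \<omega>)\<^sup>2) \<longrightarrow>
            (AE \<omega> in M. (\<lambda>n. real n * (fhat n \<omega> - f0)) \<longlonglongrightarrow> 0))"
proof -
  have X: "(\<lambda>j. X j \<omega>) = walk (\<lambda>k. V k \<omega>)" for \<omega>
    by (simp add: fun_eq_iff X_def walk_def)
  have Xj: "X j \<omega> = walk (\<lambda>k. V k \<omega>) j" for j \<omega> by (simp add: X_def walk_def)
  interpret prob_space M by fact
  interpret noisy_walk M V eps sigma
  proof unfold_locales
    show "indep_var (\<Pi>\<^sub>M j\<in>{1..}. borel) (\<lambda>\<omega>. \<lambda>j\<in>{1..}. eps j \<omega>)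
           (\<Pi>\<^sub>M j\<in>{1..}. borel) (\<lambda>\<omega>. \<lambda>j\<in>{1..}. walk (\<lambda>k. V k \<omega>) j)"
      using eps_X_indep unfolding Xj .
  qed (fact V_indep V_ident V_nonneg V_mean V_char sigma_pos eps_indep eps_normal)+
  interpret periodogram_regime s fstar fmin fmax f0 K \<beta>
    by unfold_locales (fact s_nonconst s_freq s_fourier fmin_pos f0_unique f0 K_pos K_top beta_pos K_lim)+
  obtain C where C: "C > 0" and loc: "\<And>(x :: nat \<Rightarrow> real) (e :: nat \<Rightarrow> real) (r :: nat \<Rightarrow> real).
     (\<forall>\<^sub>F n in sequentially. \<forall>t. 2 * pi * \<tau> \<le> t \<and> t \<le> real n \<longrightarrow> cmod (trig_mean (\<lambda>_. 1) x n t) \<le> n powr (-1/4) + 1 / n) \<Longrightarrow>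
     (\<forall>\<^sub>F n in sequentially. \<forall>t. 0 \<le> t \<and> t \<le> real n \<longrightarrow> cmod (trig_mean e x n t) \<le> n powr (-1/4) + 1 / n) \<Longrightarrow>
     (\<exists>\<kappa>>0. \<forall>\<^sub>F n in sequentially. \<forall>t. r n \<le> t \<and> t \<le> real n \<longrightarrow> cmod (trig_mean (\<lambda>_. 1) x n t) \<le> 1 - \<kappa>) \<Longrightarrow>
     (\<forall>\<^sub>F n in sequentially. r n > 0) \<Longrightarrow> r \<longlonglongrightarrow> 0 \<Longrightarrow>
     (\<forall>\<^sub>F n in sequentially. \<forall>f\<in>{fmin..fmax}.
        cumulated_periodogram (K n) n x (\<lambda>j. s (x j) + e j) f0 \<le> cumulated_periodogram (K n) n x (\<lambda>j. s (x j) + e j) f \<longrightarrow>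
        \<bar>f - f0\<bar> \<le> C * r n)"
    using maximizer_localized by blast
  have rate: "AE \<omega> in M. \<forall>\<^sub>F n in sequentially. \<bar>fhat n \<omega> - f0\<bar> \<le> C * r n"
    if r: "\<forall>\<^sub>F n in sequentially. r n > 0" "r \<longlonglongrightarrow> 0" and k: "\<kappa> > 0"
      and contr: "AE \<omega> in M. \<forall>\<^sub>F n in sequentially. \<forall>t. r n \<le> t \<and> t \<le> real n \<longrightarrow> cmod (S \<omega> n t) \<le> 1 - \<kappa>"
    for r \<kappa>
  proof -
    have "2 * pi * \<tau> > 0" using \<tau>_pos by simp
    from AE_S_far[OF this] AE_N_small contr AE_space show ?thesis
    proof eventually_elim
      case (elim \<omega>)
      have "\<forall>\<^sub>F n in sequentially. \<forall>f\<in>{fmin..fmax}.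
          cumulated_periodogram (K n) n (walk (\<lambda>k. V k \<omega>)) (\<lambda>j. s (walk (\<lambda>k. V k \<omega>) j) + eps j \<omega>) f0
          \<le> cumulated_periodogram (K n) n (walk (\<lambda>k. V k \<omega>)) (\<lambda>j. s (walk (\<lambda>k. V k \<omega>) j) + eps j \<omega>) f \<longrightarrow>
          \<bar>f - f0\<bar> \<le> C * r n"
        by (rule loc[OF elim(1,2) _ r]) (use k elim(3) in blast)
      then show ?case using eventually_ge_at_top[of 1]
      proof eventually_elim
        case (elim n)
        have Y: "(\<lambda>j. Y j \<omega>) = (\<lambda>j. s (walk (\<lambda>k. V k \<omega>) j) + eps j \<omega>)"
          by (simp add: fun_eq_iff Y_def Xj)
        have "cumulated_periodogram (K n) n (\<lambda>j. X j \<omega>) (\<lambda>j. Y j \<omega>) f0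
            \<le> (SUP f\<in>{fmin..fmax}. cumulated_periodogram (K n) n (\<lambda>j. X j \<omega>) (\<lambda>j. Y j \<omega>) f)"
          by (rule cSUP_upper) (use f0 bdd_above_cumulated_periodogram in auto)
        also have "\<dots> = cumulated_periodogram (K n) n (\<lambda>j. X j \<omega>) (\<lambda>j. Y j \<omega>) (fhat n \<omega>)"
          by (rule fhat_max[symmetric]) (use elim \<open>\<omega> \<in> space M\<close> in auto)
        finally show ?case
          using elim(1) fhat_range[OF elim(2) \<open>\<omega> \<in> space M\<close>] unfolding X Y by blast
      qed
    qed
  qed
  show ?thesis
  proof (intro conjI allI impI)
    fix \<alpha> :: real assume \<alpha>: "\<alpha> > 0"
    \<comment> \<open>A rate \<open>-1 + a\<close> with \<open>0 < a < \<alpha>\<close>, so that the quotient by \<open>n\<^bsup>-1+\<alpha>\<^esup>\<close> vanishes, and \<open>a < 1\<close>, so that \<open>r\<^sub>n \<rightarrow> 0\<close>.\<close>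
    define a where "a = min (\<alpha> / 2) (1 / 2)"
    have a: "a > 0" "a < 1" "a - \<alpha> < 0" using \<alpha> by (auto simp: a_def min_def)
    have ev: "AE \<omega> in M. \<forall>\<^sub>F n in sequentially. \<bar>fhat n \<omega> - f0\<bar> \<le> C * real n powr (-1 + a)"
    proof (rule rate[of "\<lambda>n. real n powr (-1 + a)" "1/2"])
      show "\<forall>\<^sub>F n in sequentially. real n powr (-1 + a) > 0" using eventually_gt_at_top[of 0] by eventually_elim simp
      show "(\<lambda>n. real n powr (-1 + a)) \<longlonglongrightarrow> 0" using a by real_asymp
      show "AE \<omega> in M. \<forall>\<^sub>F n in sequentially. \<forall>t. real n powr (-1 + a) \<le> t \<and> t \<le> real n \<longrightarrow> cmod (S \<omega> n t) \<le> 1 - 1/2"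
        using AE_S_half[OF a(1)] by simp
    qed simp
    show "small_o_p M (\<lambda>n \<omega>. fhat n \<omega> - f0) (\<lambda>n. real n powr (- 1 + \<alpha>))"
    proof (rule AE_tendsto_0_imp_small_o_p)
      show "random_variable borel (\<lambda>\<omega>. fhat n \<omega> - f0)" if "n \<ge> 1" for n
        using fhat_measurable[OF that] by measurable
      show "AE \<omega> in M. (\<lambda>n. (fhat n \<omega> - f0) / real n powr (- 1 + \<alpha>)) \<longlonglongrightarrow> 0"
        using ev
      proof eventually_elim
        case (elim \<omega>)
        have "(\<lambda>n. C * real n powr (a - \<alpha>)) \<longlonglongrightarrow> 0" using a by real_asymp
        moreover have "\<forall>\<^sub>F n in sequentially. norm ((fhat n \<omega> - f0) / real n powr (- 1 + \<alpha>)) \<le> C * real n powr (a - \<alpha>)"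
          using elim eventually_gt_at_top[of 0]
        proof eventually_elim
          case (elim n)
          have "norm ((fhat n \<omega> - f0) / real n powr (- 1 + \<alpha>)) = \<bar>fhat n \<omega> - f0\<bar> / real n powr (- 1 + \<alpha>)"
            by (simp add: abs_divide)
          also have "\<dots> \<le> C * real n powr (-1 + a) / real n powr (- 1 + \<alpha>)"
            by (rule divide_right_mono) (use elim in auto)
          also have "\<dots> = C * (real n powr (-1 + a) / real n powr (- 1 + \<alpha>))" by simp
          also have "real n powr (-1 + a) / real n powr (- 1 + \<alpha>) = real n powr (a - \<alpha>)"
            unfolding powr_diff[symmetric] by simp
          finally show ?case .
        qed
        ultimately show ?case by (rule Lim_null_comparison[rotated])
      qed
    qed
  next
    assume sq: "integrable M (\<lambda>\<omega>. (V 1 \<omega>)\<^sup>2)"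
    have "AE \<omega> in M. \<forall>\<^sub>F n in sequentially. \<bar>fhat n \<omega> - f0\<bar> \<le> C * ((1 / real (Suc m)) / real n)" for m
    proof -
      obtain \<kappa> where \<kappa>: "\<kappa> > 0"
        and contr: "AE \<omega> in M. \<forall>\<^sub>F n in sequentially. \<forall>t. (1 / real (Suc m)) / n \<le> t \<and> t \<le> real n \<longrightarrow> cmod (S \<omega> n t) \<le> 1 - \<kappa>"
        using AE_S_contraction[OF sq, of "1 / real (Suc m)"] by auto
      show ?thesis
      proof (rule rate[OF _ _ \<kappa> contr])
        show "\<forall>\<^sub>F n in sequentially. 0 < (1 / real (Suc m)) / real n"
          using eventually_gt_at_top[of 0] by eventually_elim simp
        show "(\<lambda>n. (1 / real (Suc m)) / real n) \<longlonglongrightarrow> 0" by (rule lim_const_over_n)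
      qed
    qed
    then have "AE \<omega> in M. \<forall>m. \<forall>\<^sub>F n in sequentially. \<bar>fhat n \<omega> - f0\<bar> \<le> C * ((1 / real (Suc m)) / real n)"
      by (subst AE_all_countable) blast
    then show "AE \<omega> in M. (\<lambda>n. real n * (fhat n \<omega> - f0)) \<longlonglongrightarrow> 0"
    proof eventually_elim
      case (elim \<omega>)
      show ?case
      proof (rule LIMSEQ_I)
        fix \<epsilon> :: real assume "\<epsilon> > 0"
        then obtain m where "inverse (real (Suc m)) < \<epsilon> / C"
          using reals_Archimedean[of "\<epsilon> / C"] C by auto
        then have m: "C * (1 / real (Suc m)) < \<epsilon>" using C by (simp add: field_simps)
        from elim have "\<forall>\<^sub>F n in sequentially. \<bar>fhat n \<omega> - f0\<bar> \<le> C * ((1 / real (Suc m)) / real n)" by blast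
        then have "\<forall>\<^sub>F n in sequentially. norm (real n * (fhat n \<omega> - f0) - 0) < \<epsilon>"
          using eventually_gt_at_top[of 0]
        proof eventually_elim
          case (elim n)
          have "norm (real n * (fhat n \<omega> - f0) - 0) = real n * \<bar>fhat n \<omega> - f0\<bar>" by (simp add: abs_mult)
          also have "\<dots> \<le> real n * (C * ((1 / real (Suc m)) / real n))" by (rule mult_left_mono) (use elim in auto)
          also have "\<dots> = C * (1 / real (Suc m))" using elim by simp
          finally show ?case using m by linarith
        qed
        then show "\<exists>no. \<forall>n\<ge>no. norm (real n * (fhat n \<omega> - f0) - 0) < \<epsilon>"
          by (simp add: eventually_sequentially)
      qed
    qed
  qed
qed

end
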